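(* For each integer $n\ge 3$, there exist a compact connected $n$-dimensional spin manifold $\hat{X}$ with connected nonempty smooth boundary $\partial\hat X$ and a $1$-parameter family of Riemannian metrics $(\hat{g}_a)_{a>0}$ on $\hat{X}$ such that (i) the scalar curvature is bounded, $|\operatorname{scal}_{\hat{g}_a}|\leq C$ on $\hat X$, where the constant $C$ is independent of $a>0$; (ii) the Riemannian metric induced by $\hat g_a$ on the boundary $\partial \hat{X}$ is independent of $a$; (iii) $\int_{\partial \hat{X}}H_{\hat{g}_a}\to\infty$ as $a\to 0$; (iv) $\min_{\partial \hat{X}}H_{\hat{g}_a}\to-\infty$ as $a\to 0$. Moreover, if $n\ge 5$, then the data $\hat X$ and $(\hat g_a)_{a>0}$ satisfying (i)–(iv) can be chosen such that $\operatorname{scal}_{\hat{g}_a}$ has a uniform positive lower bound, i.e. there is a constant $\varepsilon>0$ independent of $a$ with $\operatorname{scal}_{\hat g_a}\ge\varepsilon$ on $\hat X$ for all $a>0$.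
   Context: $H_{\hat g_a}$ denotes the unnormalized mean curvature (the trace of the second fundamental form) of $\partial \hat X$ in $(\hat X,\hat g_a)$ with respect to the outward unit normal, with the sign convention that the boundary of a Euclidean ball of radius $r$ in $\mathbb{R}^n$ has mean curvature $(n-1)/r$. The integral over $\partial \hat X$ is with respect to the Riemannian volume measure of the metric induced by $\hat g_a$ on $\partial \hat X$. $\operatorname{scal}_{\hat g_a}$ is the scalar curvature of $(\hat X,\hat g_a)$. *)

theory Defs
  imports "HOL-Analysis.Analysis"
begin

section \<open>Smooth maps\<close>

fun Ck_on :: "nat \<Rightarrow> 'a::euclidean_space set \<Rightarrow> ('a \<Rightarrow> 'b::real_normed_vector) \<Rightarrow> bool" where
  "Ck_on 0 U f \<longleftrightarrow> continuous_on U f"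
| "Ck_on (Suc k) U f \<longleftrightarrow> f differentiable_on U \<and>
     (\<forall>i\<in>Basis. Ck_on k U (\<lambda>x. frechet_derivative f (at x) i))"

text \<open>On a set that need not be open, smoothness means that the map extends locally to
  a smooth map on an open set.\<close>

definition smooth_on :: "'a::euclidean_space set \<Rightarrow> ('a \<Rightarrow> 'b::real_normed_vector) \<Rightarrow> bool" where
  "smooth_on S f \<longleftrightarrow>
     (\<forall>x\<in>S. \<exists>U F. open U \<and> x \<in> U \<and> (\<forall>k. Ck_on k U F) \<and> (\<forall>y\<in>S \<inter> U. F y = f y))"


section \<open>Smooth manifolds with boundary\<close>

text \<open>The coordinates of a manifold of dimension \<open>CARD('m) + 1\<close> are indexed by
  \<^typ>\<open>'m option\<close>: the index \<^term>\<open>None\<close> is the coordinate that vanishes on the boundary and is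
  positive in the interior, and the indices \<^term>\<open>Some j\<close> are tangential to the boundary.
  All derivatives are taken within the half-space, which determines them also at
  its boundary points.\<close>

definition half_space :: "(real ^ ('m::finite option)) set" where
  "half_space = {x. 0 \<le> x $ None}"

text \<open>A chart is its domain together with its coordinate map; the values of the map outside
  the domain are irrelevant.\<close>

type_synonym ('a, 'm) chart = "'a set \<times> ('a \<Rightarrow> real ^ ('m option))"

definition is_chart :: "'a topology \<Rightarrow> ('a, 'm::finite) chart \<Rightarrow> bool" where
  "is_chart T c \<longleftrightarrow>
     openin T (fst c) \<and>
     openin (top_of_set half_space) (snd c ` fst c) \<and>
     homeomorphic_map (subtopology T (fst c)) (top_of_set (snd c ` fst c)) (snd c)"

definition transition ::
  "('a, 'm::finite) chart \<Rightarrow> ('a, 'm) chart \<Rightarrow> real ^ ('m option) \<Rightarrow> real ^ ('m option)" where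
  "transition c d = snd c \<circ> inv_into (fst d) (snd d)"

definition transition_jacobian ::
  "('a, 'm::finite) chart \<Rightarrow> ('a, 'm) chart \<Rightarrow> 'a \<Rightarrow> real ^ ('m option) ^ ('m option)" where
  "transition_jacobian c d p = jacobian (transition c d) (at (snd d p) within half_space)"

definition smooth_atlas :: "'a topology \<Rightarrow> ('a, 'm::finite) chart set \<Rightarrow> bool" where
  "smooth_atlas T A \<longleftrightarrow>
     (\<forall>c\<in>A. is_chart T c) \<and> (\<Union>c\<in>A. fst c) = topspace T \<and>
     (\<forall>c\<in>A. \<forall>d\<in>A. smooth_on (snd d ` (fst c \<inter> fst d)) (transition c d))"

definition smooth_manifold :: "'a topology \<Rightarrow> ('a, 'm::finite) chart set \<Rightarrow> bool" where
  "smooth_manifold T A \<longleftrightarrow> Hausdorff_space T \<and> second_countable T \<and> smooth_atlas T A"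

definition boundary :: "('a, 'm::finite) chart set \<Rightarrow> 'a set" where
  "boundary A = {p. \<exists>c\<in>A. p \<in> fst c \<and> snd c p $ None = 0}"

definition chart_at :: "('a, 'm::finite) chart set \<Rightarrow> 'a \<Rightarrow> ('a, 'm) chart" where
  "chart_at A p = (SOME c. c \<in> A \<and> p \<in> fst c)"


section \<open>Riemannian metrics\<close>

text \<open>A metric is given by its components in each chart, as functions of the coordinates,
  subject to the tensor transformation law.\<close>

type_synonym 'm coord_metric = "real ^ ('m option) \<Rightarrow> real ^ ('m option) ^ ('m option)"

type_synonym ('a, 'm) metric_components = "('a, 'm) chart \<Rightarrow> 'm coord_metric"

definition riemannian_metric ::
  "('a, 'm::finite) chart set \<Rightarrow> ('a, 'm) metric_components \<Rightarrow> bool" where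
  "riemannian_metric A g \<longleftrightarrow>
     (\<forall>c\<in>A. smooth_on (snd c ` fst c) (g c) \<and>
        (\<forall>x\<in>snd c ` fst c. transpose (g c x) = g c x \<and>
           (\<forall>v. v \<noteq> 0 \<longrightarrow> 0 < v \<bullet> (g c x *v v)))) \<and>
     (\<forall>c\<in>A. \<forall>d\<in>A. \<forall>p\<in>fst c \<inter> fst d.
        g d (snd d p) =
          transpose (transition_jacobian c d p) ** g c (snd c p) ** transition_jacobian c d p)"


section \<open>Scalar curvature\<close>

definition pderiv_hs ::
  "'m::finite option \<Rightarrow> (real ^ ('m option) \<Rightarrow> real) \<Rightarrow> real ^ ('m option) \<Rightarrow> real" where
  "pderiv_hs i f x = frechet_derivative f (at x within half_space) (axis i 1)"

text \<open>\<open>christoffel G k i j\<close> is the coefficient of \<open>\<partial>\<^sub>k\<close> in \<open>\<nabla>\<^sub>i \<partial>\<^sub>j\<close>.\<close>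

definition christoffel ::
  "'m::finite coord_metric \<Rightarrow> 'm option \<Rightarrow> 'm option \<Rightarrow> 'm option \<Rightarrow> real ^ ('m option) \<Rightarrow> real" where
  "christoffel G k i j x =
     (1/2) * (\<Sum>l\<in>UNIV. matrix_inv (G x) $ k $ l *
       (pderiv_hs i (\<lambda>y. G y $ j $ l) x + pderiv_hs j (\<lambda>y. G y $ i $ l) x
        - pderiv_hs l (\<lambda>y. G y $ i $ j) x))"

text \<open>\<open>riemann G l k i j\<close> is the coefficient of \<open>\<partial>\<^sub>l\<close> in \<open>R(\<partial>\<^sub>i, \<partial>\<^sub>j) \<partial>\<^sub>k\<close>, where
  \<open>R(X, Y) = \<nabla>\<^sub>X \<nabla>\<^sub>Y - \<nabla>\<^sub>Y \<nabla>\<^sub>X - \<nabla>\<^bsub>[X, Y]\<^esub>\<close>.\<close>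

definition riemann ::
  "'m::finite coord_metric \<Rightarrow> 'm option \<Rightarrow> 'm option \<Rightarrow> 'm option \<Rightarrow> 'm option
    \<Rightarrow> real ^ ('m option) \<Rightarrow> real" where
  "riemann G l k i j x =
     pderiv_hs i (christoffel G l j k) x - pderiv_hs j (christoffel G l i k) x
     + (\<Sum>p\<in>UNIV. christoffel G l i p x * christoffel G p j k x
                - christoffel G l j p x * christoffel G p i k x)"

definition ricci ::
  "'m::finite coord_metric \<Rightarrow> 'm option \<Rightarrow> 'm option \<Rightarrow> real ^ ('m option) \<Rightarrow> real" where
  "ricci G j k x = (\<Sum>i\<in>UNIV. riemann G i k i j x)"

definition coord_scal :: "'m::finite coord_metric \<Rightarrow> real ^ ('m option) \<Rightarrow> real" where
  "coord_scal G x = (\<Sum>j\<in>UNIV. \<Sum>k\<in>UNIV. matrix_inv (G x) $ j $ k * ricci G j k x)"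

text \<open>By tensoriality the choice of chart is immaterial, here and for the mean curvature.\<close>

definition scal ::
  "('a, 'm::finite) chart set \<Rightarrow> ('a, 'm) metric_components \<Rightarrow> 'a \<Rightarrow> real" where
  "scal A g p = (let c = chart_at A p in coord_scal (g c) (snd c p))"


section \<open>Geometry of the boundary\<close>

definition induced_metric ::
  "'m::finite coord_metric \<Rightarrow> real ^ ('m option) \<Rightarrow> real ^ 'm ^ 'm" where
  "induced_metric G x = (\<chi> i j. G x $ Some i $ Some j)"

text \<open>The outward unit normal is minus the normalised gradient of the coordinate \<^term>\<open>None\<close>.\<close>

definition outward_normal ::
  "'m::finite coord_metric \<Rightarrow> real ^ ('m option) \<Rightarrow> real ^ ('m option)" where
  "outward_normal G x =
     (\<chi> k. - (matrix_inv (G x) $ k $ None / sqrt (matrix_inv (G x) $ None $ None)))"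

text \<open>\<open>II(\<partial>\<^sub>i, \<partial>\<^sub>j) = g(\<nabla>\<^sub>i \<nu>, \<partial>\<^sub>j) = - g(\<nu>, \<nabla>\<^sub>i \<partial>\<^sub>j)\<close> for the outward unit normal \<open>\<nu>\<close> and tangential
  \<open>i\<close>, \<open>j\<close>; with this sign the boundary of a Euclidean ball has positive mean curvature.\<close>

definition second_fundamental_form ::
  "'m::finite coord_metric \<Rightarrow> 'm \<Rightarrow> 'm \<Rightarrow> real ^ ('m option) \<Rightarrow> real" where
  "second_fundamental_form G i j x =
     - (outward_normal G x \<bullet> (G x *v (\<chi> k. christoffel G k (Some i) (Some j) x)))"

definition coord_mean_curvature :: "'m::finite coord_metric \<Rightarrow> real ^ ('m option) \<Rightarrow> real" where
  "coord_mean_curvature G x =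
     (\<Sum>i\<in>UNIV. \<Sum>j\<in>UNIV. matrix_inv (induced_metric G x) $ i $ j * second_fundamental_form G i j x)"

definition mean_curvature ::
  "('a, 'm::finite) chart set \<Rightarrow> ('a, 'm) metric_components \<Rightarrow> 'a \<Rightarrow> real" where
  "mean_curvature A g p = (let c = chart_at A p in coord_mean_curvature (g c) (snd c p))"

definition tangential :: "real ^ ('m::finite option) \<Rightarrow> real ^ 'm" where
  "tangential x = (\<chi> j. x $ Some j)"

definition from_tangential :: "real ^ 'm::finite \<Rightarrow> real ^ ('m option)" where
  "from_tangential y = (\<chi> i. case i of None \<Rightarrow> 0 | Some j \<Rightarrow> y $ j)"

definition is_boundary_volume ::
  "'a topology \<Rightarrow> ('a, 'm::finite) chart set \<Rightarrow> ('a, 'm) metric_components \<Rightarrow> 'a measure \<Rightarrow> bool" where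
  "is_boundary_volume T A g \<mu> \<longleftrightarrow>
     space \<mu> = boundary A \<and>
     sets \<mu> = sigma_sets (boundary A) {B. openin (subtopology T (boundary A)) B} \<and>
     (\<forall>c\<in>A. \<forall>B\<in>sets \<mu>. B \<subseteq> fst c \<longrightarrow>
        emeasure \<mu> B =
          (\<integral>\<^sup>+ y \<in> tangential ` snd c ` B.
             ennreal (sqrt (det (induced_metric (g c) (from_tangential y)))) \<partial>lborel))"

text \<open>The Riemannian volume measure of the boundary. The local formula determines it because
  the boundary is covered by countably many charts.\<close>

definition boundary_volume ::
  "'a topology \<Rightarrow> ('a, 'm::finite) chart set \<Rightarrow> ('a, 'm) metric_components \<Rightarrow> 'a measure" where
  "boundary_volume T A g = (THE \<mu>. is_boundary_volume T A g \<mu>)"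


section \<open>Spin structures\<close>

text \<open>The real Clifford algebra on an orthonormal basis \<open>e\<^sub>i\<close> with \<open>e\<^sub>i e\<^sub>i = -1\<close>: the component with
  index \<open>S\<close> is the coefficient of the ordered product of the \<open>e\<^sub>i\<close> with \<open>i \<in> S\<close>, where the indices
  are ordered by \<^const>\<open>to_nat\<close>. Reordering \<open>e\<^sub>S e\<^sub>T\<close> gives one sign for each pair \<open>i \<in> S\<close>, \<open>j \<in> T\<close> with
  \<open>i > j\<close>, and one sign for each common index.\<close>

type_synonym 'k clifford = "real ^ ('k set)"

definition cl_sign :: "'k::finite set \<Rightarrow> 'k set \<Rightarrow> real" where
  "cl_sign S T = (-1) ^ card {(i, j). i \<in> S \<and> j \<in> T \<and> to_nat j \<le> to_nat i}"

definition cl_mult :: "'k::finite clifford \<Rightarrow> 'k clifford \<Rightarrow> 'k clifford" where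
  "cl_mult a b =
     (\<chi> R. \<Sum>(S, T) | (S - T) \<union> (T - S) = R. cl_sign S T * (a $ S) * (b $ T))"

definition cl_one :: "'k::finite clifford" where
  "cl_one = axis {} 1"

definition cl_vec :: "real ^ 'k::finite \<Rightarrow> 'k clifford" where
  "cl_vec v = (\<Sum>i\<in>UNIV. v $ i *\<^sub>R axis {i} 1)"

definition Spin :: "'k::finite clifford set" where
  "Spin = {foldr (\<lambda>v. cl_mult (cl_vec v)) vs cl_one | vs. even (length vs) \<and> (\<forall>v\<in>set vs. norm v = 1)}"

text \<open>\<open>R\<close> is the image of \<open>s\<close> under the double covering \<open>Spin(n) \<rightarrow> SO(n)\<close>, that is
  \<open>s v s\<^sup>-\<^sup>1 = R v\<close> for all vectors \<open>v\<close>.\<close>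

definition spin_covers :: "'k::finite clifford \<Rightarrow> real ^ 'k ^ 'k \<Rightarrow> bool" where
  "spin_covers s R \<longleftrightarrow>
     s \<in> Spin \<and> (\<forall>v. cl_mult s (cl_vec v) = cl_mult (cl_vec (R *v v)) s)"

definition oriented_atlas :: "'a topology \<Rightarrow> ('a, 'm::finite) chart set \<Rightarrow> bool" where
  "oriented_atlas T B \<longleftrightarrow> smooth_atlas T B \<and>
     (\<forall>c\<in>B. \<forall>d\<in>B. \<forall>p\<in>fst c \<inter> fst d. 0 < det (transition_jacobian c d p))"

text \<open>The columns of \<open>E c x\<close> are the components in the chart \<open>c\<close> of a positively oriented
  orthonormal frame.\<close>

definition oriented_orthonormal_frames ::
  "('a, 'm::finite) chart set \<Rightarrow> ('a, 'm) metric_components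
    \<Rightarrow> (('a, 'm) chart \<Rightarrow> real ^ ('m option) \<Rightarrow> real ^ ('m option) ^ ('m option)) \<Rightarrow> bool" where
  "oriented_orthonormal_frames B g E \<longleftrightarrow>
     (\<forall>c\<in>B. smooth_on (snd c ` fst c) (E c) \<and>
        (\<forall>x\<in>snd c ` fst c. transpose (E c x) ** g c x ** E c x = mat 1 \<and> 0 < det (E c x)))"

definition frame_transition ::
  "(('a, 'm::finite) chart \<Rightarrow> real ^ ('m option) \<Rightarrow> real ^ ('m option) ^ ('m option))
    \<Rightarrow> ('a, 'm) chart \<Rightarrow> ('a, 'm) chart \<Rightarrow> 'a \<Rightarrow> real ^ ('m option) ^ ('m option)" where
  "frame_transition E c d p =
     matrix_inv (E c (snd c p)) ** transition_jacobian c d p ** E d (snd d p)"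

text \<open>A spin structure, given by its transition functions: a lift of an \<open>SO(n)\<close>-cocycle of the
  oriented orthonormal frame bundle to a \<open>Spin(n)\<close>-cocycle. The atlas \<open>B\<close> may be finer than the
  given atlas \<open>A\<close>, because the principal bundles need not be trivial over the charts of \<open>A\<close>.\<close>

definition spin_manifold :: "'a topology \<Rightarrow> ('a, 'm::finite) chart set \<Rightarrow> bool" where
  "spin_manifold T A \<longleftrightarrow> smooth_manifold T A \<and>
     (\<exists>B g E s.
        oriented_atlas T B \<and> smooth_atlas T (A \<union> B) \<and>
        riemannian_metric B g \<and> oriented_orthonormal_frames B g E \<and>
        (\<forall>c\<in>B. \<forall>d\<in>B. continuous_map (subtopology T (fst c \<inter> fst d)) euclidean (s c d)) \<and>
        (\<forall>c\<in>B. \<forall>d\<in>B. \<forall>p\<in>fst c \<inter> fst d. spin_covers (s c d p) (frame_transition E c d p)) \<and>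
        (\<forall>c\<in>B. \<forall>d\<in>B. \<forall>e\<in>B. \<forall>p\<in>fst c \<inter> fst d \<inter> fst e.
           cl_mult (s c d p) (s d e p) = s c e p))"

end

theory Submission
  imports Defs
begin

text \<open>
  Let \<open>M\<close> be the product of a circle with coordinate \<open>y\<close> and the round sphere of dimension \<open>n - 2\<close>,
  and let \<open>\<tau>\<close> be the free involution of \<open>M\<close> that shifts \<open>y\<close> by \<open>\<pi>\<close> and reflects the sphere. The
  quotient \<open>X\<close> of \<open>[-1, 1] \<times> M\<close> by \<open>(x, m) \<mapsto> (-x, \<tau> m)\<close> is orientable, and its boundary is one copy of \<open>M\<close>.
  Put \<open>f = \<delta> cos y\<close>, so that \<open>x f\<close> is invariant, and let
  \<open>g\<^sub>a = a\<^sup>2 exp (n x f) dx\<^sup>2 + exp (2 x f) h\<close>, where \<open>h\<close> is the product metric of \<open>M\<close>.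

  The lapse \<open>a exp (n x f / 2)\<close> solves the equation which says that the terms of order \<open>a\<^sup>-\<^sup>2\<close> in the
  scalar curvature cancel, as in a Kasner metric. What remains does not depend on \<open>a\<close> and is a small perturbation
  of the scalar curvature \<open>(n - 2) (n - 3)\<close> of the sphere. The boundary metric \<open>exp (2 f) h\<close> does not depend
  on \<open>a\<close> either, but the mean curvature is \<open>(n - 1) f exp (- n f / 2) / a\<close>. It is negative where \<open>cos y < 0\<close>,
  and its integral is \<open>(n - 1) / a\<close> times that of \<open>f exp ((n - 2) f / 2)\<close>, which is positive since \<open>f\<close>
  is odd under \<open>\<tau>\<close> and \<open>n > 2\<close>.

  For the spin structure the coordinate frames of stereographic charts are used. Their transition functions
  are half turns in a fixed plane and products of two reflections, which have explicit lifts.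
\<close>

section \<open>Smooth functions\<close>

text \<open>For a lapse u the part of the scalar curvature that carries u^-2 is (n - 1) f (2 u_x / u
  - n f) / u^2, because f does not depend on x; solving for u gives the exponent n/2. So a rescales
  the normal direction freely: the mean curvature grows like 1/a while the scalar curvature does not
  notice. The integral has a sign because the weights do not match: the area of the boundary carries
  exp((n - 1) f), the mean curvature only exp(- n f / 2), so the half with f > 0 outweighs the half
  with f < 0. The slab itself would have two boundary components; the quotient exchanges them, and x
  f descends since both factors change sign. Everything is computed in charts, so these are chosen
  to make the metric diagonal in each of them and to make every change of orthonormal frame a
  product of an even number of reflections. Two obstacles remain. The boundary measure is given by a
  description, hence has to be constructed and shown to be unique, and comparing the two
  stereographic charts requires the change of variables for an inversion.\<close>

lemma frechet_derivative_cong_open: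
  assumes "open U" "x \<in> U" "\<And>y. y \<in> U \<Longrightarrow> f y = g y"
  shows "frechet_derivative f (at x) = frechet_derivative g (at x)"
proof -
  have "(f has_derivative D) (at x) \<longleftrightarrow> (g has_derivative D) (at x)" for D
    using assms has_derivative_transform_within_open by metis
  then show ?thesis
    unfolding frechet_derivative_def by simp
qed

lemma Ck_on_cong:
  assumes "open U" "\<And>y. y \<in> U \<Longrightarrow> f y = g y"
  shows "Ck_on k U f \<longleftrightarrow> Ck_on k U g"
  using assms(2)
proof (induction k arbitrary: f g)
  case 0
  then show ?case by (simp cong: continuous_on_cong)
next
  case (Suc k)
  have "f differentiable_on U \<longleftrightarrow> g differentiable_on U"
    unfolding differentiable_on_def using Suc.prems
    by (metis differentiable_transform_within zero_less_one)
  moreover have "Ck_on k U (\<lambda>x. frechet_derivative f (at x) i)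
      \<longleftrightarrow> Ck_on k U (\<lambda>x. frechet_derivative g (at x) i)" for i
    by (intro Suc.IH) (metis frechet_derivative_cong_open[OF assms(1)] Suc.prems)
  ultimately show ?case by simp
qed

text \<open>On an open set the Frechet derivative is unique, so any closed form \<open>f'\<close>
  may replace the \<open>frechet_derivative\<close> in \<open>Ck_on\<close>. The closure rules below
  run their inductions through this rule.\<close>

lemma Ck_on_SucI:
  assumes "open U" "\<And>x. x \<in> U \<Longrightarrow> (f has_derivative f' x) (at x)"
    and "\<And>i. i \<in> Basis \<Longrightarrow> Ck_on k U (\<lambda>x. f' x i)"
  shows "Ck_on (Suc k) U f"
proof -
  have "frechet_derivative f (at x) = f' x" if "x \<in> U" for x
    using assms(2)[OF that] by (metis frechet_derivative_at)
  then have "Ck_on k U (\<lambda>x. frechet_derivative f (at x) i)" if "i \<in> Basis" for i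
    using Ck_on_cong[OF assms(1)] assms(3)[OF that] by (smt (verit))
  moreover have "f differentiable_on U"
    using assms(2) unfolding differentiable_on_def differentiable_def
    by (meson has_derivative_at_withinI)
  ultimately show ?thesis by simp
qed

lemma Ck_on_Suc_has_derivative:
  assumes "open U" "Ck_on (Suc k) U f" "x \<in> U"
  shows "(f has_derivative frechet_derivative f (at x)) (at x)"
  using assms by (simp add: differentiable_on_eq_differentiable_at frechet_derivative_works[symmetric])

lemma Ck_on_Suc_imp:
  assumes "open U" "Ck_on (Suc k) U f"
  shows "Ck_on k U f"
  using assms(2)
proof (induction k arbitrary: f)
  case 0
  then show ?case by (simp add: differentiable_imp_continuous_on)
next
  case (Suc k)
  then show ?case by (metis Ck_on.simps(2))
qed

lemma Ck_on_const: "open U \<Longrightarrow> Ck_on k U (\<lambda>x. c)"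
proof (induction k arbitrary: c)
  case (Suc k)
  then show ?case
    by (intro Ck_on_SucI[where f' = "\<lambda>_ _. 0"]) auto
qed simp

lemma Ck_on_linear:
  assumes "open U" "bounded_linear L"
  shows "Ck_on k U L"
proof (cases k)
  case 0
  then show ?thesis using linear_continuous_on[OF assms(2)] by simp
next
  case (Suc l)
  then show ?thesis
    using Ck_on_SucI[OF assms(1), of L "\<lambda>_. L"] assms
    by (simp add: bounded_linear_imp_has_derivative Ck_on_const del: Ck_on.simps)
qed

lemma Ck_on_add:
  assumes "open U" "Ck_on k U f" "Ck_on k U g"
  shows "Ck_on k U (\<lambda>x. f x + g x)"
  using assms(2,3)
proof (induction k arbitrary: f g)
  case 0
  then show ?case by (simp add: continuous_on_add)
next
  case (Suc k)
  show ?case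
  proof (rule Ck_on_SucI[OF assms(1)])
    show "((\<lambda>x. f x + g x) has_derivative (\<lambda>h. frechet_derivative f (at x) h + frechet_derivative g (at x) h)) (at x)"
      if "x \<in> U" for x
      using Ck_on_Suc_has_derivative[OF assms(1) _ that] Suc.prems by (intro has_derivative_add) blast+
    show "Ck_on k U (\<lambda>x. frechet_derivative f (at x) i + frechet_derivative g (at x) i)" if "i \<in> Basis" for i
      using Suc.IH Suc.prems that by simp
  qed
qed

lemma Ck_on_mult:
  fixes f g :: "'a::euclidean_space \<Rightarrow> real"
  assumes "open U" "Ck_on k U f" "Ck_on k U g"
  shows "Ck_on k U (\<lambda>x. f x * g x)"
  using assms(2,3)
proof (induction k arbitrary: f g)
  case 0
  then show ?case by (simp add: continuous_on_mult)
next
  case (Suc k)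
  show ?case
  proof (rule Ck_on_SucI[OF assms(1)])
    show "((\<lambda>x. f x * g x) has_derivative
        (\<lambda>h. f x * frechet_derivative g (at x) h + frechet_derivative f (at x) h * g x)) (at x)"
      if "x \<in> U" for x
      using Ck_on_Suc_has_derivative[OF assms(1) _ that] Suc.prems by (intro has_derivative_mult) blast+
    show "Ck_on k U (\<lambda>x. f x * frechet_derivative g (at x) i + frechet_derivative f (at x) i * g x)"
      if "i \<in> Basis" for i
      using Suc.prems that
      by (intro Ck_on_add[OF assms(1)] Suc.IH Ck_on_Suc_imp[OF assms(1) Suc.prems(1)]
          Ck_on_Suc_imp[OF assms(1) Suc.prems(2)]) simp_all
  qed
qed

text \<open>The outer function is presented as the sequence \<open>d\<close> of its successive
  derivatives, so that the induction on \<open>k\<close> can pass from \<open>d n\<close> to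
  \<open>d (Suc n)\<close> with \<open>n\<close> arbitrary.\<close>

lemma Ck_on_compose_real:
  fixes f :: "'a::euclidean_space \<Rightarrow> real" and d :: "nat \<Rightarrow> real \<Rightarrow> real"
  assumes "open U" "Ck_on k U f" "\<And>n x. x \<in> U \<Longrightarrow> (d n has_real_derivative d (Suc n) (f x)) (at (f x))"
  shows "Ck_on k U (\<lambda>x. d n (f x))"
  using assms(2)
proof (induction k arbitrary: n)
  case 0
  have "isCont (d n) (f x)" if "x \<in> U" for x
    using assms(3)[OF that] DERIV_isCont by blast
  then show ?case
    using 0 by (simp add: continuous_on_eq_continuous_at[OF assms(1)] continuous_at_compose[unfolded o_def])
next
  case (Suc k)
  show ?case
  proof (rule Ck_on_SucI[OF assms(1)])
    show "((\<lambda>x. d n (f x)) has_derivative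
        (\<lambda>h. frechet_derivative f (at x) h * d (Suc n) (f x))) (at x)"
      if "x \<in> U" for x
      using Ck_on_Suc_has_derivative[OF assms(1) Suc.prems that] assms(3)[OF that]
      by (rule DERIV_compose_FDERIV[rotated])
    show "Ck_on k U (\<lambda>x. frechet_derivative f (at x) i * d (Suc n) (f x))"
      if "i \<in> Basis" for i
      using Suc.prems that
      by (intro Ck_on_mult[OF assms(1)] Suc.IH Ck_on_Suc_imp[OF assms(1) Suc.prems]) simp
  qed
qed

lemma Ck_on_exp:
  fixes f :: "'a::euclidean_space \<Rightarrow> real"
  assumes "open U" "Ck_on k U f"
  shows "Ck_on k U (\<lambda>x. exp (f x))"
  using Ck_on_compose_real[OF assms, of "\<lambda>_. exp"] DERIV_exp by blast

lemma Ck_on_cos: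
  fixes f :: "'a::euclidean_space \<Rightarrow> real"
  assumes "open U" "Ck_on k U f"
  shows "Ck_on k U (\<lambda>x. cos (f x))"
proof -
  \<comment> \<open>Differentiating the cosine shifts its argument by pi/2, so one formula gives the
    whole sequence.\<close>
  let ?d = "\<lambda>n x::real. cos (x + of_nat n * pi / 2)"
  have "(?d n has_real_derivative ?d (Suc n) x) (at x)" for n x
  proof -
    have "?d (Suc n) x = cos ((x + of_nat n * pi / 2) + pi/2)"
      by (simp add: field_simps)
    also have "\<dots> = - sin (x + of_nat n * pi / 2)"
      by (simp add: cos_add)
    finally show ?thesis by (auto intro!: derivative_eq_intros)
  qed
  from Ck_on_compose_real[OF assms, of ?d 0] this show ?thesis by simp
qed

lemma Ck_on_inverse:
  fixes f :: "'a::euclidean_space \<Rightarrow> real"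
  assumes "open U" "Ck_on k U f" "\<And>x. x \<in> U \<Longrightarrow> f x \<noteq> 0"
  shows "Ck_on k U (\<lambda>x. inverse (f x))"
proof -
  let ?d = "\<lambda>n x::real. (-1)^n * fact n * inverse x ^ Suc n"
  have "(?d n has_real_derivative ?d (Suc n) x) (at x)" if "x \<noteq> 0" for n x
    using DERIV_cmult[OF DERIV_power_Suc[OF DERIV_inverse[OF that], of n], of "(-1)^n * fact n"]
    by (simp add: algebra_simps)
  from Ck_on_compose_real[OF assms(1,2), of ?d 0] this assms(3) show ?thesis by simp
qed

lemma has_derivative_vec:
  fixes f :: "'a::real_normed_vector \<Rightarrow> ('b::euclidean_space) ^ 'n"
  assumes "\<And>i. ((\<lambda>x. f x $ i) has_derivative (\<lambda>h. f' h $ i)) (at a within S)"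
  shows "(f has_derivative f') (at a within S)"
proof (subst has_derivative_componentwise_within, intro ballI)
  fix b :: "'b ^ 'n" assume "b \<in> Basis"
  then obtain i u where b: "b = axis i u" by (auto simp: Basis_vec_def)
  show "((\<lambda>x. f x \<bullet> b) has_derivative (\<lambda>x. f' x \<bullet> b)) (at a within S)"
    using has_derivative_inner_left[OF assms[of i], of u] by (simp add: b inner_axis)
qed

lemma Ck_on_vec:
  fixes f :: "'a::euclidean_space \<Rightarrow> ('b::euclidean_space) ^ 'n"
  assumes "open U" "\<And>i. Ck_on k U (\<lambda>x. f x $ i)"
  shows "Ck_on k U f"
  using assms(2)
proof (induction k arbitrary: f)
  case 0
  then show ?case using continuous_on_vec_lambda[of U "\<lambda>i x. f x $ i"] by simp
next
  case (Suc k)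
  show ?case
  proof (rule Ck_on_SucI[OF assms(1)])
    show "(f has_derivative (\<lambda>h. \<chi> i. frechet_derivative (\<lambda>x. f x $ i) (at x) h)) (at x)" if "x \<in> U" for x
      using Ck_on_Suc_has_derivative[OF assms(1) Suc.prems that] 
      by (intro has_derivative_vec) (simp del: Ck_on.simps)
    show "Ck_on k U (\<lambda>x. \<chi> i. frechet_derivative (\<lambda>x. f x $ i) (at x) b)" if "b \<in> Basis" for b
      using Suc.prems that by (intro Suc.IH) simp
  qed
qed

lemma smooth_on_open:
  assumes "open U" "\<And>k. Ck_on k U f" "S \<subseteq> U"
  shows "smooth_on S f"
  unfolding smooth_on_def using assms by blast

section \<open>Curvature of diagonal metrics\<close>

definition diag :: "('n \<Rightarrow> real) \<Rightarrow> real ^ 'n ^ 'n" where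
  "diag d = (\<chi> i j. if i = j then d i else 0)"

lemma diag_nth [simp]: "diag d $ i $ j = (if i = j then d i else 0)"
  by (simp add: diag_def)

lemma transpose_diag [simp]: "transpose (diag d) = diag d"
  by (simp add: transpose_def vec_eq_iff)

lemma diag_mult_nth: "(diag d ** A) $ i $ j = d i * A $ i $ j"
proof -
  have "(diag d ** A) $ i $ j = (\<Sum>k\<in>UNIV. if i = k then d i * A $ k $ j else 0)"
    by (simp add: matrix_matrix_mult_def if_distrib if_distribR cong: if_cong)
  then show ?thesis by simp
qed

lemma mult_diag_nth: "(A ** diag d) $ i $ j = A $ i $ j * d j"
proof -
  have "(A ** diag d) $ i $ j = (\<Sum>k\<in>UNIV. if k = j then A $ i $ k * d k else 0)"
    by (simp add: matrix_matrix_mult_def if_distrib if_distribR cong: if_cong)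
  then show ?thesis by simp
qed

lemma diag_mult_vec_nth: "(diag d *v x) $ i = d i * x $ i"
proof -
  have "(diag d *v x) $ i = (\<Sum>k\<in>UNIV. if i = k then d i * x $ k else 0)"
    by (simp add: matrix_vector_mult_def if_distrib if_distribR cong: if_cong)
  then show ?thesis by simp
qed

lemma matrix_inv_eqI:
  fixes A B :: "real ^ 'n ^ 'n"
  assumes "A ** B = mat 1"
  shows "matrix_inv A = B"
proof -
  have BA: "B ** A = mat 1" using assms by (simp add: matrix_left_right_inverse)
  have "A ** matrix_inv A = mat 1 \<and> matrix_inv A ** A = mat 1"
    unfolding matrix_inv_def by (rule someI[of _ B]) (use assms BA in simp)
  then show ?thesis
    by (metis BA matrix_mul_assoc matrix_mul_lid matrix_mul_rid)
qed

lemma matrix_inv_diag: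
  assumes "\<And>i. d i \<noteq> 0"
  shows "matrix_inv (diag d) = diag (\<lambda>i. inverse (d i))"
  using assms by (intro matrix_inv_eqI) (simp add: vec_eq_iff diag_mult_nth mat_def)

lemma det_diag: "det (diag d) = (\<Prod>i\<in>UNIV. d i)"
  by (subst det_diagonal) auto

section \<open>Derivatives within the half-space\<close>

lemma has_derivative_half_space_unique:
  fixes f :: "real ^ ('m::finite option) \<Rightarrow> 'b::real_normed_vector"
  assumes "x \<in> half_space" "(f has_derivative D) (at x within half_space)"
    and "(f has_derivative D') (at x within half_space)"
  shows "D = D'"
proof (rule frechet_derivative_unique_within[OF assms(2,3)])
  fix i :: "real ^ ('m option)" and e :: real
  assume "i \<in> Basis" "0 < e"
  then obtain k where i: "i = axis k 1" by (auto simp: Basis_vec_def)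
  \<comment> \<open>The displacement is taken positive: it then stays in the half-space even at a
    boundary point in direction \<open>None\<close>, and one side is enough for uniqueness.\<close>
  show "\<exists>d. 0 < \<bar>d\<bar> \<and> \<bar>d\<bar> < e \<and> x + d *\<^sub>R i \<in> half_space"
    using \<open>0 < e\<close> assms(1) by (intro exI[of _ "e/2"]) (auto simp: i half_space_def axis_def)
qed

lemma pderiv_hs_eq:
  assumes "x \<in> half_space" "(f has_derivative D) (at x within half_space)"
  shows "pderiv_hs i f x = D (axis i 1)"
proof -
  have "(f has_derivative frechet_derivative f (at x within half_space)) (at x within half_space)"
    using assms(2) by (metis differentiable_def frechet_derivative_works)
  then show ?thesis
    using has_derivative_half_space_unique[OF assms(1) _ assms(2)] by (simp add: pderiv_hs_def)
qed

text \<open>Agreement on the half-space is enough for derivatives within it. This matters for second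
  derivatives of the metric: the formula for the Christoffel symbols, which is differentiated again,
  is known only there.\<close>

lemma pderiv_hs_eq_on:
  assumes "x \<in> half_space" "(g has_derivative D) (at x)" "\<And>y. y \<in> half_space \<Longrightarrow> f y = g y"
  shows "pderiv_hs i f x = D (axis i 1)"
proof (rule pderiv_hs_eq[OF assms(1)])
  show "(f has_derivative D) (at x within half_space)"
    using has_derivative_transform[OF assms(1,3) has_derivative_at_withinI[OF assms(2)]] .
qed

lemma sum_axis_mult [simp]:
  "(\<Sum>k\<in>UNIV. axis i (1::real) $ k * a k) = a (i::'n::finite)"
proof -
  have "(\<Sum>k\<in>UNIV. axis i (1::real) $ k * a k) = (\<Sum>k\<in>UNIV. if k = i then a k else 0)"
    by (intro sum.cong) (auto simp: axis_def)
  then show ?thesis by simp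
qed

text \<open>The metric is the sum of exp(2 \<phi>_i) dx_i^2; \<open>D1 i j\<close> is the derivative
  of \<phi>_j in direction i, and \<open>D2 l i j\<close> differentiates this in direction l. With
  logarithms as unknowns the curvature is, apart from exponential weights, quadratic in
  \<open>D1\<close> and linear in \<open>D2\<close>.\<close>

context
  fixes \<phi> :: "'m::finite option \<Rightarrow> real ^ ('m option) \<Rightarrow> real"
    and D1 :: "'m option \<Rightarrow> 'm option \<Rightarrow> real ^ ('m option) \<Rightarrow> real"
    and D2 :: "'m option \<Rightarrow> 'm option \<Rightarrow> 'm option \<Rightarrow> real ^ ('m option) \<Rightarrow> real"
    and G :: "'m coord_metric"
  assumes D1: "\<And>x j. (\<phi> j has_derivative (\<lambda>h. \<Sum>i\<in>UNIV. h $ i * D1 i j x)) (at x)"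
    and D2: "\<And>x i j. (D1 i j has_derivative (\<lambda>h. \<Sum>l\<in>UNIV. h $ l * D2 l i j x)) (at x)"
    and G_eq: "\<And>x. G x = diag (\<lambda>i. exp (2 * \<phi> i x))"
begin

lemma matrix_inv_diag_metric: "matrix_inv (G x) = diag (\<lambda>i. exp (- 2 * \<phi> i x))"
  by (simp add: G_eq matrix_inv_diag exp_minus)

lemma pderiv_diag_metric:
  assumes "x \<in> half_space"
  shows "pderiv_hs i (\<lambda>y. G y $ j $ l) x = (if j = l then 2 * D1 i j x * exp (2 * \<phi> j x) else 0)"
proof (cases "j = l")
  case True
  have "((\<lambda>y. exp (2 * \<phi> j y)) has_derivative
      (\<lambda>h. (2 * (\<Sum>i\<in>UNIV. h $ i * D1 i j x)) * exp (2 * \<phi> j x))) (at x)"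
    by (intro has_derivative_exp has_derivative_mult_right D1)
  from pderiv_hs_eq_on[OF assms this, of "\<lambda>y. G y $ j $ l" i] True
  show ?thesis by (simp add: G_eq)
next
  case False
  then show ?thesis
    using pderiv_hs_eq_on[OF assms has_derivative_const[of 0], of "\<lambda>y. G y $ j $ l" i] by (simp add: G_eq)
qed

lemma christoffel_diag_metric:
  assumes "x \<in> half_space"
  shows "christoffel G k i j x = (if j = k then D1 i k x else 0) + (if i = k then D1 j k x else 0)
    - (if i = j then exp (2 * \<phi> i x - 2 * \<phi> k x) * D1 k i x else 0)"
proof -
  let ?S = "\<lambda>l. pderiv_hs i (\<lambda>y. G y $ j $ l) x + pderiv_hs j (\<lambda>y. G y $ i $ l) x
      - pderiv_hs l (\<lambda>y. G y $ i $ j) x"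
  have "christoffel G k i j x = (1/2) * (\<Sum>l\<in>UNIV. if k = l then exp (- 2 * \<phi> k x) * ?S k else 0)"
    unfolding christoffel_def matrix_inv_diag_metric by (intro arg_cong2[where f="(*)"] sum.cong) auto
  also have "\<dots> = exp (- 2 * \<phi> k x) * ?S k / 2"
    by simp
  also have "\<dots> = (if j = k then D1 i k x else 0) + (if i = k then D1 j k x else 0)
    - (if i = j then exp (2 * \<phi> i x - 2 * \<phi> k x) * D1 k i x else 0)"
    unfolding pderiv_diag_metric[OF assms]
    by (auto simp: field_simps exp_diff exp_minus)
  finally show ?thesis .
qed

lemma pderiv_christoffel_diag_metric:
  assumes "x \<in> half_space"
  shows "pderiv_hs l (christoffel G k i j) x = (if j = k then D2 l i k x else 0)
    + (if i = k then D2 l j k x else 0)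
    - (if i = j then exp (2 * \<phi> i x - 2 * \<phi> k x) *
        (D2 l k i x + 2 * (D1 l i x - D1 l k x) * D1 k i x) else 0)"
proof -
  let ?g = "\<lambda>x. of_bool (j = k) * D1 i k x + of_bool (i = k) * D1 j k x
    - of_bool (i = j) * (exp (2 * \<phi> i x - 2 * \<phi> k x) * D1 k i x)"
  let ?D = "\<lambda>f h. \<Sum>l\<in>UNIV. h $ l * f l x"
  have "(?g has_derivative (\<lambda>h. of_bool (j = k) * ?D (\<lambda>l. D2 l i k) h + of_bool (i = k) * ?D (\<lambda>l. D2 l j k) h
    - of_bool (i = j) * (exp (2 * \<phi> i x - 2 * \<phi> k x) * ?D (\<lambda>l. D2 l k i) h
       + (2 * ?D (\<lambda>l. D1 l i) h - 2 * ?D (\<lambda>l. D1 l k) h) * exp (2 * \<phi> i x - 2 * \<phi> k x) * D1 k i x))) (at x)"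
    by (intro has_derivative_diff has_derivative_add has_derivative_mult_right has_derivative_mult
        has_derivative_exp D1 D2)
  from pderiv_hs_eq_on[OF assms this, of "christoffel G k i j" l]
  have "pderiv_hs l (christoffel G k i j) x = of_bool (j = k) * D2 l i k x + of_bool (i = k) * D2 l j k x
    - of_bool (i = j) * (exp (2 * \<phi> i x - 2 * \<phi> k x) * D2 l k i x
       + (2 * D1 l i x - 2 * D1 l k x) * exp (2 * \<phi> i x - 2 * \<phi> k x) * D1 k i x)"
    by (simp add: christoffel_diag_metric)
  then show ?thesis by (auto simp: algebra_simps)
qed

text \<open>The left side is the sectional curvature of the plane of the coordinate fields i and j:
  \<open>riemann G i j i j\<close> is the i-th coefficient of R(i, j) j, and \<open>w j\<close>
  divides by the squared length of the field j.\<close>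

lemma riemann_diag_metric:
  assumes x: "x \<in> half_space" and ij: "i \<noteq> j"
  defines "A \<equiv> \<lambda>i j. D2 i i j x + (D1 i j x)\<^sup>2 - D1 i i x * D1 i j x"
    and "w \<equiv> \<lambda>i. exp (- 2 * \<phi> i x)"
  shows "w j * riemann G i j i j x = - w i * A i j - w j * A j i
    - (\<Sum>p\<in>-{i,j}. w p * D1 p i x * D1 p j x)"
proof -
  define E where "E i j = exp (2 * \<phi> i x - 2 * \<phi> j x)" for i j
  have wE: "w j * E j p = w p" for p
    by (simp add: w_def E_def exp_diff exp_minus field_simps)
  have split: "(\<Sum>p\<in>UNIV. f p) = f i + f j + (\<Sum>p\<in>-{i,j}. f p)" for f :: "'m option \<Rightarrow> real"
  proof -
    have "UNIV = insert i (insert j (-{i,j}))" by auto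
    then have "(\<Sum>p\<in>UNIV. f p) = (\<Sum>p\<in>insert i (insert j (-{i,j})). f p)" by metis
    then show ?thesis using ij by simp
  qed
  note ch = christoffel_diag_metric[OF x, folded E_def]
  have "(\<Sum>p\<in>-{i,j}. christoffel G i i p x * christoffel G p j j x - christoffel G i j p x * christoffel G p i j x)
      = (\<Sum>p\<in>-{i,j}. - (E j p * D1 p i x * D1 p j x))"
    using ij by (intro sum.cong) (auto simp: ch)
  also have "\<dots> = - (\<Sum>p\<in>-{i,j}. E j p * D1 p i x * D1 p j x)" by (simp add: sum_negf)
  finally have "riemann G i j i j x =
     - E j i * (D2 i i j x + 2 * (D1 i j x - D1 i i x) * D1 i j x) - D2 j j i x
     + (D1 i i x * (- E j i * D1 i j x) - D1 j i x * D1 j i x)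
     + (D1 j i x * D1 j j x + E j i * D1 i j x * D1 i j x)
     - (\<Sum>p\<in>-{i,j}. E j p * D1 p i x * D1 p j x)"
    using ij unfolding riemann_def split
    by (simp add: ch pderiv_christoffel_diag_metric[OF x, folded E_def]) (simp add: E_def)
  also have "\<dots> = - E j i * A i j - A j i - (\<Sum>p\<in>-{i,j}. E j p * D1 p i x * D1 p j x)"
    by (simp add: A_def algebra_simps power2_eq_square)
  finally have R: "riemann G i j i j x = - E j i * A i j - A j i - (\<Sum>p\<in>-{i,j}. E j p * D1 p i x * D1 p j x)" .
  have "w j * riemann G i j i j x = - (w j * E j i) * A i j - w j * A j i
     - (\<Sum>p\<in>-{i,j}. (w j * E j p) * D1 p i x * D1 p j x)"
    unfolding R by (simp add: right_diff_distrib sum_distrib_left mult.assoc)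
  then show ?thesis by (simp only: wE)
qed

text \<open>The sectional curvatures are regrouped by their weights exp(- 2 \<phi>_i). Each
  direction i then contributes a term with derivatives in direction i only, so that the cancellation
  in direction x can be checked on its own.\<close>

lemma coord_scal_diag_metric:
  assumes x: "x \<in> half_space"
  shows "coord_scal G x = - (\<Sum>i\<in>UNIV. exp (- 2 * \<phi> i x) *
    ((\<Sum>j\<in>-{i}. 2 * (D2 i i j x - D1 i i x * D1 i j x) + (D1 i j x)\<^sup>2) + (\<Sum>j\<in>-{i}. D1 i j x)\<^sup>2))"
proof -
  define A where "A \<equiv> \<lambda>i j. D2 i i j x + (D1 i j x)\<^sup>2 - D1 i i x * D1 i j x"
  define w where "w \<equiv> \<lambda>i. exp (- 2 * \<phi> i x)"
  define d where "d \<equiv> \<lambda>p i. D1 p i x"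
  have diagR: "riemann G i i i i x = 0" for i by (simp add: riemann_def)
  have off: "(\<Sum>i\<in>UNIV. f i) = (\<Sum>i\<in>-{j}. f i)" if "f j = 0" for f :: "'m option \<Rightarrow> real" and j
    using that by (intro sum.mono_neutral_right) auto
  have compl: "(\<Sum>i\<in>-{j}. f i) = (\<Sum>i\<in>UNIV. if i = j then 0 else f i)" for f :: "'m option \<Rightarrow> real" and j
    by (rule sum.mono_neutral_cong_left) auto
  have sw: "(\<Sum>j\<in>UNIV. \<Sum>i\<in>-{j}. f i j) = (\<Sum>j\<in>UNIV. \<Sum>i\<in>-{j}. f j i)"
    for f :: "'m option \<Rightarrow> 'm option \<Rightarrow> real"
    unfolding compl by (subst sum.swap) (auto intro!: sum.cong)
  have "coord_scal G x = (\<Sum>j\<in>UNIV. \<Sum>k\<in>UNIV. if j = k then w j * ricci G j k x else 0)"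
    unfolding coord_scal_def matrix_inv_diag_metric by (intro sum.cong) (auto simp: w_def)
  also have "\<dots> = (\<Sum>j\<in>UNIV. w j * ricci G j j x)"
    by simp
  also have "\<dots> = (\<Sum>j\<in>UNIV. \<Sum>i\<in>-{j}. w j * riemann G i j i j x)"
    unfolding ricci_def sum_distrib_left by (intro sum.cong off) (auto simp: diagR)
  also have "\<dots> = (\<Sum>j\<in>UNIV. \<Sum>i\<in>-{j}. - w i * A i j - w j * A j i - (\<Sum>p\<in>-{i,j}. w p * d p i * d p j))"
    using riemann_diag_metric[OF x] by (intro sum.cong refl) (auto simp: w_def A_def d_def)
  also have "\<dots> = - (\<Sum>j\<in>UNIV. \<Sum>i\<in>-{j}. w i * A i j) - (\<Sum>j\<in>UNIV. \<Sum>i\<in>-{j}. w j * A j i)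
      - (\<Sum>j\<in>UNIV. \<Sum>i\<in>-{j}. \<Sum>p\<in>-{i,j}. w p * d p i * d p j)"
    by (simp add: sum_subtractf sum_negf)
  also have "(\<Sum>j\<in>UNIV. \<Sum>i\<in>-{j}. w i * A i j) = (\<Sum>i\<in>UNIV. \<Sum>j\<in>-{i}. w i * A i j)"
    by (rule sw)
  \<comment> \<open>With p outermost, i and j run over distinct indices other than p, and such
    products add up to the square of a sum minus the sum of the squares.\<close>
  also have "(\<Sum>j\<in>UNIV. \<Sum>i\<in>-{j}. \<Sum>p\<in>-{i,j}. w p * d p i * d p j)
      = (\<Sum>i\<in>UNIV. w i * ((\<Sum>j\<in>-{i}. d i j)\<^sup>2 - (\<Sum>j\<in>-{i}. (d i j)\<^sup>2)))"
  proof -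
    have compl2: "(\<Sum>p\<in>-{i,j}. f p) = (\<Sum>p\<in>UNIV. if p = i \<or> p = j then 0 else f p)"
      for f :: "'m option \<Rightarrow> real" and i j
      by (rule sum.mono_neutral_cong_left) auto
    have "(\<Sum>j\<in>UNIV. \<Sum>i\<in>-{j}. \<Sum>p\<in>-{i,j}. w p * d p i * d p j)
       = (\<Sum>j\<in>UNIV. \<Sum>i\<in>UNIV. \<Sum>p\<in>UNIV. if i = j \<or> p = i \<or> p = j then 0 else w p * d p i * d p j)"
      unfolding compl compl2 by (intro sum.cong refl) auto
    also have "\<dots> = (\<Sum>j\<in>UNIV. \<Sum>p\<in>UNIV. \<Sum>i\<in>UNIV. if i = j \<or> p = i \<or> p = j then 0 else w p * d p i * d p j)"
      by (intro sum.cong refl sum.swap)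
    also have "\<dots> = (\<Sum>p\<in>UNIV. \<Sum>j\<in>UNIV. \<Sum>i\<in>UNIV. if i = j \<or> p = i \<or> p = j then 0 else w p * d p i * d p j)"
      by (rule sum.swap)
    also have "\<dots> = (\<Sum>p\<in>UNIV. w p * ((\<Sum>j\<in>-{p}. d p j)\<^sup>2 - (\<Sum>j\<in>-{p}. (d p j)\<^sup>2)))"
    proof (rule sum.cong[OF refl])
      fix p
      \<comment> \<open>The value 0 at p lets the sums over i and j run over all indices.\<close>
      define u where "u \<equiv> \<lambda>j. if j = p then 0 else d p j"
      have "(if i = j \<or> p = i \<or> p = j then 0 else w p * d p i * d p j)
          = w p * (u i * u j - (if i = j then u j * u j else 0))" for i j
        by (auto simp: u_def)
      then have "(\<Sum>j\<in>UNIV. \<Sum>i\<in>UNIV. if i = j \<or> p = i \<or> p = j then 0 else w p * d p i * d p j)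
          = w p * ((\<Sum>j\<in>UNIV. \<Sum>i\<in>UNIV. u i * u j) - (\<Sum>j\<in>UNIV. u j * u j))"
        by (simp add: sum_distrib_left[symmetric] sum_subtractf)
      also have "(\<Sum>j\<in>UNIV. \<Sum>i\<in>UNIV. u i * u j) = (\<Sum>j\<in>UNIV. u j)\<^sup>2"
        by (simp add: power2_eq_square sum_distrib_left sum_distrib_right)
      finally show "(\<Sum>j\<in>UNIV. \<Sum>i\<in>UNIV. if i = j \<or> p = i \<or> p = j then 0 else w p * d p i * d p j)
          = w p * ((\<Sum>j\<in>-{p}. d p j)\<^sup>2 - (\<Sum>j\<in>-{p}. (d p j)\<^sup>2))"
        unfolding compl by (simp add: u_def power2_eq_square if_distrib cong: if_cong)
    qed
    finally show ?thesis .
  qed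
  finally have S: "coord_scal G x = - (\<Sum>i\<in>UNIV. w i * ((\<Sum>j\<in>-{i}. 2 * A i j)
      + (\<Sum>j\<in>-{i}. d i j)\<^sup>2 - (\<Sum>j\<in>-{i}. (d i j)\<^sup>2)))"
    by (simp add: sum.distrib sum_subtractf ring_distribs flip: sum_distrib_left)
      (simp add: sum_distrib_left mult.left_commute)
  have T: "(\<Sum>j\<in>-{i}. 2 * A i j) + (\<Sum>j\<in>-{i}. d i j)\<^sup>2 - (\<Sum>j\<in>-{i}. (d i j)\<^sup>2)
     = (\<Sum>j\<in>-{i}. 2 * (D2 i i j x - D1 i i x * D1 i j x) + (D1 i j x)\<^sup>2) + (\<Sum>j\<in>-{i}. D1 i j x)\<^sup>2" for i
  proof -
    have "(\<Sum>j\<in>-{i}. 2 * A i j) - (\<Sum>j\<in>-{i}. (d i j)\<^sup>2)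
      = (\<Sum>j\<in>-{i}. 2 * (D2 i i j x - D1 i i x * D1 i j x) + (D1 i j x)\<^sup>2)"
      by (simp only: sum_subtractf[symmetric] A_def d_def) (simp add: algebra_simps)
    then show ?thesis by (simp add: d_def)
  qed
  show ?thesis by (simp only: S T w_def)
qed

text \<open>The outward unit normal is - exp(- \<phi>_None) times the coordinate field of
  \<open>None\<close>, and the mean curvature is the derivative along it of the logarithm of the
  tangential volume, which is the sum of the tangential \<phi>_i.\<close>

lemma coord_mean_curvature_diag_metric:
  assumes x: "x \<in> half_space"
  shows "coord_mean_curvature G x = - exp (- \<phi> None x) * (\<Sum>i\<in>UNIV. D1 None (Some i) x)"
proof -
  have inv: "matrix_inv (induced_metric G x) = diag (\<lambda>i. exp (- 2 * \<phi> (Some i) x))"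
  proof -
    have "induced_metric G x = diag (\<lambda>i. exp (2 * \<phi> (Some i) x))"
      by (simp add: induced_metric_def G_eq vec_eq_iff)
    then show ?thesis by (simp add: matrix_inv_diag exp_minus)
  qed
  have nu: "outward_normal G x $ k = (if k = None then - exp (- \<phi> None x) else 0)" for k
  proof -
    have "sqrt (exp (- (2 * \<phi> None x))) = exp (- \<phi> None x)"
      by (rule real_sqrt_unique) (simp_all flip: exp_double)
    then show ?thesis
      by (simp add: outward_normal_def matrix_inv_diag_metric flip: exp_diff)
  qed
  have "second_fundamental_form G i i x = - exp (2 * \<phi> (Some i) x - \<phi> None x) * D1 None (Some i) x" for i
  proof -
    have "outward_normal G x \<bullet> (G x *v (\<chi> k. christoffel G k (Some i) (Some i) x))
      = (\<Sum>k\<in>(UNIV :: 'm option set). if k = None then - exp (- \<phi> None x) * (exp (2 * \<phi> None x) *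
           christoffel G None (Some i) (Some i) x) else 0)"
      unfolding inner_vec_def by (intro sum.cong) (auto simp: nu G_eq diag_mult_vec_nth)
    also have "\<dots> = exp (2 * \<phi> (Some i) x - \<phi> None x) * D1 None (Some i) x"
      by (simp add: christoffel_diag_metric[OF x] flip: exp_add)
    finally show ?thesis by (simp add: second_fundamental_form_def)
  qed
  moreover have "coord_mean_curvature G x
      = (\<Sum>i\<in>UNIV. exp (- 2 * \<phi> (Some i) x) * second_fundamental_form G i i x)"
  proof -
    have "coord_mean_curvature G x = (\<Sum>i\<in>UNIV. \<Sum>j\<in>UNIV.
        if i = j then exp (- 2 * \<phi> (Some i) x) * second_fundamental_form G i i x else 0)"
      unfolding coord_mean_curvature_def inv by (intro sum.cong) auto
    then show ?thesis by simp
  qed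
  ultimately have "coord_mean_curvature G x
      = (\<Sum>i\<in>UNIV. - (exp (- 2 * \<phi> (Some i) x) * exp (2 * \<phi> (Some i) x - \<phi> None x)) * D1 None (Some i) x)"
    by (simp add: algebra_simps)
  also have "\<dots> = (\<Sum>i\<in>UNIV. - exp (- \<phi> None x) * D1 None (Some i) x)"
    by (simp flip: exp_add)
  finally show ?thesis by (simp add: sum_distrib_left)
qed

end

section \<open>Clifford algebra\<close>

text \<open>As a product over pairs the sign is visibly multiplicative in each argument with respect
  to symmetric difference, that is, a bicharacter. Associativity of the product rests on
  this.\<close>

lemma cl_sign_prod:
  "cl_sign S T = (\<Prod>i\<in>S. \<Prod>j\<in>T. if to_nat j \<le> to_nat i then -1 else 1)"
proof -
  let ?q = "\<lambda>(i, j). if to_nat j \<le> to_nat i then -1 else (1::real)"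
  have fin: "finite (S \<times> T)" by simp
  have "(\<Prod>i\<in>S. \<Prod>j\<in>T. if to_nat j \<le> to_nat i then -1 else (1::real)) = prod ?q (S \<times> T)"
    by (simp add: prod.cartesian_product)
  also have "\<dots> = (\<Prod>x\<in>{x \<in> S \<times> T. to_nat (snd x) \<le> to_nat (fst x)}. -1)"
    using fin by (intro prod.mono_neutral_cong_right) (auto split: if_splits)
  also have "{x \<in> S \<times> T. to_nat (snd x) \<le> to_nat (fst x)}
      = {(i, j). i \<in> S \<and> j \<in> T \<and> to_nat j \<le> to_nat i}" by auto
  finally show ?thesis by (simp add: cl_sign_def)
qed

text \<open>Elements of the intersection occur twice on the right and contribute squares, which are
  1.\<close>

lemma prod_sym_diff_sign:
  fixes f :: "'k::finite \<Rightarrow> real"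
  assumes "\<And>i. f i * f i = 1"
  shows "prod f (sym_diff S T) = prod f S * prod f T"
proof -
  have "prod f S = prod f (S - T) * prod f (S \<inter> T)"
    using prod.Int_Diff[of S f T] by (simp add: mult.commute)
  moreover have "prod f T = prod f (T - S) * prod f (S \<inter> T)"
    using prod.Int_Diff[of T f S] by (simp add: mult.commute Int_commute)
  moreover have "prod f (sym_diff S T) = prod f (S - T) * prod f (T - S)"
    by (rule prod.union_disjoint) auto
  moreover have "prod f (S \<inter> T) * prod f (S \<inter> T) = 1"
    by (simp add: assms flip: prod.distrib)
  ultimately show ?thesis by (simp add: algebra_simps)
qed

lemma cl_sign_sym_diff_right: "cl_sign S (sym_diff T U) = cl_sign S T * cl_sign S U"
  unfolding cl_sign_prod by (simp add: prod_sym_diff_sign prod.distrib)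

lemma cl_sign_sym_diff_left: "cl_sign (sym_diff S T) U = cl_sign S U * cl_sign T U"
  unfolding cl_sign_prod by (rule prod_sym_diff_sign) (auto simp flip: prod.distrib intro: prod.neutral)

lemma cl_mult_nth: "cl_mult a b $ R = (\<Sum>S\<in>UNIV. cl_sign S (sym_diff S R) * a $ S * b $ (sym_diff S R))"
proof -
  have "cl_mult a b $ R = (\<Sum>(S, T)\<in>(\<lambda>S. (S, sym_diff S R)) ` UNIV. cl_sign S T * (a $ S) * (b $ T))"
    unfolding cl_mult_def by (simp, intro sum.cong refl) auto
  also have "\<dots> = (\<Sum>S\<in>UNIV. cl_sign S (sym_diff S R) * a $ S * b $ (sym_diff S R))"
    by (subst sum.reindex) (auto simp: inj_on_def)
  finally show ?thesis .
qed

text \<open>Substituting U = \<open>sym_diff S T\<close> turns both sides into the same sum over S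
  and T; the signs match because a bicharacter is a 2-cocycle.\<close>

lemma cl_mult_assoc: "cl_mult (cl_mult a b) c = cl_mult a (cl_mult b c)"
proof (rule vec_eq_iff[THEN iffD2], rule allI)
  fix R
  let ?f = "\<lambda>S T. cl_sign S (sym_diff S R) * a $ S * (cl_sign T (sym_diff T (sym_diff S R)) * b $ T * c $ (sym_diff T (sym_diff S R)))"
  have "cl_mult (cl_mult a b) c $ R = (\<Sum>U\<in>UNIV. \<Sum>S\<in>UNIV. ?f S (sym_diff S U))"
  proof -
    have "cl_sign U (sym_diff U R) * (cl_sign S (sym_diff S U) * a $ S * b $ sym_diff S U) * c $ sym_diff U R
      = ?f S (sym_diff S U)" for U S
    proof -
      let ?T = "sym_diff S U" and ?V = "sym_diff U R"
      have 1: "sym_diff ?T (sym_diff S R) = ?V" by auto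
      have 2: "sym_diff S R = sym_diff ?T ?V" by auto
      have 3: "cl_sign U ?V = cl_sign S ?V * cl_sign ?T ?V"
      proof -
        have "U = sym_diff S ?T" by auto
        then show ?thesis by (metis cl_sign_sym_diff_left)
      qed
      have 4: "cl_sign S (sym_diff S R) = cl_sign S ?T * cl_sign S ?V"
        by (subst 2) (rule cl_sign_sym_diff_right)
      show ?thesis unfolding 1 3 4 by (simp add: mult_ac)
    qed
    then show ?thesis by (simp only: cl_mult_nth sum_distrib_left sum_distrib_right)
  qed
  also have "\<dots> = (\<Sum>S\<in>UNIV. \<Sum>U\<in>UNIV. ?f S (sym_diff S U))" by (rule sum.swap)
  also have "\<dots> = (\<Sum>S\<in>UNIV. \<Sum>T\<in>UNIV. ?f S T)"
  proof (rule sum.cong[OF refl])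
    fix S :: "'a set"
    have "bij_betw (sym_diff S) UNIV UNIV"
      by (rule bij_betw_byWitness[of _ "sym_diff S"]) auto
    then show "(\<Sum>U\<in>UNIV. ?f S (sym_diff S U)) = (\<Sum>T\<in>UNIV. ?f S T)"
      by (rule sum.reindex_bij_betw)
  qed
  also have "\<dots> = cl_mult a (cl_mult b c) $ R"
    by (simp only: cl_mult_nth sum_distrib_left)
  finally show "cl_mult (cl_mult a b) c $ R = cl_mult a (cl_mult b c) $ R" .
qed

lemma bounded_bilinear_cl_mult: "bounded_bilinear cl_mult"
proof -
  have "bilinear cl_mult"
    unfolding bilinear_def
    by (intro conjI allI linearI; simp add: vec_eq_iff cl_mult_nth)
      (simp_all add: distrib_left distrib_right sum.distrib sum_distrib_left mult.assoc mult.left_commute)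
  then show ?thesis by (simp add: bilinear_conv_bounded_bilinear)
qed

interpretation cl_mult: bounded_bilinear cl_mult
  by (rule bounded_bilinear_cl_mult)

lemma cl_mult_axis:
  "cl_mult (axis S 1) (axis T 1) = cl_sign S T *\<^sub>R axis (sym_diff S T) 1"
proof (rule vec_eq_iff[THEN iffD2], rule allI)
  fix R
  have "cl_mult (axis S 1) (axis T 1) $ R
      = (\<Sum>S'\<in>UNIV. if S' = S then cl_sign S (sym_diff S R) * axis T 1 $ (sym_diff S R) else 0)"
    unfolding cl_mult_nth by (intro sum.cong) (auto simp: axis_def)
  also have "\<dots> = cl_sign S (sym_diff S R) * axis T 1 $ (sym_diff S R)" by simp
  also have "\<dots> = (cl_sign S T *\<^sub>R axis (sym_diff S T) 1) $ R"
  proof (cases "sym_diff S R = T")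
    case True
    then have "sym_diff S T = R" by auto
    with True show ?thesis by simp
  next
    case False
    then have "sym_diff S T \<noteq> R" by auto
    with False show ?thesis by (simp add: axis_def)
  qed
  finally show "cl_mult (axis S 1) (axis T 1) $ R = (cl_sign S T *\<^sub>R axis (sym_diff S T) 1) $ R" .
qed

lemma cl_one_mult [simp]: "cl_mult cl_one (a :: 'k::finite clifford) = a"
proof -
  have "cl_mult cl_one a $ R = (\<Sum>S\<in>(UNIV :: 'k set set). if S = {} then a $ R else 0)" for R
    unfolding cl_mult_nth cl_one_def by (intro sum.cong) (auto simp: axis_def cl_sign_def)
  then show ?thesis by (simp add: vec_eq_iff)
qed

lemma cl_mult_one [simp]: "cl_mult (a :: 'k::finite clifford) cl_one = a"
proof -
  have "cl_mult a cl_one $ R = (\<Sum>S\<in>UNIV. if S = R then a $ R else 0)" for R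
    unfolding cl_mult_nth cl_one_def by (intro sum.cong) (auto simp: axis_def cl_sign_def)
  then show ?thesis by (simp add: vec_eq_iff)
qed

section \<open>Vectors, reflections and rotations in the Clifford algebra\<close>

lemma linear_cl_vec: "linear cl_vec"
  by (intro linearI) (simp_all add: cl_vec_def scaleR_add_left sum.distrib scaleR_sum_right)

lemma cl_vec_anticommute:
  fixes u v :: "real ^ 'k::finite"
  shows "cl_mult (cl_vec u) (cl_vec v) + cl_mult (cl_vec v) (cl_vec u) = (- 2 * (u \<bullet> v)) *\<^sub>R cl_one"
proof -
  have expand: "cl_mult (cl_vec u) (cl_vec v)
      = (\<Sum>i\<in>UNIV. \<Sum>j\<in>UNIV. (u $ i * v $ j * cl_sign {i} {j}) *\<^sub>R axis (sym_diff {i} {j}) 1)"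
    for u v :: "real ^ 'k::finite"
    unfolding cl_vec_def cl_mult.sum_left unfolding cl_mult.sum_right
    by (simp add: cl_mult.scaleR_left cl_mult.scaleR_right cl_mult_axis mult.assoc mult.left_commute)
  have sgn: "cl_sign {i} {j} = (if to_nat j \<le> to_nat i then -1 else 1)" for i j :: "'k::finite"
    by (simp add: cl_sign_prod)
  have vu: "cl_mult (cl_vec v) (cl_vec u)
      = (\<Sum>i\<in>UNIV. \<Sum>j\<in>UNIV. (v $ j * u $ i * cl_sign {j} {i}) *\<^sub>R axis (sym_diff {j} {i}) 1)"
    unfolding expand by (rule sum.swap)
  have "cl_mult (cl_vec u) (cl_vec v) + cl_mult (cl_vec v) (cl_vec u)
      = (\<Sum>i\<in>UNIV. \<Sum>j\<in>UNIV. (u $ i * v $ j * (cl_sign {i} {j} + cl_sign {j} {i})) *\<^sub>R axis (sym_diff {i} {j}) 1)"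
    unfolding expand[of u v] vu sum.distrib[symmetric]
  proof (intro sum.cong refl)
    fix i j :: 'k
    have sd: "sym_diff {j} {i} = sym_diff {i} {j}" by auto
    show "(u $ i * v $ j * cl_sign {i} {j}) *\<^sub>R axis (sym_diff {i} {j}) 1
        + (v $ j * u $ i * cl_sign {j} {i}) *\<^sub>R axis (sym_diff {j} {i}) 1
        = (u $ i * v $ j * (cl_sign {i} {j} + cl_sign {j} {i})) *\<^sub>R (axis (sym_diff {i} {j}) 1 :: 'k clifford)"
      unfolding sd distrib_left scaleR_add_left mult.commute[of "v $ j" "u $ i"] ..
  qed
  \<comment> \<open>For distinct i and j exactly one of the two comparisons of \<open>to_nat\<close>
    holds, so the two signs cancel.\<close>
  also have "\<dots> = (\<Sum>i\<in>UNIV. \<Sum>j\<in>UNIV. if i = j then (u $ i * v $ i * - 2) *\<^sub>R cl_one else 0)"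
    by (intro sum.cong refl) (auto simp: sgn cl_one_def dest: antisym)
  also have "\<dots> = (- 2 * (u \<bullet> v)) *\<^sub>R cl_one"
    by (simp add: inner_vec_def sum_distrib_left scaleR_sum_left[symmetric] sum_negf algebra_simps)
  finally show ?thesis .
qed

lemma cl_vec_square: "norm a = 1 \<Longrightarrow> cl_mult (cl_vec a) (cl_vec a) = - cl_one"
proof -
  assume "norm a = 1"
  then have "2 *\<^sub>R cl_mult (cl_vec a) (cl_vec a) = 2 *\<^sub>R (- cl_one)"
    using cl_vec_anticommute[of a a] by (simp add: dot_square_norm scaleR_2)
  then show ?thesis by (metis scaleR_cancel_left zero_neq_numeral)
qed

definition reflection :: "real ^ 'k::finite \<Rightarrow> real ^ 'k \<Rightarrow> real ^ 'k" where
  "reflection a v = v - (2 * (a \<bullet> v)) *\<^sub>R a"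

text \<open>Conjugation by a unit vector is minus the reflection in its hyperplane. The minus signs
  disappear for products of two unit vectors, which is why \<open>cl_pair_conj\<close> lands in the
  rotations.\<close>

lemma cl_vec_reflection:
  assumes "norm a = 1"
  shows "cl_mult (cl_vec a) (cl_vec v) = - cl_mult (cl_vec (reflection a v)) (cl_vec a)"
proof -
  interpret linear "cl_vec :: real ^ 'a \<Rightarrow> 'a clifford" by (rule linear_cl_vec)
  have "cl_mult (cl_vec (reflection a v)) (cl_vec a)
      = cl_mult (cl_vec v) (cl_vec a) - (2 * (a \<bullet> v)) *\<^sub>R cl_mult (cl_vec a) (cl_vec a)"
    by (simp add: reflection_def diff scale cl_mult.diff_left cl_mult.scaleR_left)
  also have "cl_mult (cl_vec v) (cl_vec a) = (- 2 * (a \<bullet> v)) *\<^sub>R cl_one - cl_mult (cl_vec a) (cl_vec v)"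
    using cl_vec_anticommute[of a v] by (simp only: eq_diff_eq add.commute)
  also have "(- 2 * (a \<bullet> v)) *\<^sub>R cl_one - cl_mult (cl_vec a) (cl_vec v)
      - (2 * (a \<bullet> v)) *\<^sub>R cl_mult (cl_vec a) (cl_vec a) = - cl_mult (cl_vec a) (cl_vec v)"
    by (simp add: cl_vec_square[OF assms])
  finally show ?thesis by simp
qed

lemma foldr_cl_mult_append:
  "foldr (\<lambda>v. cl_mult (cl_vec v)) (vs @ ws) cl_one
    = cl_mult (foldr (\<lambda>v. cl_mult (cl_vec v)) vs cl_one) (foldr (\<lambda>v. cl_mult (cl_vec v)) ws cl_one)"
  by (induction vs) (simp_all add: cl_mult_assoc)

lemma Spin_mult:
  assumes "s \<in> Spin" "t \<in> Spin"
  shows "cl_mult s t \<in> Spin"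
proof -
  obtain vs ws where vs: "s = foldr (\<lambda>v. cl_mult (cl_vec v)) vs cl_one" "even (length vs)" "\<forall>v\<in>set vs. norm v = 1"
    and ws: "t = foldr (\<lambda>v. cl_mult (cl_vec v)) ws cl_one" "even (length ws)" "\<forall>v\<in>set ws. norm v = 1"
    using assms unfolding Spin_def by auto
  show ?thesis
    unfolding Spin_def
  proof (intro CollectI exI[of _ "vs @ ws"] conjI)
    show "cl_mult s t = foldr (\<lambda>v. cl_mult (cl_vec v)) (vs @ ws) cl_one"
      unfolding foldr_cl_mult_append vs(1) ws(1) ..
    show "even (length (vs @ ws))" "\<forall>v\<in>set (vs @ ws). norm v = 1"
      using vs(2,3) ws(2,3) by auto
  qed
qed

lemma spin_covers_mult:
  assumes "spin_covers s R" "spin_covers t Q"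
  shows "spin_covers (cl_mult s t) (R ** Q)"
  unfolding spin_covers_def
proof (intro conjI allI)
  show "cl_mult s t \<in> Spin" using assms by (simp add: spin_covers_def Spin_mult)
  fix v
  have "cl_mult (cl_mult s t) (cl_vec v) = cl_mult s (cl_mult (cl_vec (Q *v v)) t)"
    using assms(2) by (simp add: spin_covers_def cl_mult_assoc)
  also have "\<dots> = cl_mult (cl_mult (cl_vec (R *v (Q *v v))) s) t"
    using assms(1) by (simp add: spin_covers_def flip: cl_mult_assoc)
  finally show "cl_mult (cl_mult s t) (cl_vec v) = cl_mult (cl_vec ((R ** Q) *v v)) (cl_mult s t)"
    by (simp add: cl_mult_assoc matrix_vector_mul_assoc)
qed

lemma cl_pair_conj:
  assumes "norm a = 1" "norm b = 1"
  shows "cl_mult (cl_mult (cl_vec a) (cl_vec b)) (cl_vec v)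
    = cl_mult (cl_vec (reflection a (reflection b v))) (cl_mult (cl_vec a) (cl_vec b))"
proof -
  have "cl_mult (cl_mult (cl_vec a) (cl_vec b)) (cl_vec v)
      = - cl_mult (cl_mult (cl_vec a) (cl_vec (reflection b v))) (cl_vec b)"
    by (simp add: cl_mult_assoc cl_vec_reflection[OF assms(2)] cl_mult.minus_right)
  also have "\<dots> = cl_mult (cl_mult (cl_vec (reflection a (reflection b v))) (cl_vec a)) (cl_vec b)"
    by (simp add: cl_vec_reflection[OF assms(1)] cl_mult.minus_left)
  finally show ?thesis by (simp add: cl_mult_assoc)
qed

lemma spin_covers_pair:
  assumes "norm a = 1" "norm b = 1" "\<And>v. R *v v = reflection a (reflection b v)"
  shows "spin_covers (cl_mult (cl_vec a) (cl_vec b)) R"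
  unfolding spin_covers_def
proof (intro conjI allI)
  show "cl_mult (cl_vec a) (cl_vec b) \<in> Spin"
    unfolding Spin_def using assms(1,2) by (intro CollectI exI[of _ "[a, b]"]) auto
qed (simp add: assms cl_pair_conj)

text \<open>The spin lift of the rotation by the angle \<open>2 \<alpha>\<close> in the plane of \<open>u\<close> and \<open>w\<close>.\<close>

definition rot :: "real ^ 'k \<Rightarrow> real ^ 'k \<Rightarrow> real \<Rightarrow> 'k::finite clifford" where
  "rot u w \<alpha> = cos \<alpha> *\<^sub>R cl_one + sin \<alpha> *\<^sub>R cl_mult (cl_vec u) (cl_vec w)"

text \<open>For orthonormal u and w this is the rotation that turns u by \<theta> towards w and
  fixes the orthogonal complement of their plane.\<close>

definition rotate_vec :: "real ^ 'k \<Rightarrow> real ^ 'k \<Rightarrow> real \<Rightarrow> real ^ 'k \<Rightarrow> real ^ 'k::finite" where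
  "rotate_vec u w \<theta> v = v + ((cos \<theta> - 1) * (u \<bullet> v) - sin \<theta> * (w \<bullet> v)) *\<^sub>R u
    + ((cos \<theta> - 1) * (w \<bullet> v) + sin \<theta> * (u \<bullet> v)) *\<^sub>R w"

context
  fixes u w :: "real ^ 'k::finite"
  assumes u: "norm u = 1" and w: "norm w = 1" and uw: "u \<bullet> w = 0"
begin

text \<open>Membership in \<open>Spin\<close> asks for a product of an even number of unit vectors.
  Since u u = -1, the second factor is chosen with the component - cos \<alpha> along u, which
  produces the scalar part.\<close>

lemma rot_eq_pair: "rot u w \<alpha> = cl_mult (cl_vec u) (cl_vec (sin \<alpha> *\<^sub>R w - cos \<alpha> *\<^sub>R u))"
proof -
  interpret linear "cl_vec :: real ^ 'k \<Rightarrow> 'k clifford" by (rule linear_cl_vec)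
  show ?thesis
    by (simp add: rot_def diff scale cl_mult.add_right cl_mult.diff_right cl_mult.scaleR_right cl_mult.minus_right cl_vec_square[OF u])
qed

lemma norm_rot_vec: "norm (sin \<alpha> *\<^sub>R w - cos \<alpha> *\<^sub>R u) = 1"
proof -
  have "u \<bullet> u = 1" "w \<bullet> w = 1" "w \<bullet> u = 0"
    using u w uw by (simp_all add: dot_square_norm inner_commute)
  then have "(sin \<alpha> *\<^sub>R w - cos \<alpha> *\<^sub>R u) \<bullet> (sin \<alpha> *\<^sub>R w - cos \<alpha> *\<^sub>R u) = (cos \<alpha>)\<^sup>2 + (sin \<alpha>)\<^sup>2"
    using uw by (simp add: inner_add inner_diff power2_eq_square algebra_simps)
  then show ?thesis by (simp add: norm_eq_1)
qed

lemma reflection_rot_vec: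
  "reflection u (reflection (sin \<alpha> *\<^sub>R w - cos \<alpha> *\<^sub>R u) v) = rotate_vec u w (2 * \<alpha>) v"
proof -
  have i: "u \<bullet> u = 1" "w \<bullet> w = 1" "w \<bullet> u = 0" "u \<bullet> w = 0"
    using u w uw by (simp_all add: dot_square_norm inner_commute)
  let ?c = "cos \<alpha>" and ?s = "sin \<alpha>" and ?p = "u \<bullet> v" and ?q = "w \<bullet> v"
  define k where "k = ?s * ?q - ?c * ?p"
  have bv: "(?s *\<^sub>R w - ?c *\<^sub>R u) \<bullet> v = k"
    by (simp add: inner_diff_left k_def)
  have ub: "u \<bullet> (v - (2 * k) *\<^sub>R (?s *\<^sub>R w - ?c *\<^sub>R u)) = ?p + 2 * k * ?c"
    by (simp add: inner_diff_right i)
  have "reflection u (reflection (?s *\<^sub>R w - ?c *\<^sub>R u) v)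
      = v + (2 * ?c * k - 2 * (?p + 2 * k * ?c)) *\<^sub>R u + (- 2 * ?s * k) *\<^sub>R w"
    unfolding reflection_def bv ub by (simp add: vec_eq_iff algebra_simps)
  also have "2 * ?c * k - 2 * (?p + 2 * k * ?c) = (cos (2 * \<alpha>) - 1) * ?p - sin (2 * \<alpha>) * ?q"
    unfolding k_def by (simp add: cos_double_cos sin_double power2_eq_square) (simp add: algebra_simps)
  also have "- 2 * ?s * k = (cos (2 * \<alpha>) - 1) * ?q + sin (2 * \<alpha>) * ?p"
    unfolding k_def by (simp add: cos_double_sin sin_double power2_eq_square) (simp add: algebra_simps)
  finally show ?thesis by (simp add: rotate_vec_def)
qed

lemma rot_conj: "cl_mult (rot u w \<alpha>) (cl_vec v) = cl_mult (cl_vec (rotate_vec u w (2 * \<alpha>) v)) (rot u w \<alpha>)"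
  unfolding rot_eq_pair using cl_pair_conj[OF u norm_rot_vec] by (simp add: reflection_rot_vec)

lemma spin_covers_rot:
  "(\<And>v. R *v v = rotate_vec u w (2 * \<alpha>) v) \<Longrightarrow> spin_covers (rot u w \<alpha>) R"
  unfolding rot_eq_pair
  by (rule spin_covers_pair[OF u norm_rot_vec]) (simp add: reflection_rot_vec)

text \<open>The element u w squares to -1, so \<open>rot\<close> multiplies like the complex
  exponential.\<close>

lemma rot_add: "cl_mult (rot u w \<alpha>) (rot u w \<beta>) = rot u w (\<alpha> + \<beta>)"
proof -
  let ?f = "cl_mult (cl_vec u) (cl_vec w)"
  have wu: "cl_mult (cl_vec w) (cl_vec u) = - ?f"
    using cl_vec_anticommute[of w u] uw by (simp add: inner_commute eq_neg_iff_add_eq_0)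
  have "cl_mult ?f ?f = cl_mult (cl_vec u) (cl_mult (cl_mult (cl_vec w) (cl_vec u)) (cl_vec w))"
    by (simp add: cl_mult_assoc)
  also have "\<dots> = - cl_mult (cl_mult (cl_vec u) (cl_vec u)) (cl_mult (cl_vec w) (cl_vec w))"
    unfolding wu by (simp add: cl_mult_assoc cl_mult.minus_left cl_mult.minus_right)
  also have "\<dots> = - cl_one"
    by (simp add: cl_vec_square u w cl_mult.minus_left cl_mult.minus_right)
  finally have "cl_mult ?f ?f = - cl_one" .
  then show ?thesis
    by (simp add: rot_def cl_mult.add_left cl_mult.add_right cl_mult.scaleR_left cl_mult.scaleR_right
        cos_add sin_add algebra_simps)
qed

lemma rot_zero [simp]: "rot u w 0 = cl_one"
  by (simp add: rot_def)

text \<open>The vector w anticommutes with u w and therefore reverses the angle. This is the source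
  of the opposite sign of y in the lifts for the pole -1.\<close>

lemma rot_commute: "cl_mult (cl_vec w) (rot u w \<alpha>) = cl_mult (rot u w (- \<alpha>)) (cl_vec w)"
proof -
  have wu: "cl_mult (cl_vec w) (cl_vec u) = - cl_mult (cl_vec u) (cl_vec w)"
    using cl_vec_anticommute[of w u] uw by (simp add: inner_commute eq_neg_iff_add_eq_0)
  show ?thesis
    by (simp add: rot_def cl_mult.add_left cl_mult.add_right cl_mult.diff_left cl_mult.scaleR_left cl_mult.scaleR_right wu
        cl_mult.minus_left cl_mult.minus_right flip: cl_mult_assoc)
qed

end

text \<open>An orthogonal matrix that takes a coordinate axis to \<open>a\<close> conjugates the
  reflection to a diagonal matrix with a single entry -1.\<close>

lemma det_reflection:
  assumes "norm (a :: real ^ 'k::finite) = 1" "\<And>v. R *v v = reflection a v"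
  shows "det R = -1"
proof -
  obtain k :: 'k where True by simp
  obtain A :: "real ^ 'k ^ 'k" where A: "orthogonal_matrix A" "A *v axis k 1 = a"
    using orthogonal_matrix_exists_basis[OF assms(1)] by metis
  have AA: "A ** transpose A = mat 1" "transpose A ** A = mat 1"
    using A(1) by (simp_all add: orthogonal_matrix_def)
  define D where "D = diag (\<lambda>i. if i = k then -1 else (1::real))"
  have D: "D *v v = v - (2 * v $ k) *\<^sub>R axis k 1" for v
    by (auto simp: vec_eq_iff axis_def D_def diag_mult_vec_nth)
  have "A ** D ** transpose A = R"
  proof (rule matrix_eq[THEN iffD2], rule allI)
    fix v
    have "(transpose A *v v) $ k = (transpose A *v v) \<bullet> axis k 1" by (simp add: inner_axis)
    also have "\<dots> = a \<bullet> v" by (metis A(2) dot_lmul_matrix inner_commute transpose_matrix_vector)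
    finally have "D *v (transpose A *v v) = transpose A *v v - (2 * (a \<bullet> v)) *\<^sub>R axis k 1"
      by (simp add: D)
    then have "(A ** D ** transpose A) *v v = A *v (transpose A *v v - (2 * (a \<bullet> v)) *\<^sub>R axis k 1)"
      by (simp add: matrix_vector_mul_assoc[symmetric])
    also have "\<dots> = v - (2 * (a \<bullet> v)) *\<^sub>R a"
      by (simp only: matrix_vector_mult_diff_distrib matrix_vector_mult_scaleR A(2) matrix_vector_mul_assoc AA
          matrix_vector_mul_lid)
    finally show "(A ** D ** transpose A) *v v = R *v v"
      by (simp add: assms(2) reflection_def)
  qed
  then have "det R = det (A ** D ** transpose A)" by simp
  also have "\<dots> = det D * (det A * det (transpose A))" by (simp add: det_mul)
  also have "det A * det (transpose A) = 1" by (metis AA(1) det_I det_mul)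
  also have "det D = (\<Prod>i\<in>UNIV. if i = k then -1 else (1::real))"
    by (simp add: D_def det_diag)
  also have "\<dots> = -1" by simp
  finally show ?thesis by simp
qed

section \<open>The manifold and its charts\<close>

text \<open>The sign with which the m-th power of the gluing map acts on x and on the entry
  \<open>j1\<close>; the same sign arises for cos and sin when y moves by m pi.\<close>

definition sg :: "int \<Rightarrow> real" where
  "sg m = (if even m then 1 else -1)"

lemma sg_mult_self [simp]: "sg m * sg m = 1" "sg m * (sg m * a) = a"
  by (auto simp: sg_def)

lemma abs_sg [simp]: "\<bar>sg m\<bar> = 1"
  by (simp add: sg_def)

lemma sg_square [simp]: "(sg m)\<^sup>2 = 1" "(sg m * a)\<^sup>2 = a\<^sup>2"
  by (auto simp: sg_def)

lemma cos_add_int_pi: "cos (y + of_int m * pi) = sg m * cos y"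
  by (simp add: cos_add sg_def mult.commute[of _ pi])

lemma sin_add_int_pi: "sin (y + of_int m * pi) = sg m * sin y"
  by (simp add: sin_add sg_def mult.commute[of _ pi])

text \<open>The manifold is the quotient of \<open>\<real> \<times> [-1, 1] \<times> S\<close>, where \<open>S\<close> is the unit sphere, by
  \<open>(y, x, \<sigma>) \<mapsto> (y + \<pi>, -x, \<rho> \<sigma>)\<close>, where \<open>\<rho>\<close> changes the sign of the coordinate \<open>j1\<close>. It is embedded
  by the invariant functions \<open>exp (2 i y)\<close>, \<open>(x + i \<sigma>\<^sub>j\<^sub>1) exp (i y)\<close>, and \<open>\<sigma>\<^sub>j\<close> for \<open>j \<noteq> j1\<close>.
  The coordinate \<open>j0\<close> of a chart is \<open>y\<close>; the remaining ones are stereographic.\<close>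

locale twisted_slab =
  fixes j0 j1 :: "'m::finite"
  assumes j01: "j0 \<noteq> j1"
begin

text \<open>Numbers from 4 on stand for the remaining entries of \<sigma>. A number that is not of
  the form \<open>4 + to_nat j\<close> repeats one of these entries or is 0, which does no harm to
  an embedding. The entry \<open>j1\<close> is already recorded by the numbers 2 and 3.\<close>

definition emb :: "real \<Rightarrow> real \<Rightarrow> real ^ 'm \<Rightarrow> nat \<Rightarrow> real" where
  "emb y x \<sigma> i =
    (if i = 0 then cos (2 * y) else if i = 1 then sin (2 * y)
     else if i = 2 then x * cos y - \<sigma> $ j1 * sin y
     else if i = 3 then x * sin y + \<sigma> $ j1 * cos y
     else if from_nat (i - 4) = j1 then 0 else \<sigma> $ from_nat (i - 4))"

lemma emb_simps [simp]:
  "emb y x \<sigma> 0 = cos (2 * y)" "emb y x \<sigma> (Suc 0) = sin (2 * y)"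
  "emb y x \<sigma> 2 = x * cos y - \<sigma> $ j1 * sin y" "emb y x \<sigma> 3 = x * sin y + \<sigma> $ j1 * cos y"
  "emb y x \<sigma> (4 + to_nat j) = (if j = j1 then 0 else \<sigma> $ j)"
  by (simp_all add: emb_def)

definition flip :: "real \<Rightarrow> real ^ 'm \<Rightarrow> real ^ 'm" where
  "flip s \<sigma> = (\<chi> j. if j = j1 then s * \<sigma> $ j else \<sigma> $ j)"

lemma flip_nth: "flip s \<sigma> $ j = (if j = j1 then s * \<sigma> $ j else \<sigma> $ j)"
  by (simp add: flip_def)

lemma norm_flip [simp]: "norm (flip (sg m) \<sigma>) = norm \<sigma>"
proof -
  have "(flip (sg m) \<sigma> $ i)\<^sup>2 = (\<sigma> $ i)\<^sup>2" for i by (simp add: flip_nth)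
  then show ?thesis by (simp add: norm_vec_def L2_set_def)
qed

lemma emb_shift: "emb (y + of_int m * pi) (sg m * x) (flip (sg m) \<sigma>) = emb y x \<sigma>"
proof -
  have "2 * (y + of_int m * pi) = 2 * y + of_int (2 * m) * pi" by simp
  then have "cos (2 * (y + of_int m * pi)) = cos (2 * y)" "sin (2 * (y + of_int m * pi)) = sin (2 * y)"
    by (simp_all only: cos_add_int_pi sin_add_int_pi) (simp_all add: sg_def)
  then show ?thesis
    unfolding fun_eq_iff emb_def flip_nth cos_add_int_pi sin_add_int_pi by (simp add: sg_def)
qed

text \<open>Together with \<open>emb_shift\<close>, the fibres of \<open>emb\<close> are exactly the
  orbits of the gluing map. The first two coordinates determine 2 y modulo 2 pi and hence m;
  multiplying the next two, as a complex number, by exp(- i y) recovers x and \<sigma>_j1 up to the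
  sign.\<close>

lemma emb_eqD:
  assumes "emb y x \<sigma> = emb y' x' \<sigma>'"
  obtains m where "y' = y + of_int m * pi" "x' = sg m * x" "\<sigma>' = flip (sg m) \<sigma>"
proof -
  note eq = fun_cong[OF assms]
  have "sin (2 * y') = sin (2 * y) \<and> cos (2 * y') = cos (2 * y)"
    using eq[of 0] eq[of 1] by simp
  then obtain m where "2 * y' = 2 * y + 2 * pi * of_int m"
    unfolding sin_cos_eq_iff by blast
  then have y': "y' = y + of_int m * pi"
    using mult.commute[of pi "of_int m"] by linarith
  have eq23: "x * cos y - \<sigma> $ j1 * sin y = sg m * (x' * cos y - \<sigma>' $ j1 * sin y)"
    "x * sin y + \<sigma> $ j1 * cos y = sg m * (x' * sin y + \<sigma>' $ j1 * cos y)"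
    using eq[of 2] eq[of 3] unfolding y' emb_simps cos_add_int_pi sin_add_int_pi
    by (simp_all add: algebra_simps)
  have cs: "cos y * cos y = 1 - sin y * sin y"
    using sin_cos_squared_add[of y] by (simp add: power2_eq_square)
  have "x = (x * cos y - \<sigma> $ j1 * sin y) * cos y + (x * sin y + \<sigma> $ j1 * cos y) * sin y"
    using cs by algebra
  also have "\<dots> = sg m * x'"
    unfolding eq23 using cs by algebra
  finally have x: "x' = sg m * x" by simp
  have "\<sigma> $ j1 = (x * sin y + \<sigma> $ j1 * cos y) * cos y - (x * cos y - \<sigma> $ j1 * sin y) * sin y"
    using cs by algebra
  also have "\<dots> = sg m * \<sigma>' $ j1"
    unfolding eq23 using cs by algebra
  finally have s: "\<sigma>' $ j1 = sg m * \<sigma> $ j1" by simp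
  have "\<sigma>' $ j = \<sigma> $ j" if "j \<noteq> j1" for j
    using eq[of "4 + to_nat j"] that by simp
  with s have "\<sigma>' = flip (sg m) \<sigma>" by (simp add: vec_eq_iff flip_nth)
  with y' x that show thesis by blast
qed

lemma continuous_on_emb:
  fixes S :: "'a::t2_space set"
  assumes "continuous_on S f" "continuous_on S g" "continuous_on S h"
  shows "continuous_on S (\<lambda>p. emb (f p) (g p) (h p))"
proof (rule continuous_on_coordinatewise_then_product)
  fix i
  consider "i = 0" | "i = 1" | "i = 2" | "i = 3" | "i \<ge> 4" "from_nat (i - 4) = j1"
    | "i \<ge> 4" "from_nat (i - 4) \<noteq> j1" by linarith
  then show "continuous_on S (\<lambda>p. emb (f p) (g p) (h p) i)"
    by cases (use assms in \<open>auto simp: emb_def intro!: continuous_intros\<close>)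
qed

section \<open>The quotient space: compactness and connectedness\<close>

definition X :: "(nat \<Rightarrow> real) set" where
  "X = {emb y x \<sigma> | y x \<sigma>. \<bar>x\<bar> \<le> 1 \<and> norm \<sigma> = 1}"

definition T :: "(nat \<Rightarrow> real) topology" where
  "T = top_of_set X"

lemma topspace_T [simp]: "topspace T = X"
  by (simp add: T_def)

lemma emb_in_X: "\<bar>x\<bar> \<le> 1 \<Longrightarrow> norm \<sigma> = 1 \<Longrightarrow> emb y x \<sigma> \<in> X"
  by (auto simp: X_def)

lemma compact_X: "compact X"
proof -
  have "X = (\<lambda>(y, x, \<sigma>). emb y x \<sigma>) ` ({0..pi} \<times> {-1..1} \<times> sphere 0 1)"
  proof
    show "X \<subseteq> (\<lambda>(y, x, \<sigma>). emb y x \<sigma>) ` ({0..pi} \<times> {-1..1} \<times> sphere 0 1)"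
    proof
      fix p assume "p \<in> X"
      then obtain y x \<sigma> where p: "p = emb y x \<sigma>" "\<bar>x\<bar> \<le> 1" "norm \<sigma> = 1" by (auto simp: X_def)
      \<comment> \<open>The power of the gluing map that moves y into the fundamental domain
        [0, pi].\<close>
      define m where "m = - \<lfloor>y / pi\<rfloor>"
      have "p = emb (y + of_int m * pi) (sg m * x) (flip (sg m) \<sigma>)"
        by (simp add: p emb_shift)
      moreover have "y + of_int m * pi \<in> {0..pi}"
      proof -
        have "of_int \<lfloor>y / pi\<rfloor> * pi \<le> y" "y < (of_int \<lfloor>y / pi\<rfloor> + 1) * pi"
          using mult_right_mono[OF of_int_floor_le[of "y / pi"], of pi]
            mult_strict_right_mono[OF real_of_int_floor_add_one_gt[of "y / pi"], of pi] by simp_all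
        then show ?thesis by (simp add: m_def distrib_right)
      qed
      moreover have "\<bar>sg m * x\<bar> \<le> 1" using p(2) by (simp add: abs_mult)
      ultimately show "p \<in> (\<lambda>(y, x, \<sigma>). emb y x \<sigma>) ` ({0..pi} \<times> {-1..1} \<times> sphere 0 1)"
        using p(3) by (intro image_eqI[of _ _ "(y + of_int m * pi, sg m * x, flip (sg m) \<sigma>)"]) auto
    qed
  qed (auto intro!: emb_in_X)
  moreover have "continuous_on S (\<lambda>(y, x, \<sigma>). emb y x \<sigma>)" for S
    unfolding split_beta by (intro continuous_on_emb continuous_intros)
  ultimately show ?thesis
    by (metis compact_Icc compact_Times compact_continuous_image compact_sphere)
qed

lemma connected_sphere_m: "connected (sphere (0 :: real ^ 'm) 1)"
proof (rule connected_sphere)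
  have "card {j0, j1} \<le> CARD('m)" by (rule card_mono) auto
  then show "2 \<le> DIM(real ^ 'm)" using j01 by simp
qed

lemma connected_X: "connected X"
proof -
  have "X = (\<lambda>(y, x, \<sigma>). emb y x \<sigma>) ` (UNIV \<times> {-1..1} \<times> sphere 0 1)"
    by (auto simp: X_def abs_le_iff image_iff) fastforce+
  moreover have "continuous_on S (\<lambda>(y, x, \<sigma>). emb y x \<sigma>)" for S
    unfolding split_beta by (intro continuous_on_emb continuous_intros)
  ultimately show ?thesis
    using connected_sphere_m
    by (metis connected_Icc connected_Times connected_UNIV connected_continuous_image)
qed

text \<open>One shape of chart covers interior and boundary. A window of length pi singles out one
  representative of y. The value x = -1 may be left out since the gluing map turns it into x = 1,
  and e is the pole omitted by the stereographic projection.\<close>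

definition dom :: "real \<Rightarrow> real \<Rightarrow> (nat \<Rightarrow> real) set" where
  "dom c e = {emb y x \<sigma> | y x \<sigma>. \<bar>y - c\<bar> < pi / 2 \<and> -1 < x \<and> x \<le> 1 \<and> norm \<sigma> = 1 \<and> \<sigma> $ j0 \<noteq> e}"

text \<open>The first two coordinates are exp(2 i y). Turning by - 2 c moves the branch cut of
  \<open>Arg\<close> to the ends of the window around c.\<close>

definition ycrd :: "real \<Rightarrow> (nat \<Rightarrow> real) \<Rightarrow> real" where
  "ycrd c p = c + Arg (Complex (p 0) (p 1) * cis (- 2 * c)) / 2"

text \<open>This and the entry \<open>j1\<close> of \<open>scrd\<close> are the real and imaginary
  part of (x + i \<sigma>_j1) exp(i y) after multiplication by exp(- i y).\<close>

definition xcrd :: "real \<Rightarrow> (nat \<Rightarrow> real) \<Rightarrow> real" where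
  "xcrd c p = p 2 * cos (ycrd c p) + p 3 * sin (ycrd c p)"

definition scrd :: "real \<Rightarrow> (nat \<Rightarrow> real) \<Rightarrow> real ^ 'm" where
  "scrd c p = (\<chi> j. if j = j1 then p 3 * cos (ycrd c p) - p 2 * sin (ycrd c p) else p (4 + to_nat j))"

lemma cos_sin_crd:
  "(x * cos y - s * sin y) * cos y + (x * sin y + s * cos y) * sin y = x"
  "(x * sin y + s * cos y) * cos y - (x * cos y - s * sin y) * sin y = (s::real)"
proof -
  have cs: "cos y * cos y = 1 - sin y * sin y"
    using sin_cos_squared_add[of y] by (simp add: power2_eq_square)
  show "(x * cos y - s * sin y) * cos y + (x * sin y + s * cos y) * sin y = x"
    "(x * sin y + s * cos y) * cos y - (x * cos y - s * sin y) * sin y = s"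
    using cs by algebra+
qed

lemma ycrd_emb: "\<bar>y - c\<bar> < pi / 2 \<Longrightarrow> ycrd c (emb y x \<sigma>) = y"
proof -
  assume y: "\<bar>y - c\<bar> < pi / 2"
  have "Complex (cos (2 * y)) (sin (2 * y)) * cis (- 2 * c) = cis (2 * (y - c))"
    unfolding cis.code[symmetric] cis_mult by (simp add: algebra_simps)
  moreover have "Arg (cis (2 * (y - c))) = 2 * (y - c)"
  proof (rule Arg_cis)
    show "2 * (y - c) \<in> {-pi<..pi}"
    proof -
      have "y - c < pi / 2" "- (y - c) < pi / 2" using y unfolding abs_less_iff by blast+
      then show ?thesis unfolding greaterThanAtMost_iff by argo
    qed
  qed
  ultimately show ?thesis by (simp add: ycrd_def diff_divide_distrib)
qed

lemma xcrd_emb: "\<bar>y - c\<bar> < pi / 2 \<Longrightarrow> xcrd c (emb y x \<sigma>) = x"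
  by (simp add: xcrd_def ycrd_emb cos_sin_crd)

lemma scrd_emb: "\<bar>y - c\<bar> < pi / 2 \<Longrightarrow> scrd c (emb y x \<sigma>) = \<sigma>"
  by (simp add: scrd_def ycrd_emb cos_sin_crd vec_eq_iff)

text \<open>The complement of the branch cut, on which the three coordinate functions are
  continuous.\<close>

definition far :: "real \<Rightarrow> (nat \<Rightarrow> real) set" where
  "far c = {p. Complex (p 0) (p 1) * cis (- 2 * c) \<notin> \<real>\<^sub>\<le>\<^sub>0}"

lemma continuous_on_coords [continuous_intros]: "continuous_on S (\<lambda>p :: nat \<Rightarrow> real. p i)"
  by (rule continuous_on_product_then_coordinatewise) (rule continuous_on_id)

lemma continuous_on_arg_point: "continuous_on S (\<lambda>p :: nat \<Rightarrow> real. Complex (p 0) (p 1) * cis (- 2 * c))"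
  unfolding Complex_eq by (intro continuous_intros)

lemma continuous_on_ycrd: "continuous_on (far c) (ycrd c)"
  unfolding ycrd_def
  by (intro continuous_intros continuous_on_Arg' continuous_on_arg_point) (auto simp: far_def)

lemma continuous_on_xcrd: "continuous_on (far c) (xcrd c)"
  unfolding xcrd_def by (intro continuous_intros continuous_on_ycrd)

lemma continuous_on_scrd: "continuous_on (far c) (\<lambda>p. scrd c p)"
  unfolding scrd_def
proof (rule continuous_on_vec_lambda)
  show "continuous_on (far c) (\<lambda>p. if j = j1 then p 3 * cos (ycrd c p) - p 2 * sin (ycrd c p) else p (4 + to_nat j))" for j
  proof (cases "j = j1")
    case True
    then show ?thesis by simp (intro continuous_intros continuous_on_ycrd)
  next
    case False
    then show ?thesis by (simp only: if_False continuous_on_coords)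
  qed
qed

lemma emb_in_far: "\<bar>y - c\<bar> < pi / 2 \<Longrightarrow> emb y x \<sigma> \<in> far c"
proof -
  assume y: "\<bar>y - c\<bar> < pi / 2"
  have "Complex (cos (2 * y)) (sin (2 * y)) * cis (- 2 * c) = cis (2 * (y - c))"
    unfolding cis.code[symmetric] cis_mult by (simp add: algebra_simps)
  moreover have "cis (2 * (y - c)) \<notin> \<real>\<^sub>\<le>\<^sub>0"
  proof
    assume "cis (2 * (y - c)) \<in> \<real>\<^sub>\<le>\<^sub>0"
    then have "cos (2 * (y - c)) \<le> 0" "sin (2 * (y - c)) = 0"
      by (simp_all only: complex_nonpos_Reals_iff cis.simps)
    then have "cos (y - c) = 0"
      unfolding sin_double cos_double by (metis diff_zero mult_eq_0_iff not_sum_power2_lt_zero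
        power_zero_numeral zero_eq_power2 zero_neq_numeral add_0 le_less power2_less_0)
    moreover have "cos (y - c) > 0" using y by (intro cos_gt_zero_pi; linarith)
    ultimately show False by simp
  qed
  ultimately show ?thesis by (simp add: far_def)
qed

text \<open>Replaces the image of a parametrization by conditions that are open in \<open>X\<close>.
  Conversely, for any representative of a point off the cut, the argument of exp(2 i (y - c)) tells
  which power of the gluing map brings y into the window.\<close>

lemma dom_eq: "dom c e = {p \<in> X \<inter> far c. -1 < xcrd c p \<and> p (4 + to_nat j0) \<noteq> e}"
proof (intro set_eqI iffI)
  fix p assume "p \<in> dom c e"
  then show "p \<in> {p \<in> X \<inter> far c. -1 < xcrd c p \<and> p (4 + to_nat j0) \<noteq> e}"
    using j01 by (auto simp: dom_def emb_in_far xcrd_emb intro!: emb_in_X)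
next
  fix p assume "p \<in> {p \<in> X \<inter> far c. -1 < xcrd c p \<and> p (4 + to_nat j0) \<noteq> e}"
  then have p: "p \<in> X" "p \<in> far c" "-1 < xcrd c p" "p (4 + to_nat j0) \<noteq> e" by auto
  then obtain y x \<sigma> where emb: "p = emb y x \<sigma>" "\<bar>x\<bar> \<le> 1" "norm \<sigma> = 1" by (auto simp: X_def)
  have "Complex (cos (2 * y)) (sin (2 * y)) * cis (- 2 * c) = cis (2 * (y - c))"
    unfolding cis.code[symmetric] cis_mult by (simp add: algebra_simps)
  then have far: "cis (2 * (y - c)) \<notin> \<real>\<^sub>\<le>\<^sub>0" using p(2) by (simp add: far_def emb(1))
  define z where "z = cis (2 * (y - c))"
  have "norm z = 1" by (simp add: z_def)
  moreover from this have "z \<noteq> 0" by auto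
  ultimately have "cis (Arg z) = z" using cis_Arg[of z] by (simp add: sgn_eq)
  then have "sin (Arg z) = sin (2 * (y - c)) \<and> cos (Arg z) = cos (2 * (y - c))"
    unfolding z_def by (metis cis.simps)
  then obtain m where m: "Arg z = 2 * (y - c) + 2 * pi * of_int m" unfolding sin_cos_eq_iff by blast
  \<comment> \<open>\<open>Arg\<close> can attain pi only on the excluded cut, so the shifted y lies
    strictly inside the window.\<close>
  have "Arg z \<noteq> pi" using far Arg_eq_pi[of z] unfolding z_def by (auto simp: complex_nonpos_Reals_iff)
  then have "- pi < Arg z" "Arg z < pi" using Arg_bounded[of z] by auto
  then have y': "\<bar>(y + of_int m * pi) - c\<bar> < pi / 2" unfolding m abs_less_iff by argo
  have p': "p = emb (y + of_int m * pi) (sg m * x) (flip (sg m) \<sigma>)" by (simp add: emb(1) emb_shift)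
  have "-1 < sg m * x" using p(3) unfolding p' xcrd_emb[OF y'] .
  moreover have "sg m * x \<le> 1" using emb(2) by (auto simp: sg_def)
  moreover have "flip (sg m) \<sigma> $ j0 \<noteq> e" using p(4) j01 unfolding p' by simp
  ultimately show "p \<in> dom c e"
    unfolding dom_def using y' p' emb(3) by (intro CollectI exI conjI) auto
qed

lemma openin_dom: "openin T (dom c e)"
proof -
  have "far c = (\<lambda>p. Complex (p 0) (p 1) * cis (- 2 * c)) -` (- \<real>\<^sub>\<le>\<^sub>0)"
    by (auto simp: far_def)
  moreover have "open \<dots>"
    using continuous_on_arg_point by (intro open_vimage open_Compl closed_nonpos_Reals_complex)
  ultimately have far: "open (far c)" by simp
  have "openin (top_of_set (X \<inter> far c)) ((X \<inter> far c) \<inter> (\<lambda>p. (xcrd c p, p (4 + to_nat j0))) -` ({-1<..} \<times> -{e}))"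
    by (intro continuous_openin_preimage_gen continuous_on_Pair continuous_on_coords
        continuous_on_subset[OF continuous_on_xcrd] open_Times) auto
  moreover have "openin (top_of_set X) (X \<inter> far c)" using far by auto
  ultimately have "openin (top_of_set X) ((X \<inter> far c) \<inter> (\<lambda>p. (xcrd c p, p (4 + to_nat j0))) -` ({-1<..} \<times> -{e}))"
    by (rule openin_trans)
  also have "(X \<inter> far c) \<inter> (\<lambda>p. (xcrd c p, p (4 + to_nat j0))) -` ({-1<..} \<times> -{e}) = dom c e"
    by (auto simp: dom_eq)
  finally show ?thesis by (simp add: T_def)
qed

section \<open>Stereographic coordinates and the charts\<close>

definition rsq :: "real ^ ('m option) \<Rightarrow> real" where
  "rsq v = (\<Sum>j\<in>-{j0}. (v $ Some j)\<^sup>2)"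

lemma rsq_nonneg [simp]: "0 \<le> rsq v"
  by (simp add: rsq_def sum_nonneg)

lemma one_plus_rsq [simp]: "0 < 1 + rsq v" "1 + rsq v \<noteq> 0"
  using rsq_nonneg[of v] by linarith+

text \<open>Inverse stereographic projection from the pole e on the axis \<open>j0\<close>. The
  projections from opposite poles differ by an inversion, which reverses orientation; the factor e
  at \<open>j1\<close> is a reflection that restores it.\<close>

definition sph :: "real \<Rightarrow> real ^ ('m option) \<Rightarrow> real ^ 'm" where
  "sph e v = (\<chi> j. if j = j0 then e * (rsq v - 1) / (1 + rsq v)
    else (if j = j1 then e else 1) * (2 * v $ Some j / (1 + rsq v)))"

text \<open>The coordinate \<open>None\<close> is 1 - x, so that it vanishes at x = 1 and is
  positive in the interior.\<close>

definition par :: "real \<Rightarrow> real ^ ('m option) \<Rightarrow> nat \<Rightarrow> real" where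
  "par e v = emb (v $ Some j0) (1 - v $ None) (sph e v)"

definition win :: "real \<Rightarrow> (real ^ ('m option)) set" where
  "win c = {v. 0 \<le> v $ None \<and> v $ None < 2 \<and> \<bar>v $ Some j0 - c\<bar> < pi / 2}"

definition crd :: "real \<Rightarrow> real \<Rightarrow> (nat \<Rightarrow> real) \<Rightarrow> real ^ ('m option)" where
  "crd c e p = (\<chi> i. case i of None \<Rightarrow> 1 - xcrd c p
    | Some j \<Rightarrow> if j = j0 then ycrd c p
        else (if j = j1 then e else 1) * scrd c p $ j / (1 - e * scrd c p $ j0))"

lemma crd_None: "crd c e p $ None = 1 - xcrd c p"
  by (simp add: crd_def)

lemma crd_j0: "crd c e p $ Some j0 = ycrd c p"
  by (simp add: crd_def)

lemma crd_Some: "j \<noteq> j0 \<Longrightarrow>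
    crd c e p $ Some j = (if j = j1 then e else 1) * scrd c p $ j / (1 - e * scrd c p $ j0)"
  by (simp add: crd_def)

definition pole :: "real \<Rightarrow> bool" where
  "pole e \<longleftrightarrow> e = 1 \<or> e = -1"

lemma pole_square: "pole e \<Longrightarrow> e * e = 1"
  by (auto simp: pole_def)

lemma norm_sph:
  assumes "pole e"
  shows "norm (sph e v) = 1"
proof -
  have "(\<Sum>j\<in>UNIV. (sph e v $ j)\<^sup>2) = (sph e v $ j0)\<^sup>2 + (\<Sum>j\<in>-{j0}. (sph e v $ j)\<^sup>2)"
    by (simp add: sum.remove[of UNIV j0] Compl_eq_Diff_UNIV)
  also have "(\<Sum>j\<in>-{j0}. (sph e v $ j)\<^sup>2) = (\<Sum>j\<in>-{j0}. (2 / (1 + rsq v))\<^sup>2 * (v $ Some j)\<^sup>2)"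
    using assms by (intro sum.cong) (auto simp: sph_def pole_def power_mult_distrib power_divide)
  also have "\<dots> = (2 / (1 + rsq v))\<^sup>2 * rsq v" by (simp add: rsq_def sum_distrib_left)
  also have "(sph e v $ j0)\<^sup>2 = ((rsq v - 1) / (1 + rsq v))\<^sup>2"
    using assms by (auto simp: sph_def pole_def power_divide power2_commute)
  also have "((rsq v - 1) / (1 + rsq v))\<^sup>2 + (2 / (1 + rsq v))\<^sup>2 * rsq v = 1"
    by (simp add: power_divide divide_simps) (simp add: power2_eq_square algebra_simps)
  finally show ?thesis by (simp add: norm_vec_def L2_set_def)
qed

lemma sph_j0_ne: "pole e \<Longrightarrow> sph e v $ j0 \<noteq> e"
  by (auto simp: sph_def pole_def divide_simps)

lemma par_in_dom: "pole e \<Longrightarrow> v \<in> win c \<Longrightarrow> par e v \<in> dom c e"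
  unfolding dom_def par_def win_def
  by (intro CollectI exI[of _ "v $ Some j0"] exI[of _ "1 - v $ None"] exI[of _ "sph e v"])
    (auto simp: norm_sph sph_j0_ne)

lemma crd_par:
  assumes "pole e" "v \<in> win c"
  shows "crd c e (par e v) = v"
proof -
  have y: "\<bar>v $ Some j0 - c\<bar> < pi / 2" using assms(2) by (simp add: win_def)
  have "1 - e * sph e v $ j0 = 2 / (1 + rsq v)"
    using assms(1) by (auto simp: sph_def pole_def field_simps)
  then show ?thesis
    using assms(1) j01
    by (auto simp: vec_eq_iff crd_def par_def xcrd_emb[OF y] ycrd_emb[OF y] scrd_emb[OF y] sph_def pole_def
        split: option.split)
qed

lemma par_crd:
  assumes "pole e" "p \<in> dom c e"
  shows "par e (crd c e p) = p" "crd c e p \<in> win c"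
proof -
  obtain y x \<sigma> where p: "p = emb y x \<sigma>" "\<bar>y - c\<bar> < pi / 2" "-1 < x" "x \<le> 1" "norm \<sigma> = 1" "\<sigma> $ j0 \<noteq> e"
    using assms(2) by (auto simp: dom_def)
  note crds = xcrd_emb[OF p(2)] ycrd_emb[OF p(2)] scrd_emb[OF p(2)]
  have d: "1 - e * \<sigma> $ j0 \<noteq> 0" using assms(1) p(6) by (auto simp: pole_def)
  have "(\<Sum>j\<in>UNIV. (\<sigma> $ j)\<^sup>2) = 1" using p(5) by (simp add: norm_vec_def L2_set_def)
  then have s: "(\<Sum>j\<in>-{j0}. (\<sigma> $ j)\<^sup>2) = 1 - (\<sigma> $ j0)\<^sup>2"
    by (simp add: sum.remove[of UNIV j0] Compl_eq_Diff_UNIV)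
  have "rsq (crd c e p) = (\<Sum>j\<in>-{j0}. (1 / (1 - e * \<sigma> $ j0))\<^sup>2 * (\<sigma> $ j)\<^sup>2)"
    unfolding rsq_def using assms(1)
    by (intro sum.cong) (auto simp: crd_def p(1) crds pole_def power_mult_distrib power_divide)
  also have "\<dots> = (1 - (\<sigma> $ j0)\<^sup>2) / (1 - e * \<sigma> $ j0)\<^sup>2"
    unfolding sum_distrib_left[symmetric] s by (simp add: power_divide)
  \<comment> \<open>Since e^2 = 1, the numerator factors as (1 - e \<sigma>_j0) (1 + e
    \<sigma>_j0).\<close>
  also have "\<dots> = (1 + e * \<sigma> $ j0) / (1 - e * \<sigma> $ j0)"
    using d assms(1) by (auto simp: pole_def power2_eq_square divide_simps) (simp_all add: algebra_simps)
  finally have r: "rsq (crd c e p) = (1 + e * \<sigma> $ j0) / (1 - e * \<sigma> $ j0)" .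
  have 1: "1 + rsq (crd c e p) = 2 / (1 - e * \<sigma> $ j0)"
    using d by (simp add: r field_simps)
  have 2: "(rsq (crd c e p) - 1) / (1 + rsq (crd c e p)) = e * \<sigma> $ j0"
    unfolding 1 using d by (simp add: r field_simps)
  have "sph e (crd c e p) = \<sigma>"
    unfolding vec_eq_iff
  proof
    fix j
    show "sph e (crd c e p) $ j = \<sigma> $ j"
    proof (cases "j = j0")
      case True
      then have "sph e (crd c e p) $ j = e * ((rsq (crd c e p) - 1) / (1 + rsq (crd c e p)))"
        by (simp add: sph_def)
      then show ?thesis unfolding 2 using assms(1) True by (auto simp: pole_def)
    next
      case False
      then have "sph e (crd c e p) $ j
          = (if j = j1 then e else 1) * (2 * crd c e p $ Some j / (2 / (1 - e * \<sigma> $ j0)))"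
        unfolding 1[symmetric] by (simp add: sph_def)
      then show ?thesis
        unfolding crd_Some[OF False] p(1) crds using d assms(1) by (auto simp: pole_def)
    qed
  qed
  then show "par e (crd c e p) = p"
    by (simp add: par_def crd_None crd_j0 p(1) crds)
  show "crd c e p \<in> win c"
    using p(2-4) by (simp add: win_def crd_None crd_j0 p(1) crds)
qed

lemma crd_image:
  assumes "pole e"
  shows "crd c e ` dom c e = win c"
proof
  show "crd c e ` dom c e \<subseteq> win c" using par_crd[OF assms] by auto
  show "win c \<subseteq> crd c e ` dom c e"
    using par_in_dom[OF assms] crd_par[OF assms] by (metis imageI subsetI)
qed

lemma continuous_on_rsq [continuous_intros]: "continuous_on S rsq"
  unfolding rsq_def by (intro continuous_intros)

lemma continuous_on_par: "continuous_on S (par e)"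
proof -
  have "continuous_on S (sph e)"
    unfolding sph_def
  proof (rule continuous_on_vec_lambda)
    fix j
    show "continuous_on S (\<lambda>v. if j = j0 then e * (rsq v - 1) / (1 + rsq v)
      else (if j = j1 then e else 1) * (2 * v $ Some j / (1 + rsq v)))"
      by (cases "j = j0"; cases "j = j1") (auto intro!: continuous_intros)
  qed
  then show ?thesis
    unfolding par_def by (intro continuous_on_emb continuous_intros)
qed

lemma continuous_on_crd:
  assumes "pole e"
  shows "continuous_on (dom c e) (crd c e)"
proof -
  have far: "dom c e \<subseteq> far c" by (auto simp: dom_eq)
  note c = continuous_on_subset[OF continuous_on_xcrd far] continuous_on_subset[OF continuous_on_ycrd far]
    continuous_on_subset[OF continuous_on_scrd far]
  have d: "1 - e * scrd c p $ j0 \<noteq> 0" if "p \<in> dom c e" for p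
    using that assms by (auto simp: dom_def scrd_emb pole_def)
  have "continuous_on (dom c e) (\<lambda>p. crd c e p $ i)" for i
  proof (cases i)
    case None
    then show ?thesis using c by (simp add: crd_None) (intro continuous_intros)
  next
    case (Some j)
    show ?thesis
    proof (cases "j = j0")
      case True
      then show ?thesis using c Some by (simp add: crd_j0)
    next
      case False
      then show ?thesis
        unfolding Some crd_Some[OF False] using c d by (intro continuous_intros) auto
    qed
  qed
  then show ?thesis using continuous_on_vec_lambda[of "dom c e" "\<lambda>i p. crd c e p $ i"] by simp
qed

lemma openin_win: "openin (top_of_set half_space) (win c)"
proof -
  have "open {v :: real ^ ('m option). v $ None < 2}" "open {v :: real ^ ('m option). \<bar>v $ Some j0 - c\<bar> < pi / 2}"
    by (intro open_Collect_less continuous_intros)+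
  moreover have "win c = half_space \<inter> ({v. v $ None < 2} \<inter> {v. \<bar>v $ Some j0 - c\<bar> < pi / 2})"
    by (auto simp: win_def half_space_def)
  ultimately show ?thesis by auto
qed

lemma dom_subset_X: "dom c e \<subseteq> X"
  by (auto simp: dom_eq)

lemma is_chart_crd:
  assumes "pole e"
  shows "is_chart T (dom c e, crd c e)"
proof -
  have "homeomorphic_map (top_of_set (dom c e)) (top_of_set (win c)) (crd c e)"
  proof (rule homeomorphic_maps_imp_map)
    show "homeomorphic_maps (top_of_set (dom c e)) (top_of_set (win c)) (crd c e) (par e)"
      unfolding homeomorphic_maps_def
      using continuous_on_crd[OF assms] continuous_on_par par_crd[OF assms] crd_par[OF assms] par_in_dom[OF assms]
      by auto
  qed
  moreover have "subtopology T (dom c e) = top_of_set (dom c e)"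
    unfolding T_def subtopology_subtopology using dom_subset_X by (metis inf.absorb2)
  ultimately show ?thesis
    using openin_dom openin_win by (simp add: is_chart_def crd_image[OF assms])
qed

end

lemma Ck_on_nth [simp]: "open U \<Longrightarrow> Ck_on k U (\<lambda>v :: real ^ 'n. v $ i)"
  by (rule Ck_on_linear[OF _ bounded_linear_vec_nth])

lemma Ck_on_diff:
  fixes f g :: "'a::euclidean_space \<Rightarrow> real"
  assumes "open U" "Ck_on k U f" "Ck_on k U g"
  shows "Ck_on k U (\<lambda>x. f x - g x)"
  using Ck_on_add[OF assms(1,2) Ck_on_mult[OF assms(1) Ck_on_const[OF assms(1), of k "-1"] assms(3)]] by simp

lemma Ck_on_sum:
  assumes "open U" "finite A" "\<And>i. i \<in> A \<Longrightarrow> Ck_on k U (f i)"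
  shows "Ck_on k U (\<lambda>x. \<Sum>i\<in>A. f i x)"
  using assms(2,3) by (induction A rule: finite_induct) (auto intro: Ck_on_add Ck_on_const assms(1))

lemma Ck_on_divide:
  fixes f g :: "'a::euclidean_space \<Rightarrow> real"
  assumes "open U" "Ck_on k U f" "Ck_on k U g" "\<And>x. x \<in> U \<Longrightarrow> g x \<noteq> 0"
  shows "Ck_on k U (\<lambda>x. f x / g x)"
  using Ck_on_mult[OF assms(1,2) Ck_on_inverse[OF assms(1,3,4)]] by (simp add: divide_inverse)

lemma inner_reflection [simp]:
  assumes "norm a = 1"
  shows "reflection a x \<bullet> reflection a y = x \<bullet> y"
proof -
  have "a \<bullet> a = 1" using assms by (simp add: dot_square_norm)
  then show ?thesis
    by (simp add: reflection_def inner_diff_left inner_diff_right inner_commute algebra_simps)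
qed

lemma linear_reflection: "linear (reflection a)"
  by (intro linearI) (simp_all add: reflection_def inner_add_right algebra_simps)

lemma det_matrix_reflection: "norm a = 1 \<Longrightarrow> det (matrix (reflection a)) = -1"
  by (rule det_reflection) (simp_all add: linear_reflection matrix_works)

lemma det_matrix_reflection_pair:
  assumes "norm a = 1" "norm b = 1"
  shows "det (matrix (\<lambda>x. reflection a (reflection b x))) = 1"
proof -
  have "matrix (\<lambda>x. reflection a (reflection b x)) = matrix (reflection a) ** matrix (reflection b)"
    using matrix_compose[OF linear_reflection linear_reflection] by (simp add: o_def)
  then show ?thesis using assms by (simp add: det_mul det_matrix_reflection)
qed

section \<open>Transition maps and the smooth atlas\<close>

context twisted_slab
begin

text \<open>The coordinate change for the m-th power of the gluing map, with q the product of the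
  two poles. For q = -1 the stereographic coordinates are inverted. The sign at \<open>j1\<close>
  collects the reflection of the gluing map and the convention in \<open>sph\<close>.\<close>

definition trn :: "int \<Rightarrow> real \<Rightarrow> real ^ ('m option) \<Rightarrow> real ^ ('m option)" where
  "trn m q v = (\<chi> i. case i of None \<Rightarrow> 1 - sg m * (1 - v $ None)
    | Some j \<Rightarrow> if j = j0 then v $ Some j0 + of_int m * pi
        else (if j = j1 then sg m * q else 1) * v $ Some j / (if q = 1 then 1 else rsq v))"

lemma trn_nth:
  "trn m q v $ None = 1 - sg m * (1 - v $ None)"
  "trn m q v $ Some j0 = v $ Some j0 + of_int m * pi"
  "j \<noteq> j0 \<Longrightarrow> trn m q v $ Some j
    = (if j = j1 then sg m * q else 1) * v $ Some j / (if q = 1 then 1 else rsq v)"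
  by (simp_all add: trn_def)

lemma crd_sph:
  assumes "pole e" "j \<noteq> j0"
  shows "v $ Some j = (if j = j1 then e else 1) * sph e v $ j / (1 - e * sph e v $ j0)"
proof -
  have "1 - e * sph e v $ j0 = 2 / (1 + rsq v)"
    using assms(1) by (auto simp: sph_def pole_def field_simps)
  then show ?thesis using assms by (auto simp: sph_def pole_def)
qed

text \<open>Two representatives differ by a power of the gluing map, which leaves the entry
  \<open>j0\<close> alone. For opposite poles, \<open>rsq v = 0\<close> would describe the very pole
  that the chart with e omits.\<close>

lemma par_eqD:
  assumes "pole e" "pole e'" "par e u = par e' v"
  obtains m where "u = trn m (e * e') v" "e * e' \<noteq> 1 \<Longrightarrow> rsq v \<noteq> 0"
proof -
  obtain m where m: "u $ Some j0 = v $ Some j0 + of_int m * pi" "1 - u $ None = sg m * (1 - v $ None)"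
    "sph e u = flip (sg m) (sph e' v)"
    using emb_eqD assms(3)[symmetric] unfolding par_def by metis
  have s0: "sph e u $ j0 = sph e' v $ j0" using j01 by (simp add: m(3) flip_nth)
  have r: "rsq v \<noteq> 0" if "e * e' \<noteq> 1"
  proof
    assume "rsq v = 0"
    then have "sph e u $ j0 = e"
      unfolding s0 using that assms(1,2) by (auto simp: sph_def pole_def)
    then show False using sph_j0_ne[OF assms(1)] by simp
  qed
  have d: "1 - e * sph e' v $ j0 = (if e * e' = 1 then 2 / (1 + rsq v) else 2 * rsq v / (1 + rsq v))"
    using assms(1,2) by (auto simp: sph_def pole_def divide_simps)
  have "u $ Some j = trn m (e * e') v $ Some j" if j: "j \<noteq> j0" for j
  proof -
    have "u $ Some j = (if j = j1 then e else 1) * flip (sg m) (sph e' v) $ j / (1 - e * sph e' v $ j0)"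
      unfolding s0[symmetric] m(3)[symmetric] by (rule crd_sph[OF assms(1) j])
    also have "\<dots> = trn m (e * e') v $ Some j"
      unfolding d trn_nth(3)[OF j] using j r
      by (cases "e * e' = 1") (auto simp: flip_nth sph_def)
    finally show ?thesis .
  qed
  moreover have "u $ None = trn m (e * e') v $ None"
    using m(2) unfolding trn_nth by linarith
  moreover have "u $ Some j0 = trn m (e * e') v $ Some j0"
    using m(1) unfolding trn_nth by simp
  ultimately have "u = trn m (e * e') v"
    unfolding vec_eq_iff by (metis not_Some_eq)
  with r that show thesis by blast
qed

abbreviation chart :: "real \<Rightarrow> real \<Rightarrow> (nat \<Rightarrow> real, 'm) chart" where
  "chart c e \<equiv> (dom c e, crd c e)"

definition atlas :: "(nat \<Rightarrow> real, 'm) chart set" where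
  "atlas = {chart c e | c e. pole e}"

lemma transition_chart:
  assumes "pole e'" "w \<in> win c'"
  shows "transition (chart c e) (chart c' e') w = crd c e (par e' w)"
proof -
  have "inj_on (crd c' e') (dom c' e')"
    by (rule inj_on_inverseI) (rule par_crd(1)[OF assms(1)])
  then have "inv_into (dom c' e') (crd c' e') w = par e' w"
    using crd_par[OF assms] par_in_dom[OF assms] by (metis inv_into_f_f)
  then show ?thesis by (simp add: transition_def)
qed

text \<open>This is open in the whole space and not only in the half-space, so that
  \<open>trn\<close> on it can serve as the local smooth extension that \<open>smooth_on\<close>
  demands.\<close>

definition trn_dom :: "int \<Rightarrow> real \<Rightarrow> real \<Rightarrow> (real ^ ('m option)) set" where
  "trn_dom m q c = {w. \<bar>w $ Some j0 + of_int m * pi - c\<bar> < pi / 2} \<inter> {w. q \<noteq> 1 \<longrightarrow> rsq w \<noteq> 0}"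

lemma open_rsq_nonzero: "open {w. q \<noteq> (1::real) \<longrightarrow> rsq w \<noteq> 0}"
proof -
  have "open {w. rsq w \<noteq> 0}"
    by (intro open_Collect_neq continuous_intros)
  then show ?thesis by (cases "q = 1") auto
qed

lemma open_trn_dom: "open (trn_dom m q c)"
  unfolding trn_dom_def by (intro open_Int open_rsq_nonzero open_Collect_less continuous_intros)

lemma overlap_image:
  assumes "pole e'"
  shows "crd c' e' ` (dom c e \<inter> dom c' e') = {w \<in> win c'. par e' w \<in> dom c e}"
proof
  show "crd c' e' ` (dom c e \<inter> dom c' e') \<subseteq> {w \<in> win c'. par e' w \<in> dom c e}"
    using par_crd[OF assms] by auto
  show "{w \<in> win c'. par e' w \<in> dom c e} \<subseteq> crd c' e' ` (dom c e \<inter> dom c' e')"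
    using par_in_dom[OF assms] crd_par[OF assms] by (intro subsetI) (metis (mono_tags, lifting) IntI imageI mem_Collect_eq)
qed

lemma openin_overlap:
  assumes "pole e'"
  shows "openin (top_of_set half_space) (crd c' e' ` (dom c e \<inter> dom c' e'))"
proof -
  have "openin (top_of_set (win c')) (win c' \<inter> par e' -` dom c e)"
    using subsetD[OF dom_subset_X par_in_dom[OF assms]]
    by (intro continuous_openin_preimage[where T = X] continuous_on_par openin_dom[unfolded T_def]) auto
  then have "openin (top_of_set half_space) (win c' \<inter> par e' -` dom c e)"
    using openin_win openin_trans by blast
  then show ?thesis
    unfolding overlap_image[OF assms] by (simp add: vimage_def Int_def)
qed

text \<open>On the overlap of two charts the integer \<open>m\<close> is determined by \<open>y\<close>, because the windows
  are open intervals of length \<open>\<pi>\<close>.\<close>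

lemma transition_local:
  assumes "pole e" "pole e'" "p \<in> dom c e \<inter> dom c' e'"
  obtains m where "crd c e p = trn m (e * e') (crd c' e' p)"
    and "crd c' e' p \<in> trn_dom m (e * e') c"
    and "\<forall>w\<in>crd c' e' ` (dom c e \<inter> dom c' e') \<inter> trn_dom m (e * e') c.
      transition (chart c e) (chart c' e') w = trn m (e * e') w"
proof -
  have step: "\<exists>m. crd c e p = trn m (e * e') (crd c' e' p) \<and> crd c' e' p \<in> trn_dom m (e * e') c"
    if p: "p \<in> dom c e \<inter> dom c' e'" for p
  proof -
    have "par e (crd c e p) = par e' (crd c' e' p)"
      using p par_crd[OF assms(1)] par_crd[OF assms(2)] by simp
    then obtain m where m: "crd c e p = trn m (e * e') (crd c' e' p)"
      "e * e' \<noteq> 1 \<Longrightarrow> rsq (crd c' e' p) \<noteq> 0"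
      using par_eqD[OF assms(1,2)] by metis
    have "crd c e p \<in> win c" using p par_crd[OF assms(1)] by simp
    then have "crd c' e' p \<in> trn_dom m (e * e') c"
      using m by (simp add: trn_dom_def win_def trn_nth)
    with m show ?thesis by blast
  qed
  from step[OF assms(3)] obtain m where m: "crd c e p = trn m (e * e') (crd c' e' p)"
    "crd c' e' p \<in> trn_dom m (e * e') c" by blast
  have "transition (chart c e) (chart c' e') w = trn m (e * e') w"
    if w: "w \<in> crd c' e' ` (dom c e \<inter> dom c' e') \<inter> trn_dom m (e * e') c" for w
  proof -
    from w obtain p' where p': "p' \<in> dom c e \<inter> dom c' e'" "w = crd c' e' p'" by auto
    from step[OF p'(1)] obtain k where k: "crd c e p' = trn k (e * e') w" "w \<in> trn_dom k (e * e') c"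
      unfolding p'(2) by blast
    have "\<bar>of_int m * pi - of_int k * pi\<bar> < pi"
    proof -
      have "\<bar>w $ Some j0 + of_int k * pi - c\<bar> < pi / 2" "\<bar>w $ Some j0 + of_int m * pi - c\<bar> < pi / 2"
        using k(2) w by (auto simp: trn_dom_def)
      then show ?thesis unfolding abs_less_iff by argo
    qed
    then have "\<bar>of_int (m - k)\<bar> * pi < 1 * pi" by (simp add: abs_mult left_diff_distrib[symmetric])
    then have "\<bar>of_int (m - k)\<bar> < (1::real)" by (simp only: mult_less_cancel_right_pos pi_gt_zero)
    then have "m = k" by linarith
    moreover have "transition (chart c e) (chart c' e') w = crd c e p'"
      using transition_chart[OF assms(2)] p' par_crd[OF assms(2)] by (metis IntD2)
    ultimately show ?thesis using k(1) by simp
  qed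
  with m that show thesis by blast
qed

lemma Ck_on_rsq: "open U \<Longrightarrow> Ck_on k U rsq"
  unfolding rsq_def power2_eq_square by (intro Ck_on_sum Ck_on_mult Ck_on_nth finite) auto

lemma Ck_on_trn:
  assumes "open U" "U \<subseteq> {w. q \<noteq> 1 \<longrightarrow> rsq w \<noteq> 0}"
  shows "Ck_on k U (trn m q)"
proof (rule Ck_on_vec[OF assms(1)])
  fix i
  show "Ck_on k U (\<lambda>v. trn m q v $ i)"
  proof (cases i)
    case None
    then show ?thesis
      unfolding None trn_nth by (intro Ck_on_diff Ck_on_mult Ck_on_const Ck_on_nth assms(1))
  next
    case (Some j)
    show ?thesis
    proof (cases "j = j0")
      case True
      then show ?thesis
        unfolding Some True trn_nth by (intro Ck_on_add Ck_on_const Ck_on_nth assms(1))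
    next
      case False
      show ?thesis
        unfolding Some trn_nth(3)[OF False]
      proof (intro Ck_on_divide Ck_on_mult Ck_on_const Ck_on_nth assms(1))
        show "Ck_on k U (\<lambda>v. if q = 1 then 1 else rsq v)"
          by (cases "q = 1") (simp_all add: Ck_on_const Ck_on_rsq assms(1))
      qed (use assms(2) in auto)
    qed
  qed
qed

lemma dom_cover: "(\<Union>c\<in>atlas. fst c) = X"
proof
  show "(\<Union>c\<in>atlas. fst c) \<subseteq> X" using subsetD[OF dom_subset_X] by (auto simp: atlas_def)
  show "X \<subseteq> (\<Union>c\<in>atlas. fst c)"
  proof
    fix p assume "p \<in> X"
    then obtain y x \<sigma> where p: "p = emb y x \<sigma>" "\<bar>x\<bar> \<le> 1" "norm \<sigma> = 1" by (auto simp: X_def)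
    define e :: real where "e = (if \<sigma> $ j0 = 1 then -1 else 1)"
    have e: "pole e" "\<sigma> $ j0 \<noteq> e" by (auto simp: e_def pole_def)
    show "p \<in> (\<Union>c\<in>atlas. fst c)"
    proof (cases "x = -1")
      case False
      then have "p \<in> dom y e" unfolding dom_def p(1) using p(2,3) e
        by (intro CollectI exI[of _ y] exI[of _ x] exI[of _ \<sigma>]) auto
      then show ?thesis using e(1) by (auto simp: atlas_def)
    next
      case True
      \<comment> \<open>The gluing map replaces x = -1 by x = 1 and keeps the entry
        \<open>j0\<close> of \<sigma>, so the choice of the pole remains valid.\<close>
      have "p = emb (y + of_int 1 * pi) (sg 1 * x) (flip (sg 1) \<sigma>)" by (simp only: p(1) emb_shift)
      then have "p \<in> dom (y + of_int 1 * pi) e" unfolding dom_def using p(2,3) e True j01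
        by (intro CollectI exI[of _ "y + of_int 1 * pi"] exI[of _ "sg 1 * x"] exI[of _ "flip (sg 1) \<sigma>"])
          (auto simp: sg_def flip_nth norm_flip[of 1, unfolded sg_def, simplified])
      then show ?thesis using e(1) by (auto simp: atlas_def)
    qed
  qed
qed

lemma smooth_atlas_atlas: "smooth_atlas T atlas"
  unfolding smooth_atlas_def
proof (intro conjI ballI)
  show "is_chart T c" if "c \<in> atlas" for c
    using that is_chart_crd by (auto simp: atlas_def)
  show "(\<Union>c\<in>atlas. fst c) = topspace T" by (simp add: dom_cover)
  fix C D assume "C \<in> atlas" "D \<in> atlas"
  then obtain c e c' e' where C: "C = chart c e" "pole e" and D: "D = chart c' e'" "pole e'"
    by (auto simp: atlas_def)
  show "smooth_on (snd D ` (fst C \<inter> fst D)) (transition C D)"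
    unfolding smooth_on_def
  proof
    fix v assume "v \<in> snd D ` (fst C \<inter> fst D)"
    then obtain p where p: "p \<in> dom c e \<inter> dom c' e'" "v = crd c' e' p" by (auto simp: C D)
    obtain m where m: "v \<in> trn_dom m (e * e') c"
      "\<forall>w\<in>crd c' e' ` (dom c e \<inter> dom c' e') \<inter> trn_dom m (e * e') c.
        transition C D w = trn m (e * e') w"
      using transition_local[OF C(2) D(2) p(1)] unfolding C(1) D(1) p(2) by metis
    have "Ck_on k (trn_dom m (e * e') c) (trn m (e * e'))" for k
      by (rule Ck_on_trn[OF open_trn_dom]) (auto simp: trn_dom_def)
    then show "\<exists>U F. open U \<and> v \<in> U \<and> (\<forall>k. Ck_on k U F) \<and>
        (\<forall>y\<in>snd D ` (fst C \<inter> fst D) \<inter> U. F y = transition C D y)"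
      using m open_trn_dom by (intro exI[of _ "trn_dom m (e * e') c"] exI[of _ "trn m (e * e')"])
        (simp add: C D)
  qed
qed

lemma smooth_manifold_T: "smooth_manifold T atlas"
proof -
  have "Hausdorff_space T"
    unfolding T_def by (intro Hausdorff_space_subtopology) (simp add: Hausdorff_space_euclidean)
  moreover have "second_countable T"
  proof -
    obtain B :: "(nat \<Rightarrow> real) set set" where "countable B" "topological_basis B"
      using ex_countable_basis by blast
    have "\<forall>V\<in>B. openin euclidean V"
      using topological_basis_open[OF \<open>topological_basis B\<close>] by simp
    moreover have "\<forall>U x. openin euclidean U \<and> x \<in> U \<longrightarrow> (\<exists>V\<in>B. x \<in> V \<and> V \<subseteq> U)"
      using topological_basisE[OF \<open>topological_basis B\<close>] by (metis open_openin)
    ultimately have "second_countable (euclidean :: (nat \<Rightarrow> real) topology)"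
      using \<open>countable B\<close> unfolding second_countable_def by blast
    then show ?thesis unfolding T_def by (rule second_countable_subtopology)
  qed
  ultimately show ?thesis by (simp add: smooth_manifold_def smooth_atlas_atlas)
qed

end

section \<open>The metric\<close>

lemma has_derivative_nth: "((\<lambda>v. v $ i) has_derivative (\<lambda>h. h $ i)) F"
  by (rule bounded_linear_imp_has_derivative[OF bounded_linear_vec_nth])

context twisted_slab
begin

definition dtrn :: "int \<Rightarrow> real \<Rightarrow> real ^ ('m option) \<Rightarrow> real ^ ('m option) \<Rightarrow> real ^ ('m option)" where
  "dtrn m q v h = (\<chi> i. case i of None \<Rightarrow> sg m * h $ None
    | Some j \<Rightarrow> if j = j0 then h $ Some j0
        else (if j = j1 then sg m * q else 1) * (if q = 1 then h $ Some j
          else h $ Some j / rsq v - v $ Some j * (2 * (\<Sum>l\<in>-{j0}. v $ Some l * h $ Some l)) / (rsq v)\<^sup>2))"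

lemma dtrn_nth:
  "dtrn m q v h $ None = sg m * h $ None"
  "dtrn m q v h $ Some j0 = h $ Some j0"
  "j \<noteq> j0 \<Longrightarrow> dtrn m q v h $ Some j = (if j = j1 then sg m * q else 1) * (if q = 1 then h $ Some j
          else h $ Some j / rsq v - v $ Some j * (2 * (\<Sum>l\<in>-{j0}. v $ Some l * h $ Some l)) / (rsq v)\<^sup>2)"
  by (simp_all add: dtrn_def)

lemma has_derivative_rsq:
  "(rsq has_derivative (\<lambda>h. 2 * (\<Sum>l\<in>-{j0}. v $ Some l * h $ Some l))) (at v within S)"
proof -
  have "(rsq has_derivative (\<lambda>h. \<Sum>l\<in>-{j0}. of_nat 2 * h $ Some l * (v $ Some l) ^ (2 - 1))) (at v within S)"
    unfolding rsq_def by (intro has_derivative_sum has_derivative_power has_derivative_nth)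
  then show ?thesis by (simp add: sum_distrib_left mult_ac)
qed

lemma has_derivative_trn:
  assumes "q \<noteq> 1 \<Longrightarrow> rsq v \<noteq> 0"
  shows "(trn m q has_derivative dtrn m q v) (at v within S)"
proof (rule has_derivative_vec)
  fix i
  show "((\<lambda>v. trn m q v $ i) has_derivative (\<lambda>h. dtrn m q v h $ i)) (at v within S)"
  proof (cases i)
    case None
    have "((\<lambda>v. 1 - sg m * (1 - v $ None)) has_derivative (\<lambda>h. 0 - sg m * (0 - h $ None))) (at v within S)"
      by (intro has_derivative_diff has_derivative_const has_derivative_mult_right has_derivative_nth)
    then show ?thesis by (simp add: None trn_nth dtrn_nth)
  next
    case (Some j)
    show ?thesis
    proof (cases "j = j0")
      case True
      have "((\<lambda>v. v $ Some j0 + of_int m * pi) has_derivative (\<lambda>h. h $ Some j0 + 0)) (at v within S)"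
        by (intro has_derivative_add has_derivative_const has_derivative_nth)
      then show ?thesis by (simp add: Some True trn_nth dtrn_nth)
    next
      case j: False
      show ?thesis
      proof (cases "q = 1")
        case True
        show ?thesis
          unfolding Some trn_nth(3)[OF j] dtrn_nth(3)[OF j] if_P[OF True] div_by_1
          by (intro has_derivative_mult_right has_derivative_nth)
      next
        case False
        have "((\<lambda>v. v $ Some j / rsq v) has_derivative
            (\<lambda>h. (h $ Some j * rsq v - v $ Some j * (2 * (\<Sum>l\<in>-{j0}. v $ Some l * h $ Some l))) / (rsq v * rsq v)))
            (at v within S)"
          using assms[OF False] by (intro has_derivative_divide' has_derivative_nth has_derivative_rsq)
        then have "((\<lambda>v. (if j = j1 then sg m * q else 1) * (v $ Some j / rsq v)) has_derivative
            (\<lambda>h. (if j = j1 then sg m * q else 1) * ((h $ Some j * rsq v - v $ Some j * (2 * (\<Sum>l\<in>-{j0}. v $ Some l * h $ Some l))) / (rsq v * rsq v))))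
            (at v within S)"
          by (rule has_derivative_mult_right)
        then show ?thesis
          unfolding Some trn_nth(3)[OF j] dtrn_nth(3)[OF j] if_not_P[OF False]
          using assms[OF False] by (simp add: diff_divide_distrib power2_eq_square)
      qed
    qed
  qed
qed

lemma linear_dtrn: "linear (dtrn m q v)"
proof (cases "q \<noteq> 1 \<and> rsq v = 0")
  case False
  then show ?thesis using has_derivative_trn has_derivative_linear by metis
next
  \<comment> \<open>At the centre of the inversion the formula of \<open>dtrn\<close> divides by 0;
    its quotients are then 0 and it is still linear.\<close>
  case True
  then show ?thesis
    by (intro linearI) (auto simp: vec_eq_iff dtrn_def algebra_simps split: option.split)
qed

text \<open>The overlap is open in the half-space and m is locally constant, so the derivative
  within the half-space sees only \<open>trn\<close> with a fixed m.\<close>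

lemma transition_jacobian_chart:
  assumes "pole e" "pole e'" "p \<in> dom c e \<inter> dom c' e'"
  obtains m where "crd c e p = trn m (e * e') (crd c' e' p)"
    "crd c' e' p \<in> trn_dom m (e * e') c"
    "transition_jacobian (chart c e) (chart c' e') p = matrix (dtrn m (e * e') (crd c' e' p))"
proof -
  define v where "v = crd c' e' p"
  define S where "S = crd c' e' ` (dom c e \<inter> dom c' e')"
  obtain m where m: "crd c e p = trn m (e * e') v" "v \<in> trn_dom m (e * e') c"
    "\<forall>w\<in>S \<inter> trn_dom m (e * e') c. transition (chart c e) (chart c' e') w = trn m (e * e') w"
    by (rule transition_local[OF assms, folded v_def S_def])
  have vS: "v \<in> S" using assms(3) by (auto simp: v_def S_def)
  have "openin (top_of_set half_space) (S \<inter> trn_dom m (e * e') c)"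
    unfolding S_def by (intro openin_Int_open openin_overlap assms(2) open_trn_dom)
  then obtain d where d: "0 < d" "ball v d \<inter> half_space \<subseteq> S \<inter> trn_dom m (e * e') c"
    using vS m(2) unfolding openin_contains_ball by blast
  have v: "v \<in> half_space"
    using par_crd(2)[OF assms(2)] assms(3) by (auto simp: v_def win_def half_space_def)
  have tr: "(trn m (e * e') has_derivative dtrn m (e * e') v) (at v within half_space)"
    using m(2) by (intro has_derivative_trn) (auto simp: trn_dom_def)
  have D: "(transition (chart c e) (chart c' e') has_derivative dtrn m (e * e') v) (at v within half_space)"
  proof (rule has_derivative_transform_within[OF tr d(1) v])
    fix w assume "w \<in> half_space" "dist w v < d"
    then have "w \<in> S \<inter> trn_dom m (e * e') c" using d(2) by (auto simp: dist_commute)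
    then show "trn m (e * e') w = transition (chart c e) (chart c' e') w" using m(3) by simp
  qed
  then have "(transition (chart c e) (chart c' e') has_derivative
      frechet_derivative (transition (chart c e) (chart c' e')) (at v within half_space)) (at v within half_space)"
    by (metis differentiable_def frechet_derivative_works)
  then have "frechet_derivative (transition (chart c e) (chart c' e')) (at v within half_space) = dtrn m (e * e') v"
    using has_derivative_half_space_unique[OF v _ D] by blast
  then have "transition_jacobian (chart c e) (chart c' e') p = matrix (dtrn m (e * e') v)"
    by (simp add: transition_jacobian_def jacobian_def v_def)
  with m(1,2) that show thesis unfolding v_def by blast
qed

section \<open>The metric and its orthonormal frames\<close>

definition N :: real where
  "N = real CARD('m) + 1"

text \<open>Chosen for \<open>abs_err_le\<close>: the two terms of \<open>err\<close> are then at
  most 3 N^2 \<delta> = 3/100 and 4 N^2 \<delta>^2 = 4 \<delta> / 100.\<close>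

definition \<delta> :: real where
  "\<delta> = 1 / (100 * N\<^sup>2)"

definition theta :: "real ^ ('m option) \<Rightarrow> real" where
  "theta v = \<delta> * cos (v $ Some j0) * (1 - v $ None)"

text \<open>The logarithm of the conformal factor 2 / (1 + r^2) of the round metric in stereographic
  coordinates, where r^2 is \<open>rsq\<close>.\<close>

definition lam :: "real ^ ('m option) \<Rightarrow> real" where
  "lam v = ln 2 - ln (1 + rsq v)"

text \<open>The metric is \<open>a\<^sup>2 exp (n \<theta>) dx\<^sup>2 + exp (2 \<theta>) (dy\<^sup>2 + g)\<close>, where \<open>g\<close> is the metric of
  the round sphere and \<open>\<theta> = \<delta> x cos y\<close>. The exponent \<open>n/2\<close> makes the second fundamental
  forms of the slices \<open>x = const\<close> contribute nothing to the scalar curvature, as in a Kasner metric.\<close>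

definition ph :: "real \<Rightarrow> 'm option \<Rightarrow> real ^ ('m option) \<Rightarrow> real" where
  "ph a i v = (case i of None \<Rightarrow> ln a + N / 2 * theta v
    | Some j \<Rightarrow> if j = j0 then theta v else theta v + lam v)"

lemma ph_simps:
  "ph a None v = ln a + N / 2 * theta v" "ph a (Some j0) v = theta v"
  "j \<noteq> j0 \<Longrightarrow> ph a (Some j) v = theta v + lam v"
  by (simp_all add: ph_def)

definition met :: "real \<Rightarrow> real ^ ('m option) \<Rightarrow> real ^ ('m option) ^ ('m option)" where
  "met a v = diag (\<lambda>i. exp (2 * ph a i v))"

definition frm :: "real \<Rightarrow> real ^ ('m option) \<Rightarrow> real ^ ('m option) ^ ('m option)" where
  "frm a v = diag (\<lambda>i. exp (- ph a i v))"

text \<open>The radial unit vector of the stereographic coordinates. The differential of the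
  inversion is the reflection along it, divided by \<open>rsq\<close>.\<close>

definition eta :: "real ^ ('m option) \<Rightarrow> real ^ ('m option)" where
  "eta v = (\<chi> i. case i of None \<Rightarrow> 0 | Some j \<Rightarrow> if j = j0 then 0 else v $ Some j / sqrt (rsq v))"

lemma eta_nth:
  "eta v $ None = 0" "eta v $ Some j0 = 0" "j \<noteq> j0 \<Longrightarrow> eta v $ Some j = v $ Some j / sqrt (rsq v)"
  by (simp_all add: eta_def)

lemma sum_option:
  "(\<Sum>i\<in>UNIV. f i) = f None + f (Some j0) + (\<Sum>j\<in>-{j0}. f (Some j))" for f :: "'m option \<Rightarrow> real"
proof -
  have "(\<Sum>i\<in>UNIV. f i) = f None + (\<Sum>j\<in>UNIV. f (Some j))"
    by (simp add: UNIV_option_conv sum.reindex)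
  also have "(\<Sum>j\<in>UNIV. f (Some j)) = f (Some j0) + (\<Sum>j\<in>-{j0}. f (Some j))"
    by (simp add: sum.remove[of UNIV j0] Compl_eq_Diff_UNIV)
  finally show ?thesis by simp
qed

lemma eta_inner: "eta v \<bullet> h = (\<Sum>l\<in>-{j0}. v $ Some l * h $ Some l) / sqrt (rsq v)"
proof -
  have "(\<Sum>l\<in>-{j0}. eta v $ Some l * h $ Some l) = (\<Sum>l\<in>-{j0}. v $ Some l * h $ Some l / sqrt (rsq v))"
    by (intro sum.cong) (auto simp: eta_nth)
  then show ?thesis by (simp add: inner_vec_def sum_option eta_nth sum_divide_distrib)
qed

lemma norm_eta:
  assumes "rsq v \<noteq> 0"
  shows "norm (eta v) = 1"
proof -
  have "(\<Sum>l\<in>-{j0}. v $ Some l * eta v $ Some l) = (\<Sum>l\<in>-{j0}. (v $ Some l)\<^sup>2 / sqrt (rsq v))"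
    by (intro sum.cong) (auto simp: eta_nth power2_eq_square)
  then have "eta v \<bullet> eta v = rsq v / (sqrt (rsq v) * sqrt (rsq v))"
    by (simp add: eta_inner rsq_def[symmetric] sum_divide_distrib[symmetric])
  then show ?thesis using assms by (simp add: norm_eq_1)
qed

abbreviation e0 :: "real ^ ('m option)" where "e0 \<equiv> axis None 1"

abbreviation e1 :: "real ^ ('m option)" where "e1 \<equiv> axis (Some j1) 1"

lemma reflection_axis_nth: "reflection (axis i 1) h $ k = (if k = i then - h $ i else h $ k)"
  unfolding reflection_def inner_axis' by (simp add: axis_def)

text \<open>The orthogonal part of \<open>dtrn\<close>, written with reflections in pairs. A change
  of pole contributes \<open>eta\<close> from the inversion and \<open>e1\<close> from the
  convention in \<open>sph\<close>; an odd power of the gluing map contributes \<open>e0\<close> and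
  \<open>e1\<close>. Each pair has determinant 1 and lifts to a product of two unit vectors.\<close>

definition ortho :: "int \<Rightarrow> real \<Rightarrow> real ^ ('m option) \<Rightarrow> real ^ ('m option) \<Rightarrow> real ^ ('m option)" where
  "ortho m q v h =
    (let h' = if q = 1 then h else reflection e1 (reflection (eta v) h)
     in if even m then h' else reflection e0 (reflection e1 h'))"

lemma linear_ortho: "linear (ortho m q v)"
proof -
  have "linear (\<lambda>h. reflection a (reflection b h))" for a b :: "real ^ ('m option)"
    using linear_compose[OF linear_reflection linear_reflection] by (simp add: o_def)
  then have "linear (\<lambda>h. if q = 1 then h else reflection e1 (reflection (eta v) h))"
    by (cases "q = 1") (simp_all add: linear_id[unfolded id_def])
  then show ?thesis
    using linear_compose[OF _ \<open>\<And>a b. linear (\<lambda>h. reflection a (reflection b h))\<close>]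
    by (cases "even m") (simp_all add: ortho_def[abs_def] o_def)
qed

lemma ortho_inner:
  assumes "q \<noteq> 1 \<Longrightarrow> rsq v \<noteq> 0"
  shows "ortho m q v h \<bullet> ortho m q v k = h \<bullet> k"
  using assms by (simp add: ortho_def Let_def norm_eta)

lemma det_ortho:
  assumes "q \<noteq> 1 \<Longrightarrow> rsq v \<noteq> 0"
  shows "det (matrix (ortho m q v)) = 1"
proof -
  define f where "f h = (if q = 1 then h else reflection e1 (reflection (eta v) h))" for h
  define g where "g h = (if even m then h else reflection e0 (reflection e1 h))" for h
  have f: "linear f" "det (matrix f) = 1"
    using linear_compose[OF linear_reflection[of "eta v"] linear_reflection[of e1]]
      det_matrix_reflection_pair[of e1 "eta v"] norm_eta assms
    by (cases "q = 1"; simp add: f_def[abs_def] o_def linear_id[unfolded id_def] matrix_id_mat_1[unfolded id_def])+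
  have g: "linear g" "det (matrix g) = 1"
    using linear_compose[OF linear_reflection[of "e1"] linear_reflection[of e0]]
      det_matrix_reflection_pair[of e0 "e1"]
    by (cases "even m"; simp add: g_def[abs_def] o_def linear_id[unfolded id_def] matrix_id_mat_1[unfolded id_def])+
  have "ortho m q v = g \<circ> f" by (auto simp: ortho_def Let_def f_def g_def fun_eq_iff)
  then show ?thesis using matrix_compose[OF f(1) g(1)] f(2) g(2) by (simp add: det_mul)
qed

lemma theta_trn: "theta (trn m q v) = theta v"
  unfolding theta_def trn_nth cos_add_int_pi by (simp add: mult_ac)

lemma rsq_trn:
  assumes "q = 1 \<or> q = -1" "q \<noteq> 1 \<Longrightarrow> rsq v \<noteq> 0"
  shows "rsq (trn m q v) = (if q = 1 then rsq v else 1 / rsq v)"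
proof -
  have "rsq (trn m q v) = (\<Sum>j\<in>-{j0}. (v $ Some j)\<^sup>2 / (if q = 1 then 1 else rsq v)\<^sup>2)"
    unfolding rsq_def[of "trn m q v"] using assms(1)
    by (intro sum.cong) (auto simp: trn_nth power_divide power_mult_distrib)
  also have "\<dots> = rsq v / (if q = 1 then 1 else rsq v)\<^sup>2"
    by (simp add: rsq_def sum_divide_distrib)
  finally show ?thesis using assms(2) by (auto simp: power2_eq_square)
qed

lemma lam_trn:
  assumes "q = 1 \<or> q = -1" "q \<noteq> 1 \<Longrightarrow> rsq v \<noteq> 0"
  shows "lam (trn m q v) = lam v + (if q = 1 then 0 else ln (rsq v))"
proof -
  have "ln (1 + 1 / rsq v) = ln (1 + rsq v) - ln (rsq v)" if "rsq v \<noteq> 0"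
  proof -
    have "rsq v > 0" using that rsq_nonneg[of v] by linarith
    moreover have "1 + 1 / rsq v = (1 + rsq v) / rsq v" using that by (simp add: field_simps)
    ultimately show ?thesis by (simp add: ln_div)
  qed
  then show ?thesis using assms by (auto simp: lam_def rsq_trn)
qed

text \<open>The inversion scales by 1 / \<open>rsq\<close>, and \<open>lam\<close> changes by
  exactly the logarithm of \<open>rsq\<close>. The frames absorb this factor, and only
  \<open>ortho\<close> remains. The transformation law of the metric, the orientation and the frame
  cocycle all follow from this identity.\<close>

lemma dtrn_frm:
  assumes "q = 1 \<or> q = -1" "q \<noteq> 1 \<Longrightarrow> rsq v \<noteq> 0"
  shows "dtrn m q v (frm a v *v h) = frm a (trn m q v) *v ortho m q v h"
proof -
  have comp: "dtrn m q v (frm a v *v h) $ i = (frm a (trn m q v) *v ortho m q v h) $ i" for i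
  proof (cases i)
    case None
    have "ortho m q v h $ None = sg m * h $ None"
      by (auto simp: ortho_def Let_def reflection_axis_nth reflection_def[of "eta v"] eta_nth sg_def)
    then show ?thesis
      by (simp add: None dtrn_nth frm_def diag_mult_vec_nth ph_simps theta_trn)
  next
    case (Some j)
    show ?thesis
    proof (cases "j = j0")
      case True
      have "ortho m q v h $ Some j0 = h $ Some j0"
        using j01 by (auto simp: ortho_def Let_def reflection_axis_nth reflection_def[of "eta v"] eta_nth)
      then show ?thesis
        by (simp add: Some True dtrn_nth frm_def diag_mult_vec_nth ph_simps theta_trn)
    next
      case j: False
      define w where "w = exp (- (theta v + lam v))"
      define s where "s = (\<Sum>l\<in>-{j0}. v $ Some l * h $ Some l)"
      have fh: "(frm a v *v h) $ Some l = w * h $ Some l" if "l \<noteq> j0" for l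
        using that by (simp add: frm_def diag_mult_vec_nth ph_simps w_def)
      have sum: "(\<Sum>l\<in>-{j0}. v $ Some l * (frm a v *v h) $ Some l) = w * s"
        unfolding s_def sum_distrib_left by (intro sum.cong) (auto simp: fh)
      have rhs: "(frm a (trn m q v) *v ortho m q v h) $ Some j
          = (if q = 1 then w else w / rsq v) * ortho m q v h $ Some j"
      proof -
        have "rsq v > 0" if "q \<noteq> 1" using assms(2)[OF that] rsq_nonneg[of v] by linarith
        then have E: "exp (- (theta v + lam v + (if q = 1 then 0 else ln (rsq v)))) = (if q = 1 then w else w / rsq v)"
        proof (cases "q = 1")
          case False
          have "exp (- (x + ln (rsq v))) = exp (- x) / rsq v" for x
            using \<open>q \<noteq> 1 \<Longrightarrow> rsq v > 0\<close>[OF False]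
            by (simp only: minus_add_distrib exp_add exp_minus exp_ln) (simp add: field_simps)
          then show ?thesis using False by (simp only: w_def if_False)
        qed (simp add: w_def)
        have L: "lam (trn m q v) = lam v + (if q = 1 then 0 else ln (rsq v))"
          using assms by (rule lam_trn)
        show ?thesis
          unfolding frm_def diag_mult_vec_nth ph_simps(3)[OF j] theta_trn L add.assoc[symmetric] E ..
      qed
      show ?thesis
      proof (cases "q = 1")
        case True
        then have "ortho m q v h $ Some j = (if j = j1 then sg m else 1) * h $ Some j"
          by (auto simp: ortho_def Let_def reflection_axis_nth sg_def)
        then show ?thesis
          unfolding Some rhs dtrn_nth(3)[OF j] using True by (simp add: fh[OF j])
      next
        case False
        have refl: "reflection (eta v) h $ Some j = h $ Some j - 2 * (s / rsq v) * v $ Some j"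
          using j by (simp add: reflection_def eta_inner eta_nth s_def[symmetric] divide_divide_eq_left)
        have "ortho m q v h $ Some j
            = (if j = j1 then sg m * q else 1) * (h $ Some j - 2 * (s / rsq v) * v $ Some j)"
          using False assms(1) refl by (auto simp: ortho_def Let_def reflection_axis_nth sg_def)
        then show ?thesis
          unfolding Some rhs dtrn_nth(3)[OF j] fh[OF j] sum using False
          by (simp add: power2_eq_square diff_divide_distrib right_diff_distrib mult_ac)
      qed
    qed
  qed
  then show ?thesis by (simp add: vec_eq_iff)
qed

lemma matrix_inv_frm: "matrix_inv (frm a v) = diag (\<lambda>i. exp (ph a i v))"
  by (simp add: frm_def matrix_inv_diag exp_minus)

lemma frm_mult_inv: "matrix_inv (frm a v) ** frm a v = mat 1" "frm a v ** matrix_inv (frm a v) = mat 1"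
  unfolding matrix_inv_frm
  by (simp_all add: frm_def vec_eq_iff diag_mult_nth mat_def flip: exp_add)

lemma matrix_dtrn_frm:
  assumes "q = 1 \<or> q = -1" "q \<noteq> 1 \<Longrightarrow> rsq v \<noteq> 0"
  shows "matrix (dtrn m q v) ** frm a v = frm a (trn m q v) ** matrix (ortho m q v)"
  unfolding matrix_eq
  by (simp add: matrix_vector_mul_assoc[symmetric] matrix_works linear_dtrn linear_ortho dtrn_frm[OF assms])

lemma det_frm: "det (frm a v) > 0"
  by (simp add: frm_def det_diag prod_pos)

lemma det_dtrn:
  assumes "q = 1 \<or> q = -1" "q \<noteq> 1 \<Longrightarrow> rsq v \<noteq> 0"
  shows "det (matrix (dtrn m q v)) > 0"
proof -
  have "det (matrix (dtrn m q v)) * det (frm 1 v) = det (frm 1 (trn m q v))"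
    using arg_cong[OF matrix_dtrn_frm[OF assms, of m 1], of det] by (simp add: det_mul det_ortho assms(2))
  then show ?thesis using det_frm[of 1 v] det_frm[of 1 "trn m q v"] zero_less_mult_pos2 by metis
qed

lemma met_frm: "(frm a v *v h) \<bullet> (met a v *v (frm a v *v k)) = h \<bullet> k"
proof -
  have E: "exp (- x) * b * (exp (2 * x) * (exp (- x) * c)) = b * c" for x b c :: real
  proof -
    have "exp (- x) * b * (exp (2 * x) * (exp (- x) * c)) = exp (- x + 2 * x + - x) * (b * c)"
      by (simp only: exp_add) (simp add: mult_ac)
    then show ?thesis by simp
  qed
  then show ?thesis
    unfolding inner_vec_def frm_def met_def diag_mult_vec_nth inner_real_def by (simp only: E)
qed

text \<open>The two bilinear forms are compared on vectors written in the frame, where both become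
  the standard inner product, which \<open>ortho\<close> preserves.\<close>

lemma met_trn:
  assumes "q = 1 \<or> q = -1" "q \<noteq> 1 \<Longrightarrow> rsq v \<noteq> 0"
  shows "met a v = transpose (matrix (dtrn m q v)) ** met a (trn m q v) ** matrix (dtrn m q v)"
proof -
  let ?J = "matrix (dtrn m q v)"
  have "x \<bullet> (met a v *v y) = x \<bullet> ((transpose ?J ** met a (trn m q v) ** ?J) *v y)" for x y
  proof -
    define h k where "h = matrix_inv (frm a v) *v x" and "k = matrix_inv (frm a v) *v y"
    have xy: "x = frm a v *v h" "y = frm a v *v k"
      by (simp_all add: h_def k_def matrix_vector_mul_assoc frm_mult_inv)
    have "x \<bullet> ((transpose ?J ** met a (trn m q v) ** ?J) *v y) = (?J *v x) \<bullet> (met a (trn m q v) *v (?J *v y))"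
    proof -
      have "x \<bullet> (transpose ?J *v z) = (?J *v x) \<bullet> z" for z
        by (subst dot_lmul_matrix[symmetric]) (simp only: vector_transpose_matrix)
      then show ?thesis by (simp only: matrix_vector_mul_assoc[symmetric])
    qed
    also have "\<dots> = (frm a (trn m q v) *v ortho m q v h) \<bullet> (met a (trn m q v) *v (frm a (trn m q v) *v ortho m q v k))"
      by (simp add: matrix_works linear_dtrn xy dtrn_frm[OF assms])
    also have "\<dots> = x \<bullet> (met a v *v y)"
      by (simp add: xy met_frm ortho_inner assms(2))
    finally show ?thesis by simp
  qed
  then have "met a v *v y = (transpose ?J ** met a (trn m q v) ** ?J) *v y" for y
    using vector_eq_ldot by blast
  then show ?thesis unfolding matrix_eq by blast
qed

lemma Ck_on_theta: "open U \<Longrightarrow> Ck_on k U theta"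
  unfolding theta_def[abs_def] by (intro Ck_on_mult Ck_on_diff Ck_on_cos Ck_on_const Ck_on_nth)

text \<open>The factors 2 and -1 are those of the metric and of the frame. For them the exponential
  of the multiple of \<open>lam\<close> is rational in \<open>rsq\<close>, so smoothness of the
  logarithm need not be discussed.\<close>

lemma Ck_on_exp_ph:
  assumes "r = 2 \<or> r = -1"
  shows "Ck_on k UNIV (\<lambda>v. exp (r * ph a i v))"
proof -
  have th: "Ck_on k UNIV (\<lambda>v. exp (r * theta v))"
    by (intro Ck_on_exp Ck_on_mult Ck_on_const Ck_on_theta open_UNIV)
  have inv: "Ck_on k UNIV (\<lambda>v. 2 / (1 + rsq v))"
    by (intro Ck_on_divide Ck_on_add Ck_on_const Ck_on_rsq open_UNIV) simp
  have lam: "exp (lam v) = 2 / (1 + rsq v)" for v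
    by (simp add: lam_def exp_diff)
  have "Ck_on k UNIV (\<lambda>v. exp (r * lam v))"
    using assms
  proof
    assume "r = 2"
    then have "exp (r * lam v) = (2 / (1 + rsq v)) * (2 / (1 + rsq v))" for v
      unfolding lam[symmetric] by (simp flip: exp_add)
    then show ?thesis using Ck_on_mult[OF open_UNIV inv inv] by simp
  next
    assume "r = -1"
    then have "exp (r * lam v) = (1 + rsq v) / 2" for v
      using lam[of v] by (simp add: exp_minus)
    then have "(\<lambda>v. exp (r * lam v)) = (\<lambda>v. (1 + rsq v) / 2)" by (rule ext)
    moreover have "Ck_on k UNIV (\<lambda>v. (1 + rsq v) / 2)"
      by (intro Ck_on_divide Ck_on_add Ck_on_const Ck_on_rsq open_UNIV) simp
    ultimately show ?thesis by (simp only:)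
  qed
  then have thl: "Ck_on k UNIV (\<lambda>v. exp (r * (theta v + lam v)))"
    using Ck_on_mult[OF open_UNIV th] by (simp add: distrib_left exp_add)
  consider "i = None" | "i = Some j0" | j where "i = Some j" "j \<noteq> j0" by (metis not_Some_eq)
  then show ?thesis
  proof cases
    case 1
    show ?thesis unfolding 1 ph_simps
      by (intro Ck_on_exp Ck_on_mult Ck_on_add Ck_on_const Ck_on_theta open_UNIV)
  qed (use th thl in \<open>simp_all add: ph_simps\<close>)
qed

lemma smooth_on_diag:
  assumes "\<And>i k. Ck_on k UNIV (d i)"
  shows "smooth_on S (\<lambda>v :: real ^ ('m option). diag (\<lambda>i. d i v) :: real ^ 'n ^ 'n)"
proof (rule smooth_on_open[OF open_UNIV])
  fix k
  show "Ck_on k UNIV (\<lambda>v :: real ^ ('m option). diag (\<lambda>i. d i v) :: real ^ 'n ^ 'n)"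
  proof (intro Ck_on_vec open_UNIV)
    fix i j
    show "Ck_on k UNIV (\<lambda>v :: real ^ ('m option). (diag (\<lambda>i. d i v) :: real ^ 'n ^ 'n) $ i $ j)"
      by (cases "i = j") (simp_all add: assms Ck_on_const)
  qed
qed simp

lemma pole_mult: "pole e \<Longrightarrow> pole e' \<Longrightarrow> e * e' = 1 \<or> e * e' = -1"
  by (auto simp: pole_def)

section \<open>The atlas with its metric, orientation and frame cocycle\<close>

lemma riemannian_metric_met: "riemannian_metric atlas (\<lambda>c. met a)"
  unfolding riemannian_metric_def
proof (intro conjI ballI)
  fix C assume "C \<in> atlas"
  show "smooth_on (snd C ` fst C) (met a)"
    unfolding met_def[abs_def] by (intro smooth_on_diag Ck_on_exp_ph) simp
  fix x
  show "transpose (met a x) = met a x" by (simp add: met_def)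
  show "\<forall>v. v \<noteq> 0 \<longrightarrow> 0 < v \<bullet> (met a x *v v)"
  proof (intro allI impI)
    fix v :: "real ^ ('m option)" assume "v \<noteq> 0"
    then obtain i where i: "v $ i \<noteq> 0" by (auto simp: vec_eq_iff)
    have "v \<bullet> (met a x *v v) = (\<Sum>i\<in>UNIV. exp (2 * ph a i x) * (v $ i)\<^sup>2)"
      by (simp add: inner_vec_def met_def diag_mult_vec_nth power2_eq_square mult_ac)
    also have "\<dots> > 0"
      by (rule sum_pos2[of _ i]) (use i in auto)
    finally show "0 < v \<bullet> (met a x *v v)" .
  qed
next
  fix C D p assume "C \<in> atlas" "D \<in> atlas" "p \<in> fst C \<inter> fst D"
  then obtain c e c' e' where C: "C = chart c e" "pole e" and D: "D = chart c' e'" "pole e'"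
    and p: "p \<in> dom c e \<inter> dom c' e'"
    by (auto simp: atlas_def)
  obtain m where m: "crd c e p = trn m (e * e') (crd c' e' p)"
    "crd c' e' p \<in> trn_dom m (e * e') c"
    "transition_jacobian (chart c e) (chart c' e') p = matrix (dtrn m (e * e') (crd c' e' p))"
    using transition_jacobian_chart[OF C(2) D(2) p] .
  show "met a (snd D p) = transpose (transition_jacobian C D p) ** met a (snd C p) ** transition_jacobian C D p"
    using m(2) met_trn[OF pole_mult[OF C(2) D(2)]] by (simp add: C D m(1,3) trn_dom_def)
qed

lemma oriented_atlas_atlas: "oriented_atlas T atlas"
  unfolding oriented_atlas_def
proof (intro conjI ballI smooth_atlas_atlas)
  fix C D p assume "C \<in> atlas" "D \<in> atlas" "p \<in> fst C \<inter> fst D"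
  then obtain c e c' e' where C: "C = chart c e" "pole e" and D: "D = chart c' e'" "pole e'"
    and p: "p \<in> dom c e \<inter> dom c' e'"
    by (auto simp: atlas_def)
  obtain m where m: "crd c' e' p \<in> trn_dom m (e * e') c"
    "transition_jacobian (chart c e) (chart c' e') p = matrix (dtrn m (e * e') (crd c' e' p))"
    using transition_jacobian_chart[OF C(2) D(2) p] .
  show "0 < det (transition_jacobian C D p)"
    using m(1) det_dtrn[OF pole_mult[OF C(2) D(2)]] by (simp add: C D m(2) trn_dom_def)
qed

lemma oriented_orthonormal_frames_frm:
  "oriented_orthonormal_frames atlas (\<lambda>c. met a) (\<lambda>c. frm a)"
  unfolding oriented_orthonormal_frames_def
proof (intro ballI conjI)
  fix C assume "C \<in> atlas"
  show "smooth_on (snd C ` fst C) (frm a)"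
    unfolding frm_def[abs_def] using Ck_on_exp_ph[of "-1"] by (intro smooth_on_diag) simp
  fix x
  show "transpose (frm a x) ** met a x ** frm a x = mat 1"
    by (simp add: frm_def met_def vec_eq_iff diag_mult_nth mult_diag_nth mat_def flip: exp_add)
  show "0 < det (frm a x)" by (rule det_frm)
qed

lemma frame_transition_frm:
  assumes "pole e" "pole e'" "p \<in> dom c e \<inter> dom c' e'"
  obtains m where "crd c e p = trn m (e * e') (crd c' e' p)"
    "e * e' \<noteq> 1 \<Longrightarrow> rsq (crd c' e' p) \<noteq> 0"
    "frame_transition (\<lambda>c. frm a) (chart c e) (chart c' e') p = matrix (ortho m (e * e') (crd c' e' p))"
proof -
  obtain m where m: "crd c e p = trn m (e * e') (crd c' e' p)"
    "crd c' e' p \<in> trn_dom m (e * e') c"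
    "transition_jacobian (chart c e) (chart c' e') p = matrix (dtrn m (e * e') (crd c' e' p))"
    using transition_jacobian_chart[OF assms] .
  have r: "e * e' \<noteq> 1 \<Longrightarrow> rsq (crd c' e' p) \<noteq> 0" using m(2) by (simp add: trn_dom_def)
  have D: "matrix (dtrn m (e * e') (crd c' e' p)) ** frm a (crd c' e' p)
      = frm a (trn m (e * e') (crd c' e' p)) ** matrix (ortho m (e * e') (crd c' e' p))"
    using pole_mult[OF assms(1,2)] r by (rule matrix_dtrn_frm)
  have "frame_transition (\<lambda>c. frm a) (chart c e) (chart c' e') p
      = matrix_inv (frm a (crd c e p)) ** (matrix (dtrn m (e * e') (crd c' e' p)) ** frm a (crd c' e' p))"
    by (simp add: frame_transition_def m(3) matrix_mul_assoc)
  also have "\<dots> = matrix (ortho m (e * e') (crd c' e' p))"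
    unfolding D m(1) by (simp only: matrix_mul_assoc frm_mult_inv matrix_mul_lid)
  finally show thesis using that m(1) r by blast
qed

end

section \<open>The spin structure\<close>

context twisted_slab
begin

abbreviation rt :: "real \<Rightarrow> ('m option) clifford" where
  "rt \<equiv> rot e0 e1"

abbreviation c1 :: "('m option) clifford" where
  "c1 \<equiv> cl_vec e1"

lemma orthonormal_e01: "norm e0 = 1" "norm e1 = 1" "e0 \<bullet> e1 = 0"
  by (simp_all add: inner_axis_axis)

lemmas rt_add = rot_add[OF orthonormal_e01]
lemmas rt_conj = rot_conj[OF orthonormal_e01]
lemmas rt_commute = rot_commute[OF orthonormal_e01]
lemmas rt_zero = rot_zero[OF orthonormal_e01]

text \<open>The polynomials in the entries \<open>None\<close> and \<open>j1\<close> are \<sigma>_j1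
  sin y and \<sigma>_j1 cos y, which are invariant under the gluing map. So \<open>zeta\<close> is
  the radial direction turned by - y in the plane of \<open>e0\<close> and \<open>e1\<close>, the
  turn that undoes the half turns of the transition functions; it is one function on the quotient
  for all charts, away from the poles.\<close>

definition zeta :: "(nat \<Rightarrow> real) \<Rightarrow> real ^ ('m option)" where
  "zeta p = (\<chi> i. case i of
      None \<Rightarrow> (p 2 * p 0 + p 3 * p 1 - p 2) / 2 / sqrt (1 - (p (4 + to_nat j0))\<^sup>2)
    | Some j \<Rightarrow> if j = j0 then 0
        else if j = j1 then (p 3 + p 3 * p 0 - p 2 * p 1) / 2 / sqrt (1 - (p (4 + to_nat j0))\<^sup>2)
        else p (4 + to_nat j) / sqrt (1 - (p (4 + to_nat j0))\<^sup>2))"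

lemma zeta_emb:
  "zeta (emb y x \<sigma>) $ None = \<sigma> $ j1 * sin y / sqrt (1 - (\<sigma> $ j0)\<^sup>2)"
  "zeta (emb y x \<sigma>) $ Some j0 = 0"
  "zeta (emb y x \<sigma>) $ Some j1 = \<sigma> $ j1 * cos y / sqrt (1 - (\<sigma> $ j0)\<^sup>2)"
  "j \<noteq> j0 \<Longrightarrow> j \<noteq> j1 \<Longrightarrow> zeta (emb y x \<sigma>) $ Some j = \<sigma> $ j / sqrt (1 - (\<sigma> $ j0)\<^sup>2)"
proof -
  have cs: "cos y * cos y = 1 - sin y * sin y"
    using sin_cos_squared_add[of y] by (simp add: power2_eq_square)
  have "(x * cos y - \<sigma> $ j1 * sin y) * cos (2 * y) + (x * sin y + \<sigma> $ j1 * cos y) * sin (2 * y)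
      - (x * cos y - \<sigma> $ j1 * sin y) = 2 * (\<sigma> $ j1 * sin y)"
    unfolding cos_double sin_double power2_eq_square using cs by algebra
  from arg_cong[OF this, of "\<lambda>t. t / 2 / sqrt (1 - (\<sigma> $ j0)\<^sup>2)"]
  show "zeta (emb y x \<sigma>) $ None = \<sigma> $ j1 * sin y / sqrt (1 - (\<sigma> $ j0)\<^sup>2)"
    unfolding zeta_def vec_lambda_beta option.case emb_simps if_not_P[OF j01] by simp
  have "(x * sin y + \<sigma> $ j1 * cos y) + (x * sin y + \<sigma> $ j1 * cos y) * cos (2 * y)
      - (x * cos y - \<sigma> $ j1 * sin y) * sin (2 * y) = 2 * (\<sigma> $ j1 * cos y)"
    unfolding cos_double sin_double power2_eq_square using cs by algebra
  from arg_cong[OF this, of "\<lambda>t. t / 2 / sqrt (1 - (\<sigma> $ j0)\<^sup>2)"]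
  show "zeta (emb y x \<sigma>) $ Some j1 = \<sigma> $ j1 * cos y / sqrt (1 - (\<sigma> $ j0)\<^sup>2)"
    unfolding zeta_def vec_lambda_beta option.case emb_simps if_not_P[OF j01] if_not_P[OF j01[symmetric]] by simp
qed (use j01 in \<open>simp_all add: zeta_def\<close>)

text \<open>For the pole -1 the reflection cancels the sign convention of \<open>sph\<close>, so
  that for both poles the tangential part of \<sigma> is obtained, normalised to length 1.\<close>

definition etap :: "real \<Rightarrow> real ^ ('m option) \<Rightarrow> real ^ ('m option)" where
  "etap e v = (if e = 1 then eta v else reflection e1 (eta v))"

lemma zeta_par:
  assumes "pole e" "rsq v \<noteq> 0"
  shows "zeta (par e v) = rotate_vec e0 e1 (- (v $ Some j0)) (etap e v)"
proof -
  have r: "rsq v > 0" using assms(2) rsq_nonneg[of v] by linarith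
  have "1 - (sph e v $ j0)\<^sup>2 = (2 * sqrt (rsq v) / (1 + rsq v))\<^sup>2"
    using assms(1) r by (auto simp: sph_def pole_def power_divide power_mult_distrib divide_simps)
      (simp_all add: power2_eq_square algebra_simps)
  then have n: "sqrt (1 - (sph e v $ j0)\<^sup>2) = 2 * sqrt (rsq v) / (1 + rsq v)"
    using r by (simp add: real_sqrt_abs)
  have quot: "sph e v $ j * b / (2 * sqrt (rsq v) / (1 + rsq v))
      = (if j = j1 then e else 1) * (v $ Some j / sqrt (rsq v)) * b" if "j \<noteq> j0" for j b
    using that r by (simp add: sph_def)
  have ep: "etap e v $ Some j = (if j = j1 then e else 1) * (v $ Some j / sqrt (rsq v))" if "j \<noteq> j0" for j
    using that assms(1) by (auto simp: etap_def reflection_axis_nth eta_nth pole_def)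
  have ep0: "etap e v $ None = 0" "etap e v $ Some j0 = 0"
    using j01 by (simp_all add: etap_def reflection_axis_nth eta_nth)
  have "zeta (par e v) $ i = rotate_vec e0 e1 (- (v $ Some j0)) (etap e v) $ i" for i
  proof -
    consider "i = None" | "i = Some j0" | "i = Some j1" | j where "i = Some j" "j \<noteq> j0" "j \<noteq> j1"
      by (metis not_Some_eq)
    then show ?thesis
    proof cases
      case 1
      show ?thesis
        unfolding 1 par_def zeta_emb n quot[OF j01[symmetric]]
        by (simp add: rotate_vec_def inner_axis' ep0 ep[OF j01[symmetric]]) (simp add: axis_def)
    next
      case 2
      show ?thesis
        unfolding 2 par_def zeta_emb using j01
        by (simp add: rotate_vec_def ep0 axis_def)
    next
      case 3
      show ?thesis
        unfolding 3 par_def zeta_emb n quot[OF j01[symmetric]]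
        by (simp add: rotate_vec_def inner_axis' ep0 ep[OF j01[symmetric]]) (simp add: axis_def algebra_simps diff_divide_distrib)
    next
      case 4
      show ?thesis
        unfolding 4(1) par_def zeta_emb(4)[OF 4(2,3)] n
        using quot[OF 4(2), of 1] 4 by (simp add: rotate_vec_def ep axis_def)
    qed
  qed
  then show ?thesis by (simp add: vec_eq_iff)
qed

lemma norm_etap:
  assumes "rsq v \<noteq> 0"
  shows "norm (etap e v) = 1"
  using norm_eta[OF assms] inner_reflection[OF orthonormal_e01(2), of "eta v" "eta v"]
  by (simp add: etap_def norm_eq_1)

lemma norm_zeta_par:
  assumes "pole e" "rsq v \<noteq> 0"
  shows "norm (zeta (par e v)) = 1"
proof -
  define \<alpha> where "\<alpha> = - (v $ Some j0) / 2"
  have "zeta (par e v) = reflection e0 (reflection (sin \<alpha> *\<^sub>R e1 - cos \<alpha> *\<^sub>R e0) (etap e v))"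
    unfolding zeta_par[OF assms] reflection_rot_vec[OF orthonormal_e01] by (simp add: \<alpha>_def)
  then show ?thesis
    using norm_etap[OF assms(2)] by (simp add: norm_eq_1 norm_rot_vec[OF orthonormal_e01])
qed

text \<open>Moving the half-angle rotation past the global vector \<open>zeta\<close> turns it into
  the local vector \<open>etap\<close>. This is how the lifts, which are written with
  \<open>zeta\<close>, are compared with the frame transitions, which are written with
  \<open>eta\<close>.\<close>

lemma zeta_rt:
  assumes "pole e" "rsq v \<noteq> 0"
  shows "cl_mult (cl_vec (zeta (par e v))) (rt (- (v $ Some j0) / 2))
    = cl_mult (rt (- (v $ Some j0) / 2)) (cl_vec (etap e v))"
  unfolding rt_conj zeta_par[OF assms] by simp

text \<open>A chart with the opposite pole is composed with a reflection, so that the rotation angle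
  \<open>y\<close> enters its lift with the opposite sign. Every transition function is \<open>lift\<close> times the
  inverse \<open>colift\<close> of another \<open>lift\<close>, which makes the cocycle condition automatic; \<open>zeta\<close> is
  not defined at the poles, so these factors are multiplied out when they cancel.\<close>

definition plus :: "(nat \<Rightarrow> real, 'm) chart \<Rightarrow> bool" where
  "plus C \<longleftrightarrow> (\<exists>c. C = chart c 1)"

definition lift :: "bool \<Rightarrow> real \<Rightarrow> real ^ ('m option) \<Rightarrow> ('m option) clifford" where
  "lift b y z = (if b then rt (y / 2) else cl_mult (rt (- y / 2)) (cl_mult c1 (cl_vec z)))"

definition colift :: "bool \<Rightarrow> real \<Rightarrow> real ^ ('m option) \<Rightarrow> ('m option) clifford" where
  "colift b y z = (if b then rt (- y / 2) else cl_mult (cl_vec z) (cl_mult c1 (rt (y / 2))))"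

definition lift_quot :: "bool \<Rightarrow> bool \<Rightarrow> real \<Rightarrow> real \<Rightarrow> real ^ ('m option) \<Rightarrow> ('m option) clifford" where
  "lift_quot b b' y y' z = (if b = b' then rt ((if b then 1 else -1) * (y - y') / 2)
    else cl_mult (lift b y z) (colift b' y' z))"

definition spin :: "(nat \<Rightarrow> real, 'm) chart \<Rightarrow> (nat \<Rightarrow> real, 'm) chart \<Rightarrow> (nat \<Rightarrow> real) \<Rightarrow> ('m option) clifford" where
  "spin C D p = lift_quot (plus C) (plus D) (snd C p $ Some j0) (snd D p $ Some j0) (zeta p)"

lemma emb_in_dom:
  "\<bar>y - c\<bar> < pi / 2 \<Longrightarrow> -1 < x \<Longrightarrow> x \<le> 1 \<Longrightarrow> norm \<sigma> = 1 \<Longrightarrow> \<sigma> $ j0 \<noteq> e \<Longrightarrow> emb y x \<sigma> \<in> dom c e"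
  by (auto simp: dom_def)

text \<open>The pole must be recoverable from the chart as a pair. It is, from the domain: one with
  pole 1 contains points at the opposite pole, which no domain with pole -1 contains.\<close>

lemma plus_chart:
  assumes "pole e"
  shows "plus (chart c e) \<longleftrightarrow> e = 1"
proof
  have n: "norm (axis j0 (-1) :: real ^ 'm) = 1"
    by (simp add: norm_eq_1 inner_axis_axis)
  assume "plus (chart c e)"
  then obtain c' where "dom c e = dom c' 1" by (auto simp: plus_def)
  moreover have "emb c 1 (axis j0 (-1)) \<in> dom c e" if "e \<noteq> -1"
    using that n by (intro emb_in_dom) auto
  moreover have "emb c' 1 (axis j0 (-1)) \<in> dom c' 1"
    using n by (intro emb_in_dom) auto
  moreover have "p (4 + to_nat j0) \<noteq> e" if "p \<in> dom c e" for p
    using that by (simp add: dom_eq)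
  ultimately have "emb c' 1 (axis j0 (-1)) (4 + to_nat j0) \<noteq> e" by blast
  then have "e \<noteq> -1" using j01 by simp
  then show "e = 1" using assms by (simp add: pole_def)
qed (auto simp: plus_def)

lemma c1_c1: "cl_mult c1 c1 = - cl_one"
  by (rule cl_vec_square[OF orthonormal_e01(2)])

lemma c1_c1_mult: "cl_mult c1 (cl_mult c1 a) = - a"
  by (simp add: cl_mult_assoc[symmetric] c1_c1 cl_mult.minus_left)

lemma rt_rt_mult: "cl_mult (rt a) (cl_mult (rt b) s) = cl_mult (rt (a + b)) s"
  by (simp add: cl_mult_assoc[symmetric] rt_add)

lemma colift_lift:
  assumes "norm z = 1"
  shows "cl_mult (colift b y z) (lift b y z) = cl_one"
proof (cases b)
  case True
  then show ?thesis by (simp add: lift_def colift_def rt_add rt_zero)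
next
  case False
  have "cl_mult (rt (y / 2)) (cl_mult (rt (- y / 2)) a) = a" for a
    by (simp add: rt_rt_mult rt_zero)
  then show ?thesis
    using False by (simp add: lift_def colift_def cl_mult_assoc c1_c1_mult cl_mult.minus_right cl_vec_square[OF assms])
qed

lemma lift_quot_eq:
  assumes "norm z = 1"
  shows "lift_quot b b' y y' z = cl_mult (lift b y z) (colift b' y' z)"
proof (cases "b = b'")
  case True
  have zz: "cl_mult (cl_vec z) (cl_mult (cl_vec z) a) = - a" for a
    by (simp add: cl_mult_assoc[symmetric] cl_vec_square[OF assms] cl_mult.minus_left)
  show ?thesis
    using True by (simp add: lift_quot_def lift_def colift_def rt_add cl_mult_assoc zz c1_c1_mult
        cl_mult.minus_right diff_divide_distrib)
qed (simp add: lift_quot_def)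

lemma lift_quot_cocycle:
  assumes "\<not> (b = b' \<and> b' = b'') \<Longrightarrow> norm z = 1"
  shows "cl_mult (lift_quot b b' y y' z) (lift_quot b' b'' y' y'' z) = lift_quot b b'' y y'' z"
proof (cases "b = b' \<and> b' = b''")
  \<comment> \<open>All three charts omit the same pole, so the point may lie at the other one,
    where \<open>zeta\<close> is no unit vector; here the angles are simply added.\<close>
  case True
  then show ?thesis by (simp add: lift_quot_def rt_add add_divide_distrib[symmetric])
next
  case False
  have "cl_mult (cl_mult l k) (cl_mult l' k') = cl_mult l (cl_mult (cl_mult k l') k')" for l k l' k' :: "('m option) clifford"
    by (simp add: cl_mult_assoc)
  then show ?thesis
    unfolding lift_quot_eq[OF assms[OF False]] by (simp add: colift_lift[OF assms[OF False]])
qed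

text \<open>Rotations by m pi and by - m pi are equal, so the order of y and y' does not affect what
  is covered. Both orders occur, as the charts with pole -1 use the opposite angle.\<close>

lemma spin_covers_rt:
  assumes "y = y' + of_int m * pi \<or> y' = y + of_int m * pi"
  shows "spin_covers (rt ((y - y') / 2)) (matrix (ortho m 1 v))"
proof (rule spin_covers_rot[OF orthonormal_e01])
  fix h
  have "sin (y - y') = 0" "cos (y - y') = sg m"
    using assms cos_add_int_pi[of 0 m] sin_add_int_pi[of 0 m] cos_minus[of "of_int m * pi"] sin_minus[of "of_int m * pi"]
    by auto
  moreover have "2 * ((y - y') / 2) = y - y'" by simp
  ultimately have "rotate_vec e0 e1 (2 * ((y - y') / 2)) h = h + ((sg m - 1) * h $ None) *\<^sub>R e0 + ((sg m - 1) * h $ Some j1) *\<^sub>R e1"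
    by (simp only: rotate_vec_def inner_axis') simp
  also have "\<dots> = ortho m 1 v h"
    by (auto simp: vec_eq_iff ortho_def reflection_axis_nth sg_def) (auto simp: axis_def split: if_splits)
  finally show "matrix (ortho m 1 v) *v h = rotate_vec e0 e1 (2 * ((y - y') / 2)) h"
    by (simp add: matrix_works linear_ortho)
qed

lemma spin_covers_mixed:
  assumes "rsq v \<noteq> 0" "y = y' + of_int m * pi \<or> y' = y + of_int m * pi"
  shows "spin_covers (cl_mult (rt ((y - y') / 2)) (cl_mult c1 (cl_vec (eta v)))) (matrix (ortho m (-1) v))"
proof -
  let ?P = "\<lambda>h. reflection e1 (reflection (eta v) h)"
  have P: "linear ?P"
    using linear_compose[OF linear_reflection linear_reflection] by (simp add: o_def)
  have "spin_covers (cl_mult c1 (cl_vec (eta v))) (matrix ?P)"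
    by (rule spin_covers_pair[OF orthonormal_e01(2) norm_eta[OF assms(1)]]) (simp add: matrix_works P)
  moreover have "ortho m (-1) v = ortho m 1 v \<circ> ?P"
    by (simp add: ortho_def Let_def fun_eq_iff)
  then have "matrix (ortho m (-1) v) = matrix (ortho m 1 v) ** matrix ?P"
    using matrix_compose[OF P linear_ortho[of m 1 v]] by (simp only:)
  ultimately show ?thesis
    using spin_covers_mult[OF spin_covers_rt[OF assms(2)]] by (simp only:)
qed

text \<open>With \<open>zeta_rt\<close> and \<open>rt_commute\<close> all rotations are collected on
  the left, and the two angles combine into the difference of the y-coordinates.\<close>

lemma lift_quot_mixed:
  assumes "pole e" "rsq v \<noteq> 0"
  shows "lift_quot (e \<noteq> 1) (e = 1) y (v $ Some j0) (zeta (par e v))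
    = (if e = 1 then cl_mult (rt (- (y - v $ Some j0) / 2)) (cl_mult c1 (cl_vec (eta v)))
       else cl_mult (rt ((y - v $ Some j0) / 2)) (cl_mult (cl_vec (reflection e1 (eta v))) c1))"
proof -
  let ?y = "v $ Some j0"
  note z = zeta_rt[OF assms]
  have c: "cl_mult c1 (rt (- ?y / 2)) = cl_mult (rt (?y / 2)) c1" "cl_mult c1 (rt (?y / 2)) = cl_mult (rt (- ?y / 2)) c1"
    by (simp_all add: rt_commute)
  show ?thesis
  proof (cases "e = 1")
    case True
    have "cl_mult (cl_mult (rt (- y / 2)) (cl_mult c1 (cl_vec (zeta (par e v))))) (rt (- ?y / 2))
        = cl_mult (rt (- y / 2)) (cl_mult c1 (cl_mult (cl_vec (zeta (par e v))) (rt (- ?y / 2))))"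
      by (simp only: cl_mult_assoc)
    also have "\<dots> = cl_mult (rt (- y / 2)) (cl_mult (cl_mult c1 (rt (- ?y / 2))) (cl_vec (eta v)))"
      unfolding z using True by (simp add: cl_mult_assoc etap_def)
    also have "\<dots> = cl_mult (rt (- y / 2 + ?y / 2)) (cl_mult c1 (cl_vec (eta v)))"
      unfolding c by (simp only: cl_mult_assoc rt_rt_mult)
    also have "- y / 2 + ?y / 2 = - (y - ?y) / 2" by (simp add: field_simps)
    finally show ?thesis using True by (simp add: lift_quot_def lift_def colift_def)
  next
    case False
    have "cl_mult (rt (y / 2)) (cl_mult (cl_vec (zeta (par e v))) (cl_mult c1 (rt (?y / 2))))
        = cl_mult (rt (y / 2)) (cl_mult (cl_mult (cl_vec (zeta (par e v))) (rt (- ?y / 2))) c1)"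
      unfolding c by (simp only: cl_mult_assoc)
    also have "\<dots> = cl_mult (rt (y / 2 + - ?y / 2)) (cl_mult (cl_vec (reflection e1 (eta v))) c1)"
      unfolding cl_mult_assoc[symmetric] unfolding cl_mult_assoc[of "rt (y / 2)"] z
      unfolding etap_def if_not_P[OF False] by (simp only: cl_mult_assoc rt_rt_mult)
    also have "y / 2 + - ?y / 2 = (y - ?y) / 2" by (simp add: field_simps)
    finally show ?thesis using False by (simp add: lift_quot_def lift_def colift_def)
  qed
qed

text \<open>Conjugating the reflection along \<open>eta\<close> by that along \<open>e1\<close>
  gives the reflection along the reflected vector. So the reversed product of vectors covers the
  same map as in \<open>spin_covers_mixed\<close>.\<close>

lemma spin_covers_neg_mixed:
  assumes "rsq v \<noteq> 0" "y = y' + of_int m * pi \<or> y' = y + of_int m * pi"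
  shows "spin_covers (cl_mult (rt ((y - y') / 2)) (cl_mult (cl_vec (reflection e1 (eta v))) c1)) (matrix (ortho m (-1) v))"
proof -
  let ?P = "\<lambda>h. reflection e1 (reflection (eta v) h)"
  have P: "linear ?P"
    using linear_compose[OF linear_reflection linear_reflection] by (simp add: o_def)
  have n: "norm (reflection e1 (eta v)) = 1"
    using norm_etap[OF assms(1), of 0] by (simp add: etap_def)
  have "reflection (reflection e1 (eta v)) (reflection e1 h) = ?P h" for h
    unfolding reflection_def[of "reflection e1 (eta v)"] inner_reflection[OF orthonormal_e01(2)]
    unfolding reflection_def[of "eta v"]
    using linear_reflection[of e1] by (simp add: linear_diff linear_cmul)
  then have "spin_covers (cl_mult (cl_vec (reflection e1 (eta v))) c1) (matrix ?P)"
    by (intro spin_covers_pair[OF n orthonormal_e01(2)]) (simp add: matrix_works P)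
  moreover have "ortho m (-1) v = ortho m 1 v \<circ> ?P"
    by (simp add: ortho_def Let_def fun_eq_iff)
  then have "matrix (ortho m (-1) v) = matrix (ortho m 1 v) ** matrix ?P"
    using matrix_compose[OF P linear_ortho[of m 1 v]] by (simp only:)
  ultimately show ?thesis
    using spin_covers_mult[OF spin_covers_rt[OF assms(2)]] by (simp only:)
qed

lemma spin_covers_spin:
  assumes "pole e" "pole e'" "p \<in> dom c e \<inter> dom c' e'"
  shows "spin_covers (spin (chart c e) (chart c' e') p)
    (frame_transition (\<lambda>c. frm a) (chart c e) (chart c' e') p)"
proof -
  define u v where "u = crd c e p" and "v = crd c' e' p"
  obtain m where m: "u = trn m (e * e') v" "e * e' \<noteq> 1 \<Longrightarrow> rsq v \<noteq> 0"
    "frame_transition (\<lambda>c. frm a) (chart c e) (chart c' e') p = matrix (ortho m (e * e') v)"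
    using frame_transition_frm[OF assms] unfolding u_def v_def by metis
  have p: "p = par e' v" using par_crd[OF assms(2)] assms(3) by (simp add: v_def)
  have y: "u $ Some j0 = v $ Some j0 + of_int m * pi" by (simp add: m(1) trn_nth)
  have s: "spin (chart c e) (chart c' e') p = lift_quot (e = 1) (e' = 1) (u $ Some j0) (v $ Some j0) (zeta (par e' v))"
    unfolding p[symmetric] using assms by (simp add: spin_def plus_chart u_def v_def)
  show ?thesis
  proof (cases "e = e'")
    case True
    then have q: "e * e' = 1" using pole_square[OF assms(1)] by simp
    show ?thesis
    proof (cases "e = 1")
      case e: True
      have "spin_covers (rt ((u $ Some j0 - v $ Some j0) / 2)) (matrix (ortho m 1 v))"
        by (rule spin_covers_rt) (use y in simp)
      then show ?thesis unfolding s m(3) q using True e by (simp add: lift_quot_def)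
    next
      case e: False
      have "spin_covers (rt ((v $ Some j0 - u $ Some j0) / 2)) (matrix (ortho m 1 v))"
        by (rule spin_covers_rt) (use y in simp)
      then show ?thesis unfolding s m(3) q using True e by (simp add: lift_quot_def)
    qed
  next
    case False
    then have q: "e * e' = -1" "(e = 1) = (e' \<noteq> 1)" using assms(1,2) by (auto simp: pole_def)
    then have r: "rsq v \<noteq> 0" using m(2) by simp
    show ?thesis
      unfolding s m(3) q lift_quot_mixed[OF assms(2) r]
      using spin_covers_mixed[OF r, of "v $ Some j0" "u $ Some j0" m] spin_covers_neg_mixed[OF r, of "u $ Some j0" "v $ Some j0" m] y
      by simp
  qed
qed

lemma rsq_nonzero_overlap:
  assumes "pole e" "pole e'" "p \<in> dom c e \<inter> dom c' e'" "e \<noteq> e'"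
  shows "rsq (crd c' e' p) \<noteq> 0" "p (4 + to_nat j0) \<noteq> 1" "p (4 + to_nat j0) \<noteq> -1"
proof -
  have "e * e' \<noteq> 1" using assms(1,2,4) by (auto simp: pole_def)
  then show "rsq (crd c' e' p) \<noteq> 0" using frame_transition_frm[OF assms(1-3)] by metis
  show "p (4 + to_nat j0) \<noteq> 1" "p (4 + to_nat j0) \<noteq> -1"
    using assms by (auto simp: dom_eq pole_def)
qed

section \<open>Continuity of the lifts, and the spin structure\<close>

lemma continuous_on_rt:
  fixes S :: "(nat \<Rightarrow> real) set"
  assumes "continuous_on S f"
  shows "continuous_on S (\<lambda>p. rt (f p))"
  unfolding rot_def by (intro continuous_intros assms)

lemma continuous_on_cl_mult:
  fixes f :: "'a::topological_space \<Rightarrow> ('m option) clifford"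
  assumes "continuous_on S f" "continuous_on S g"
  shows "continuous_on S (\<lambda>p. cl_mult (f p) (g p))"
  using bounded_bilinear.continuous_on[OF bounded_bilinear_cl_mult assms] .

lemma continuous_on_cl_zeta:
  assumes "\<And>p. p \<in> S \<Longrightarrow> (p (4 + to_nat j0))\<^sup>2 \<noteq> 1"
  shows "continuous_on S (\<lambda>p. cl_vec (zeta p))"
proof -
  have n: "continuous_on S (\<lambda>p. sqrt (1 - (p (4 + to_nat j0))\<^sup>2))"
    by (intro continuous_intros)
  have n0: "\<forall>p\<in>S. sqrt (1 - (p (4 + to_nat j0))\<^sup>2) \<noteq> 0"
    "\<forall>p\<in>S. 2 * sqrt (1 - (p (4 + to_nat j0))\<^sup>2) \<noteq> 0" using assms by auto
  have "continuous_on S (\<lambda>p. zeta p $ i)" for i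
  proof -
    consider "i = None" | "i = Some j0" | "i = Some j1" | j where "i = Some j" "j \<noteq> j0" "j \<noteq> j1"
      by (metis not_Some_eq)
    then show ?thesis
    proof cases
      case 1
      then show ?thesis
        unfolding zeta_def by simp (intro continuous_intros n n0)
    next
      case 2
      then show ?thesis by (simp add: zeta_def)
    next
      case 3
      then show ?thesis
        unfolding zeta_def using j01 by simp (intro continuous_intros n n0)
    next
      case 4
      have "(\<lambda>p. zeta p $ i) = (\<lambda>p. p (4 + to_nat j) / sqrt (1 - (p (4 + to_nat j0))\<^sup>2))"
        using 4 by (simp add: zeta_def)
      then show ?thesis by (simp only:) (intro continuous_intros n n0)
    qed
  qed
  then have "continuous_on S zeta"
    using continuous_on_vec_lambda[of S "\<lambda>i p. zeta p $ i"] by simp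
  then show ?thesis
    by (rule bounded_linear.continuous_on[OF linear_cl_vec[unfolded linear_conv_bounded_linear]])
qed

lemma continuous_on_spin:
  assumes "pole e" "pole e'"
  shows "continuous_on (dom c e \<inter> dom c' e') (spin (chart c e) (chart c' e'))"
proof -
  let ?S = "dom c e \<inter> dom c' e'"
  have y: "continuous_on ?S (\<lambda>p. crd c e p $ Some j0)" "continuous_on ?S (\<lambda>p. crd c' e' p $ Some j0)"
    by (intro continuous_intros continuous_on_subset[OF continuous_on_crd] assms; simp)+
  note cont = continuous_on_rt continuous_on_cl_mult continuous_on_const continuous_on_divide continuous_on_minus
    continuous_on_diff continuous_on_mult y
  show ?thesis
  proof (cases "e = e'")
    case True
    have "continuous_on ?S (\<lambda>p. rt ((if e = 1 then 1 else -1) * (crd c e p $ Some j0 - crd c' e' p $ Some j0) / 2))"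
      by (intro cont) simp
    then show ?thesis
      using True assms by (simp add: spin_def[abs_def] lift_quot_def plus_chart)
  next
    case False
    have z: "continuous_on ?S (\<lambda>p. cl_vec (zeta p))"
      using rsq_nonzero_overlap(2,3)[OF assms _ False] by (intro continuous_on_cl_zeta) (auto simp: power2_eq_1_iff)
    have "continuous_on ?S (\<lambda>p. lift_quot (e = 1) (e' = 1) (crd c e p $ Some j0) (crd c' e' p $ Some j0) (zeta p))"
    proof (cases "e = 1")
      case True
      with False assms have "e' \<noteq> 1" by (auto simp: pole_def)
      then have "lift_quot (e = 1) (e' = 1) a b z = cl_mult (rt (a / 2)) (cl_mult (cl_vec z) (cl_mult c1 (rt (b / 2))))" for a b z
        using True by (simp add: lift_quot_def lift_def colift_def)
      then show ?thesis by (simp only:) (intro cont z; simp)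
    next
      case e: False
      with False assms have "e' = 1" by (auto simp: pole_def)
      then have "lift_quot (e = 1) (e' = 1) a b z = cl_mult (cl_mult (rt (- a / 2)) (cl_mult c1 (cl_vec z))) (rt (- b / 2))" for a b z
        using e by (simp add: lift_quot_def lift_def colift_def)
      then show ?thesis by (simp only:) (intro cont z; simp)
    qed
    then show ?thesis
      using assms by (simp add: spin_def[abs_def] plus_chart)
  qed
qed

lemma spin_cocycle:
  assumes "pole e" "pole e'" "pole e''" "p \<in> dom c e \<inter> dom c' e' \<inter> dom c'' e''"
  shows "cl_mult (spin (chart c e) (chart c' e') p) (spin (chart c' e') (chart c'' e'') p)
    = spin (chart c e) (chart c'' e'') p"
proof -
  have "norm (zeta p) = 1" if "\<not> ((e = 1) = (e' = 1) \<and> (e' = 1) = (e'' = 1))"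
  proof -
    have "e \<noteq> e' \<or> e' \<noteq> e''" using that by auto
    then have "rsq (crd c' e' p) \<noteq> 0"
      using rsq_nonzero_overlap(1)[OF assms(1,2)] rsq_nonzero_overlap(1)[OF assms(3,2)] assms(4) by auto
    then show ?thesis
      using norm_zeta_par[OF assms(2)] par_crd(1)[OF assms(2)] assms(4) by (metis IntD1 IntD2)
  qed
  then show ?thesis
    unfolding spin_def plus_chart[OF assms(1)] plus_chart[OF assms(2)] plus_chart[OF assms(3)]
    by (intro lift_quot_cocycle)
qed

lemma spin_manifold_T: "spin_manifold T atlas"
  unfolding spin_manifold_def
proof (intro conjI smooth_manifold_T exI)
  show "oriented_atlas T atlas" by (rule oriented_atlas_atlas)
  show "smooth_atlas T (atlas \<union> atlas)" by (simp add: smooth_atlas_atlas)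
  show "riemannian_metric atlas (\<lambda>c. met 1)" by (rule riemannian_metric_met)
  show "oriented_orthonormal_frames atlas (\<lambda>c. met 1) (\<lambda>c. frm 1)" by (rule oriented_orthonormal_frames_frm)
  show "\<forall>c\<in>atlas. \<forall>d\<in>atlas. continuous_map (subtopology T (fst c \<inter> fst d)) euclidean (spin c d)"
  proof (intro ballI)
    fix C D assume "C \<in> atlas" "D \<in> atlas"
    then obtain c e c' e' where C: "C = chart c e" "pole e" and D: "D = chart c' e'" "pole e'"
      by (auto simp: atlas_def)
    have "subtopology T (fst C \<inter> fst D) = top_of_set (fst C \<inter> fst D)"
      unfolding T_def subtopology_subtopology C D using dom_subset_X by (metis fst_conv inf.absorb2 le_infI1)
    then show "continuous_map (subtopology T (fst C \<inter> fst D)) euclidean (spin C D)"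
      using continuous_on_spin[OF C(2) D(2)] by (simp add: C D)
  qed
  show "\<forall>c\<in>atlas. \<forall>d\<in>atlas. \<forall>p\<in>fst c \<inter> fst d. spin_covers (spin c d p) (frame_transition (\<lambda>c. frm 1) c d p)"
    using spin_covers_spin by (fastforce simp: atlas_def)
  show "\<forall>c\<in>atlas. \<forall>d\<in>atlas. \<forall>e\<in>atlas. \<forall>p\<in>fst c \<inter> fst d \<inter> fst e. cl_mult (spin c d p) (spin d e p) = spin c e p"
    using spin_cocycle by (fastforce simp: atlas_def)
qed

end

section \<open>Curvature\<close>

context twisted_slab
begin

definition dth :: "'m option \<Rightarrow> real ^ ('m option) \<Rightarrow> real" where
  "dth i v = (case i of None \<Rightarrow> - (\<delta> * cos (v $ Some j0))
    | Some j \<Rightarrow> if j = j0 then - (\<delta> * sin (v $ Some j0) * (1 - v $ None)) else 0)"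

definition ddth :: "'m option \<Rightarrow> 'm option \<Rightarrow> real ^ ('m option) \<Rightarrow> real" where
  "ddth l i v = (if l = Some j0 \<and> i = Some j0 then - (\<delta> * cos (v $ Some j0) * (1 - v $ None))
    else if l = None \<and> i = Some j0 \<or> l = Some j0 \<and> i = None then \<delta> * sin (v $ Some j0) else 0)"

definition dlam :: "'m option \<Rightarrow> real ^ ('m option) \<Rightarrow> real" where
  "dlam i v = (case i of None \<Rightarrow> 0 | Some j \<Rightarrow> if j = j0 then 0 else - (2 * v $ Some j / (1 + rsq v)))"

definition ddlam :: "'m option \<Rightarrow> 'm option \<Rightarrow> real ^ ('m option) \<Rightarrow> real" where
  "ddlam l i v = (if l \<in> {None, Some j0} \<or> i \<in> {None, Some j0} then 0
    else 4 * v $ i * v $ l / (1 + rsq v)\<^sup>2 - (if i = l then 2 / (1 + rsq v) else 0))"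

lemmas dth_simps = dth_def[of None, simplified] dth_def[of "Some j0", simplified]
lemmas ddth_simps = ddth_def[of None None, simplified] ddth_def[of None "Some j0", simplified]
  ddth_def[of "Some j0" None, simplified] ddth_def[of "Some j0" "Some j0", simplified]

lemma dth_Some: "j \<noteq> j0 \<Longrightarrow> dth (Some j) v = 0"
  and ddth_Some: "j \<noteq> j0 \<Longrightarrow> ddth (Some j) i v = 0" "j \<noteq> j0 \<Longrightarrow> ddth i (Some j) v = 0"
  by (auto simp: dth_def ddth_def)

lemma has_derivative_theta: "(theta has_derivative (\<lambda>h. \<Sum>i\<in>UNIV. h $ i * dth i v)) (at v)"
proof -
  have "(theta has_derivative (\<lambda>h. (\<delta> * cos (v $ Some j0)) * (0 - h $ None)
      + (\<delta> * (- sin (v $ Some j0) * h $ Some j0)) * (1 - v $ None))) (at v)"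
    unfolding theta_def[abs_def]
    by (intro has_derivative_mult has_derivative_mult_right has_derivative_diff has_derivative_const
        has_derivative_nth) (auto intro!: derivative_eq_intros has_derivative_nth)
  then show ?thesis by (rule has_derivative_eq_rhs) (simp add: fun_eq_iff sum_option dth_simps dth_Some algebra_simps)
qed

lemma has_derivative_dth: "(dth i has_derivative (\<lambda>h. \<Sum>l\<in>UNIV. h $ l * ddth l i v)) (at v)"
proof -
  consider "i = None" | "i = Some j0" | j where "i = Some j" "j \<noteq> j0" by (metis not_Some_eq)
  then show ?thesis
  proof cases
    case 1
    have "((\<lambda>v. - (\<delta> * cos (v $ Some j0))) has_derivative (\<lambda>h. - (\<delta> * (- sin (v $ Some j0) * h $ Some j0)))) (at v)"
      by (auto intro!: derivative_eq_intros has_derivative_nth)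
    then show ?thesis
      unfolding 1 dth_def[abs_def] option.case
      by (rule has_derivative_eq_rhs) (simp add: fun_eq_iff sum_option ddth_simps ddth_Some algebra_simps)
  next
    case 2
    have "((\<lambda>v. - (\<delta> * sin (v $ Some j0) * (1 - v $ None))) has_derivative
        (\<lambda>h. - (\<delta> * sin (v $ Some j0) * (0 - h $ None)
          + (\<delta> * (cos (v $ Some j0) * h $ Some j0)) * (1 - v $ None)))) (at v)"
      by (intro has_derivative_minus has_derivative_mult has_derivative_mult_right has_derivative_diff has_derivative_const
          has_derivative_nth) (auto intro!: derivative_eq_intros has_derivative_nth)
    then show ?thesis
      unfolding 2 dth_def[abs_def] option.case if_P[OF refl]
      by (rule has_derivative_eq_rhs) (simp add: fun_eq_iff sum_option ddth_simps ddth_Some algebra_simps)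
  next
    case 3
    then show ?thesis by (simp add: dth_def[abs_def] ddth_Some)
  qed
qed

lemma has_derivative_lam: "(lam has_derivative (\<lambda>h. \<Sum>i\<in>UNIV. h $ i * dlam i v)) (at v)"
proof -
  have "(lam has_derivative (\<lambda>h. 0 - (0 + 2 * (\<Sum>l\<in>-{j0}. v $ Some l * h $ Some l)) * inverse (1 + rsq v))) (at v)"
    unfolding lam_def[abs_def]
    by (intro has_derivative_diff has_derivative_const has_derivative_ln has_derivative_add has_derivative_rsq) simp
  moreover have "(\<Sum>l\<in>-{j0}. h $ Some l * dlam (Some l) v)
      = (\<Sum>l\<in>-{j0}. - (2 * inverse (1 + rsq v)) * (v $ Some l * h $ Some l))" for h
    by (intro sum.cong) (auto simp: dlam_def divide_inverse)
  then have "(\<Sum>l\<in>-{j0}. h $ Some l * dlam (Some l) v)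
      = - (2 * inverse (1 + rsq v)) * (\<Sum>l\<in>-{j0}. v $ Some l * h $ Some l)" for h
    by (simp only: sum_distrib_left)
  ultimately show ?thesis
    by (elim has_derivative_eq_rhs) (simp add: fun_eq_iff sum_option dlam_def[of None] dlam_def[of "Some j0"])
qed

lemma has_derivative_dlam: "(dlam i has_derivative (\<lambda>h. \<Sum>l\<in>UNIV. h $ l * ddlam l i v)) (at v)"
proof (cases "i \<in> {None, Some j0}")
  case True
  then show ?thesis by (auto simp: dlam_def[abs_def] ddlam_def)
next
  case False
  then obtain j where i: "i = Some j" "j \<noteq> j0" by (metis insertI1 insertI2 not_Some_eq)
  have "((\<lambda>v. - (2 * v $ Some j / (1 + rsq v))) has_derivative
      (\<lambda>h. - ((2 * h $ Some j * (1 + rsq v) - 2 * v $ Some j * (0 + 2 * (\<Sum>l\<in>-{j0}. v $ Some l * h $ Some l)))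
        / ((1 + rsq v) * (1 + rsq v))))) (at v)"
    by (intro has_derivative_minus has_derivative_divide' has_derivative_mult_right has_derivative_nth
        has_derivative_add has_derivative_const has_derivative_rsq) simp
  moreover have "(\<Sum>l\<in>-{j0}. h $ Some l * ddlam (Some l) i v)
      = (\<Sum>l\<in>-{j0}. 4 * v $ Some j / (1 + rsq v)\<^sup>2 * (v $ Some l * h $ Some l)
          - (if l = j then h $ Some j * (2 / (1 + rsq v)) else 0))" for h
    using i by (intro sum.cong) (auto simp: ddlam_def algebra_simps)
  then have "(\<Sum>l\<in>-{j0}. h $ Some l * ddlam (Some l) i v)
      = 4 * v $ Some j / (1 + rsq v)\<^sup>2 * (\<Sum>l\<in>-{j0}. v $ Some l * h $ Some l) - h $ Some j * (2 / (1 + rsq v))" for h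
    using i(2) by (simp add: sum_subtractf sum_distrib_left)
  moreover have "- ((2 * a * w - 2 * b * (0 + 2 * s)) / (w * w)) = 4 * b / w\<^sup>2 * s - a * (2 / w)"
    if "w \<noteq> 0" for a b w s :: real
    using that by (simp add: field_simps power2_eq_square)
  ultimately show ?thesis
    unfolding i(1) dlam_def[abs_def] option.case if_not_P[OF i(2)]
    by (elim has_derivative_eq_rhs) (simp add: fun_eq_iff sum_option ddlam_def[of None] ddlam_def[of "Some j0"] i(1))
qed

definition dph :: "'m option \<Rightarrow> 'm option \<Rightarrow> real ^ ('m option) \<Rightarrow> real" where
  "dph i j v = (if j = None then N / 2 else 1) * dth i v + (if j \<in> {None, Some j0} then 0 else 1) * dlam i v"

definition ddph :: "'m option \<Rightarrow> 'm option \<Rightarrow> 'm option \<Rightarrow> real ^ ('m option) \<Rightarrow> real" where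
  "ddph l i j v = (if j = None then N / 2 else 1) * ddth l i v + (if j \<in> {None, Some j0} then 0 else 1) * ddlam l i v"

lemma ph_eq: "ph a j v = (if j = None then ln a else 0) + (if j = None then N / 2 else 1) * theta v
    + (if j \<in> {None, Some j0} then 0 else 1) * lam v"
  by (simp add: ph_def split: option.split)

lemma has_derivative_ph: "(ph a j has_derivative (\<lambda>h. \<Sum>i\<in>UNIV. h $ i * dph i j v)) (at v)"
proof -
  have "(ph a j has_derivative (\<lambda>h. 0 + (if j = None then N / 2 else 1) * (\<Sum>i\<in>UNIV. h $ i * dth i v)
      + (if j \<in> {None, Some j0} then 0 else 1) * (\<Sum>i\<in>UNIV. h $ i * dlam i v))) (at v)"
    unfolding ph_eq[abs_def]
    by (intro has_derivative_add has_derivative_const has_derivative_mult_right has_derivative_theta has_derivative_lam)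
  then show ?thesis
    by (rule has_derivative_eq_rhs) (simp add: fun_eq_iff dph_def sum_distrib_left sum.distrib[symmetric] algebra_simps)
qed

lemma has_derivative_dph: "(dph i j has_derivative (\<lambda>h. \<Sum>l\<in>UNIV. h $ l * ddph l i j v)) (at v)"
proof -
  have "(dph i j has_derivative (\<lambda>h. (if j = None then N / 2 else 1) * (\<Sum>l\<in>UNIV. h $ l * ddth l i v)
      + (if j \<in> {None, Some j0} then 0 else 1) * (\<Sum>l\<in>UNIV. h $ l * ddlam l i v))) (at v)"
    unfolding dph_def[abs_def]
    by (intro has_derivative_add has_derivative_mult_right has_derivative_dth has_derivative_dlam)
  then show ?thesis
    by (rule has_derivative_eq_rhs) (simp add: fun_eq_iff ddph_def sum_distrib_left sum.distrib[symmetric] algebra_simps)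
qed

lemma card_sphere_coords: "real (card (-{j0})) = N - 2"
proof -
  have "card (-{j0}) = CARD('m) - 1" by (simp add: Compl_eq_Diff_UNIV)
  moreover have "CARD('m) \<ge> 1" by (simp add: Suc_leI)
  ultimately show ?thesis by (simp add: N_def of_nat_diff)
qed

lemma N_ge: "N \<ge> 3"
proof -
  have "card {j0, j1} \<le> CARD('m)" by (rule card_mono) auto
  then show ?thesis using j01 by (simp add: N_def)
qed

text \<open>The contribution of direction y. The exponents of the other directions contain theta
  with the factors N/2 once and 1 for the N - 2 sphere directions: these add up to (3 N - 4) / 2,
  and their squares to N^2 / 4 + N - 2.\<close>

definition err :: "real ^ ('m option) \<Rightarrow> real" where
  "err v = (3 * N - 4) * ddth (Some j0) (Some j0) v
    + (((3 * N - 4) / 2)\<^sup>2 - (3 * N - 4) + N\<^sup>2 / 4 + N - 2) * (dth (Some j0) v)\<^sup>2"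

lemma coord_scal_met:
  assumes "v \<in> half_space"
  shows "coord_scal (met a) v = exp (- 2 * theta v) * ((N - 2) * (N - 3) - err v)"
proof -
  define w where "w i = exp (- 2 * ph a i v)" for i
  define F where "F i = (\<Sum>j\<in>-{i}. 2 * (ddph i i j v - dph i i v * dph i j v) + (dph i j v)\<^sup>2)
    + (\<Sum>j\<in>-{i}. dph i j v)\<^sup>2" for i
  have "coord_scal (met a) v = - (\<Sum>i\<in>UNIV. w i * F i)"
    unfolding w_def F_def
    by (rule coord_scal_diag_metric[OF has_derivative_ph has_derivative_dph met_def assms])
  also have "\<dots> = - (w None * F None + w (Some j0) * F (Some j0) + (\<Sum>j\<in>-{j0}. w (Some j) * F (Some j)))"
    by (simp add: sum_option)
  \<comment> \<open>Theta is linear in x, so no second derivative appears. With c its x-derivative,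
    the rest is (N - 1) (c^2 - N c^2) + (N - 1)^2 c^2 = 0.\<close>
  also have "F None = 0"
  proof -
    have sum: "(\<Sum>j\<in>-{None}. f j) = f (Some j0) + (\<Sum>j\<in>-{j0}. f (Some j))" for f :: "'m option \<Rightarrow> real"
      using sum_option[of f] by (simp add: Compl_eq_Diff_UNIV sum_diff1)
    have 1: "dph None (Some j) v = dth None v" for j
      by (simp add: dph_def dlam_def)
    have 2: "dph None None v = N / 2 * dth None v" by (simp add: dph_def dlam_def)
    have 3: "ddph None None j v = 0" for j
      by (simp add: ddph_def ddth_simps ddlam_def)
    show ?thesis
      unfolding F_def sum by (simp add: 1 2 3 card_sphere_coords) (simp add: power2_eq_square algebra_simps)
  qed
  also have "F (Some j0) = err v"
  proof -
    have sum: "(\<Sum>j\<in>-{Some j0}. f j) = f None + (\<Sum>j\<in>-{j0}. f (Some j))" for f :: "'m option \<Rightarrow> real"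
      using sum_option[of f] by (simp add: Compl_eq_Diff_UNIV sum_diff1)
    have 1: "dph (Some j0) j v = (if j = None then N / 2 else 1) * dth (Some j0) v" for j
      by (simp add: dph_def dlam_def)
    have 2: "ddph (Some j0) (Some j0) j v = (if j = None then N / 2 else 1) * ddth (Some j0) (Some j0) v" for j
      by (simp add: ddph_def ddlam_def)
    show ?thesis
      unfolding F_def sum err_def
      by (simp add: 1 2 card_sphere_coords) (simp add: power2_eq_square field_simps)
  qed
  also have "w (Some j0) = exp (- 2 * theta v)"
    by (simp add: w_def ph_simps)
  \<comment> \<open>Theta is constant in these directions, so this is the scalar curvature of the
    unit sphere of dimension N - 2, up to sign and the scaling by exp(- 2 theta).\<close>
  also have "(\<Sum>j\<in>-{j0}. w (Some j) * F (Some j)) = exp (- 2 * theta v) * (- ((N - 2) * (N - 3)))"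
  proof -
    define s where "s = 1 + rsq v"
    have s0: "s \<noteq> 0" by (simp add: s_def)
    have w: "w (Some j) = exp (- 2 * theta v) * (s\<^sup>2 / 4)" if "j \<noteq> j0" for j
    proof -
      have "exp (- lam v) = s / 2" by (simp add: lam_def exp_diff s_def)
      then have "exp (- 2 * lam v) = (s / 2)\<^sup>2"
        by (metis exp_double mult_minus_left mult_minus_right)
      then have "exp (- 2 * lam v) = s\<^sup>2 / 4" by (simp add: power_divide)
      moreover have "w (Some j) = exp (- 2 * theta v) * exp (- 2 * lam v)"
        using that by (simp add: w_def ph_simps flip: exp_add)
      ultimately show ?thesis by simp
    qed
    have F: "F (Some j) = (N - 3) * (2 * (4 * (v $ Some j)\<^sup>2 / s\<^sup>2 - 2 / s) + (N - 4) * (4 * (v $ Some j)\<^sup>2 / s\<^sup>2))"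
      if j: "j \<noteq> j0" for j
    proof -
      have sum: "(\<Sum>l\<in>-{Some j}. f l) = f None + f (Some j0) + (\<Sum>l\<in>-{j0}. f (Some l)) - f (Some j)" for f :: "'m option \<Rightarrow> real"
        using sum_option[of f] by (simp add: Compl_eq_Diff_UNIV sum_diff1)
      define L where "L = - (2 * v $ Some j / s)"
      define M where "M = 4 * (v $ Some j)\<^sup>2 / s\<^sup>2 - 2 / s"
      have 1: "dph (Some j) None v = 0" "dph (Some j) (Some j0) v = 0"
        "\<And>l. l \<noteq> j0 \<Longrightarrow> dph (Some j) (Some l) v = L"
        using j by (simp_all add: dph_def dth_Some dlam_def s_def L_def)
      have 2: "ddph (Some j) (Some j) None v = 0" "ddph (Some j) (Some j) (Some j0) v = 0"
        "\<And>l. l \<noteq> j0 \<Longrightarrow> ddph (Some j) (Some j) (Some l) v = M"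
        using j by (simp_all add: ddph_def ddth_Some ddlam_def s_def M_def power2_eq_square)
      have L2: "4 * (v $ Some j)\<^sup>2 / s\<^sup>2 = L * L" by (simp add: L_def power2_eq_square)
      have "F (Some j) = (N - 2) * (2 * (M - L * L) + L * L) - (2 * (M - L * L) + L * L) + ((N - 2) * L - L)\<^sup>2"
        unfolding F_def sum using j
        by (simp add: 1 2 card_sphere_coords power2_eq_square)
      also have "\<dots> = (N - 3) * (2 * M + (N - 4) * (L * L))"
        by (simp add: power2_eq_square algebra_simps)
      finally show ?thesis by (simp only: M_def L2)
    qed
    have "(\<Sum>j\<in>-{j0}. w (Some j) * F (Some j))
        = (\<Sum>j\<in>-{j0}. exp (- 2 * theta v) * ((N - 3) * ((N - 2) * (v $ Some j)\<^sup>2 - s)))"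
    proof (rule sum.cong[OF refl])
      fix j assume "j \<in> -{j0}"
      then have j: "j \<noteq> j0" by simp
      have "s\<^sup>2 / 4 * (c * (2 * (4 * x / s\<^sup>2 - 2 / s) + d * (4 * x / s\<^sup>2))) = c * ((d + 2) * x - s)" for x c d
        using s0 by (simp add: field_simps power2_eq_square)
      from this[of "N - 3" "(v $ Some j)\<^sup>2" "N - 4"]
      show "w (Some j) * F (Some j) = exp (- 2 * theta v) * ((N - 3) * ((N - 2) * (v $ Some j)\<^sup>2 - s))"
        unfolding w[OF j] F[OF j] by (simp add: mult.assoc)
    qed
    also have "\<dots> = exp (- 2 * theta v) * ((N - 3) * ((N - 2) * rsq v - (N - 2) * s))"
      by (simp add: sum_distrib_left[symmetric] sum_subtractf rsq_def card_sphere_coords)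
    also have "\<dots> = exp (- 2 * theta v) * (- ((N - 2) * (N - 3)))"
      by (simp add: s_def algebra_simps)
    finally show ?thesis .
  qed
  finally show ?thesis by (simp add: algebra_simps)
qed

section \<open>Bounds for the scalar curvature\<close>

lemma \<delta>_pos: "0 < \<delta>"
  using N_ge by (simp add: \<delta>_def)

lemma abs_theta_le:
  assumes "\<bar>1 - v $ None\<bar> \<le> 1"
  shows "\<bar>theta v\<bar> \<le> \<delta>"
proof -
  have "\<bar>theta v\<bar> = \<delta> * (\<bar>cos (v $ Some j0)\<bar> * \<bar>1 - v $ None\<bar>)"
    using \<delta>_pos by (simp add: theta_def abs_mult)
  also have "\<dots> \<le> \<delta> * (1 * 1)"
    using \<delta>_pos assms by (intro mult_left_mono mult_mono) auto
  finally show ?thesis by simp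
qed

lemma abs_err_le:
  assumes "\<bar>1 - v $ None\<bar> \<le> 1"
  shows "\<bar>err v\<bar> \<le> 1"
proof -
  let ?b = "3 * N - 4" and ?B = "((3 * N - 4) / 2)\<^sup>2 - (3 * N - 4) + N\<^sup>2 / 4 + N - 2"
  have dd: "\<bar>ddth (Some j0) (Some j0) v\<bar> \<le> \<delta>"
    using abs_theta_le[OF assms] by (simp add: ddth_simps theta_def)
  have "\<bar>dth (Some j0) v\<bar> = \<delta> * (\<bar>sin (v $ Some j0)\<bar> * \<bar>1 - v $ None\<bar>)"
    using \<delta>_pos by (simp add: dth_simps abs_mult)
  also have "\<dots> \<le> \<delta> * (1 * 1)"
    using \<delta>_pos assms by (intro mult_left_mono mult_mono) auto
  finally have d: "(dth (Some j0) v)\<^sup>2 \<le> \<delta>\<^sup>2"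
    using \<delta>_pos by (simp add: abs_le_square_iff[symmetric])
  have N1: "1 \<le> N" "N \<le> N\<^sup>2" using N_ge by (simp_all add: power2_eq_square)
  have B: "\<bar>?B\<bar> \<le> 4 * N\<^sup>2"
  proof -
    have "?B = 5 / 2 * N\<^sup>2 - 8 * N + 6" by (simp add: power2_eq_square field_simps)
    moreover have "3 * N \<le> N\<^sup>2" using N_ge by (simp add: power2_eq_square)
    ultimately show ?thesis using N_ge by linarith
  qed
  have "\<bar>err v\<bar> \<le> \<bar>?b\<bar> * \<bar>ddth (Some j0) (Some j0) v\<bar> + \<bar>?B\<bar> * \<bar>(dth (Some j0) v)\<^sup>2\<bar>"
    unfolding err_def abs_mult[symmetric] by (rule abs_triangle_ineq)
  also have "\<dots> \<le> (3 * N\<^sup>2) * \<delta> + (4 * N\<^sup>2) * \<delta>\<^sup>2"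
    using dd d B N_ge N1 by (intro add_mono mult_mono) auto
  also have "(3 * N\<^sup>2) * \<delta> = 3 / 100" using N_ge by (simp add: \<delta>_def)
  also have "(4 * N\<^sup>2) * \<delta>\<^sup>2 = 4 / 100 * \<delta>" using N_ge by (simp add: \<delta>_def power2_eq_square)
  also have "\<delta> \<le> 1"
    using N_ge N1 by (simp add: \<delta>_def)
  finally show ?thesis by simp
qed

lemma chart_at_atlas:
  assumes "p \<in> X"
  obtains c e where "chart_at atlas p = chart c e" "pole e" "p \<in> dom c e"
proof -
  have "\<exists>C. C \<in> atlas \<and> p \<in> fst C" using assms dom_cover by blast
  then have "chart_at atlas p \<in> atlas \<and> p \<in> fst (chart_at atlas p)"
    unfolding chart_at_def by (rule someI_ex)
  then show thesis using that by (auto simp: atlas_def)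
qed

lemma scal_eq:
  assumes "p \<in> X"
  obtains v where "\<bar>1 - v $ None\<bar> \<le> 1"
    "scal atlas (\<lambda>c. met a) p = exp (- 2 * theta v) * ((N - 2) * (N - 3) - err v)"
proof -
  obtain c e where c: "chart_at atlas p = chart c e" "pole e" "p \<in> dom c e"
    using chart_at_atlas[OF assms] .
  have win: "crd c e p \<in> win c" using par_crd(2)[OF c(2,3)] .
  then have "scal atlas (\<lambda>c. met a) p = exp (- 2 * theta (crd c e p)) * ((N - 2) * (N - 3) - err (crd c e p))"
    by (simp add: scal_def c(1) coord_scal_met win_def half_space_def)
  moreover have "\<bar>1 - crd c e p $ None\<bar> \<le> 1" using win by (simp add: win_def abs_le_iff)
  ultimately show thesis using that by blast
qed

lemma scal_bounded:
  assumes "p \<in> X"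
  shows "\<bar>scal atlas (\<lambda>c. met a) p\<bar> \<le> exp (2 * \<delta>) * ((N - 2) * (N - 3) + 1)"
proof -
  obtain v where v: "\<bar>1 - v $ None\<bar> \<le> 1"
    "scal atlas (\<lambda>c. met a) p = exp (- 2 * theta v) * ((N - 2) * (N - 3) - err v)"
    using scal_eq[OF assms] .
  have "0 \<le> (N - 2) * (N - 3)" using N_ge by (intro mult_nonneg_nonneg) auto
  then have "\<bar>(N - 2) * (N - 3) - err v\<bar> \<le> (N - 2) * (N - 3) + 1"
    using abs_err_le[OF v(1)] by linarith
  moreover have "exp (- 2 * theta v) \<le> exp (2 * \<delta>)"
    using abs_theta_le[OF v(1)] by (auto simp: abs_le_iff)
  ultimately show ?thesis
    unfolding v(2) abs_mult by (intro mult_mono) auto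
qed

text \<open>For N >= 5 the sphere contributes at least 6, which dominates the error of absolute
  value at most 1.\<close>

lemma scal_ge:
  assumes "p \<in> X" "N \<ge> 5"
  shows "scal atlas (\<lambda>c. met a) p \<ge> exp (- 2 * \<delta>)"
proof -
  obtain v where v: "\<bar>1 - v $ None\<bar> \<le> 1"
    "scal atlas (\<lambda>c. met a) p = exp (- 2 * theta v) * ((N - 2) * (N - 3) - err v)"
    using scal_eq[OF assms(1)] .
  have "3 * 2 \<le> (N - 2) * (N - 3)" using assms(2) by (intro mult_mono) auto
  then have "1 \<le> (N - 2) * (N - 3) - err v"
    using abs_err_le[OF v(1)] by (auto simp: abs_le_iff)
  moreover have "exp (- 2 * \<delta>) \<le> exp (- 2 * theta v)"
    using abs_theta_le[OF v(1)] by (auto simp: abs_le_iff)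
  ultimately have "exp (- 2 * \<delta>) * 1 \<le> exp (- 2 * theta v) * ((N - 2) * (N - 3) - err v)"
    by (intro mult_mono) auto
  then show ?thesis by (simp add: v(2))
qed

section \<open>The boundary and its mean curvature\<close>

definition mean_curv :: "real \<Rightarrow> real" where
  "mean_curv y = (N - 1) * (\<delta> * cos y) * exp (- (N / 2 * (\<delta> * cos y)))"

lemma coord_mean_curvature_met:
  assumes "a > 0" "v $ None = 0"
  shows "coord_mean_curvature (met a) v = mean_curv (v $ Some j0) / a"
proof -
  have "v \<in> half_space" using assms(2) by (simp add: half_space_def)
  then have "coord_mean_curvature (met a) v = - exp (- ph a None v) * (\<Sum>i\<in>UNIV. dph None (Some i) v)"
    by (rule coord_mean_curvature_diag_metric[OF has_derivative_ph has_derivative_dph met_def])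
  also have "dph None (Some i) v = - (\<delta> * cos (v $ Some j0))" for i
    by (simp add: dph_def dlam_def dth_simps)
  then have "(\<Sum>i\<in>UNIV. dph None (Some i) v) = - ((N - 1) * (\<delta> * cos (v $ Some j0)))"
    by (simp add: N_def)
  also have "exp (- ph a None v) = exp (- (N / 2 * (\<delta> * cos (v $ Some j0)))) / a"
  proof -
    have "exp (- (ln a + c)) = exp (- c) / a" for c
      using assms(1) by (simp only: minus_add_distrib exp_add exp_minus exp_ln divide_inverse mult.commute)
    then show ?thesis using assms(2) by (simp add: ph_simps theta_def)
  qed
  finally show ?thesis by (simp add: mean_curv_def mult_ac)
qed

lemma sg_eq_1: "-1 < sg m \<Longrightarrow> sg m = 1"
  by (simp add: sg_def split: if_splits)

text \<open>Both ends of the slab are accounted for, since the gluing map turns x = -1 into x =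
  1.\<close>

lemma boundary_atlas: "boundary atlas = {emb y 1 \<sigma> | y \<sigma>. norm \<sigma> = 1}"
proof
  show "boundary atlas \<subseteq> {emb y 1 \<sigma> | y \<sigma>. norm \<sigma> = 1}"
  proof
    fix p assume "p \<in> boundary atlas"
    then obtain c e where c: "pole e" "p \<in> dom c e" "crd c e p $ None = 0"
      by (auto simp: boundary_def atlas_def)
    then have "p = emb (crd c e p $ Some j0) 1 (sph e (crd c e p))"
      using par_crd(1)[OF c(1,2)] by (simp add: par_def)
    then show "p \<in> {emb y 1 \<sigma> | y \<sigma>. norm \<sigma> = 1}" using norm_sph[OF c(1)] by blast
  qed
  show "{emb y 1 \<sigma> | y \<sigma>. norm \<sigma> = 1} \<subseteq> boundary atlas"
  proof clarify
    fix y and \<sigma> :: "real ^ 'm" assume "norm \<sigma> = 1"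
    define e :: real where "e = (if \<sigma> $ j0 = 1 then -1 else 1)"
    have e: "pole e" "\<sigma> $ j0 \<noteq> e" by (auto simp: e_def pole_def)
    have d: "emb y 1 \<sigma> \<in> dom y e" using \<open>norm \<sigma> = 1\<close> e(2) by (intro emb_in_dom) auto
    moreover have "crd y e (emb y 1 \<sigma>) $ None = 0" by (simp add: crd_None xcrd_emb)
    ultimately show "emb y 1 \<sigma> \<in> boundary atlas"
      using e(1) unfolding boundary_def atlas_def by force
  qed
qed

lemma emb_in_boundary: "norm \<sigma> = 1 \<Longrightarrow> emb y 1 \<sigma> \<in> boundary atlas"
  by (auto simp: boundary_atlas)

text \<open>An odd power of the gluing map would give x = -1, which no chart allows. Hence on the
  boundary y is determined modulo 2 pi and not only modulo pi, and cos y is a function on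
  it.\<close>

lemma boundary_crd:
  assumes "pole e" "emb y 1 \<sigma> \<in> dom c e"
  obtains m where "even m" "crd c e (emb y 1 \<sigma>) $ Some j0 = y + of_int m * pi"
    "crd c e (emb y 1 \<sigma>) $ None = 0" "sph e (crd c e (emb y 1 \<sigma>)) = \<sigma>"
proof -
  let ?v = "crd c e (emb y 1 \<sigma>)"
  have "emb y 1 \<sigma> = par e ?v" using par_crd(1)[OF assms] by simp
  then obtain m where m: "?v $ Some j0 = y + of_int m * pi" "1 - ?v $ None = sg m * 1" "sph e ?v = flip (sg m) \<sigma>"
    using emb_eqD unfolding par_def by metis
  have "?v $ None < 2" using par_crd(2)[OF assms] by (simp add: win_def)
  then have s: "sg m = 1" using m(2) by (intro sg_eq_1) simp
  then have "even m" by (simp add: sg_def split: if_splits)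
  moreover have "?v $ None = 0" using m(2) s by simp
  moreover have "sph e ?v = \<sigma>" using m(3) by (simp add: s vec_eq_iff flip_nth)
  ultimately show thesis using that m(1) by blast
qed

lemma mean_curv_add_even: "even m \<Longrightarrow> mean_curv (y + of_int m * pi) = mean_curv y"
  unfolding mean_curv_def cos_add_int_pi by (simp add: sg_def)

lemma mean_curvature_emb:
  assumes "norm \<sigma> = 1" "a > 0"
  shows "mean_curvature atlas (\<lambda>c. met a) (emb y 1 \<sigma>) = mean_curv y / a"
proof -
  have "emb y 1 \<sigma> \<in> X" using assms(1) by (intro emb_in_X) auto
  then obtain c e where c: "chart_at atlas (emb y 1 \<sigma>) = chart c e" "pole e" "emb y 1 \<sigma> \<in> dom c e"
    using chart_at_atlas by blast
  obtain m where m: "even m" "crd c e (emb y 1 \<sigma>) $ Some j0 = y + of_int m * pi"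
    "crd c e (emb y 1 \<sigma>) $ None = 0"
    using boundary_crd[OF c(2,3)] .
  show ?thesis
    by (simp add: mean_curvature_def c(1) coord_mean_curvature_met[OF assms(2) m(3)] m(2) mean_curv_add_even m(1))
qed

lemma boundary_nonempty: "boundary atlas \<noteq> {}"
proof -
  have "emb 0 1 (axis j0 1) \<in> boundary atlas" by (intro emb_in_boundary) simp
  then show ?thesis by blast
qed

lemma connected_boundary: "connectedin T (boundary atlas)"
proof -
  have "boundary atlas = (\<lambda>(y, \<sigma>). emb y 1 \<sigma>) ` (UNIV \<times> sphere 0 1)"
  proof
    show "boundary atlas \<subseteq> (\<lambda>(y, \<sigma>). emb y 1 \<sigma>) ` (UNIV \<times> sphere 0 1)"
      by (force simp: boundary_atlas)
  qed (auto intro: emb_in_boundary)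
  moreover have "continuous_on S (\<lambda>(y, \<sigma>). emb y 1 \<sigma>)" for S
    unfolding split_beta by (intro continuous_on_emb continuous_intros)
  ultimately have "connected (boundary atlas)"
    using connected_sphere_m by (metis connected_Times connected_UNIV connected_continuous_image)
  moreover have "boundary atlas \<subseteq> X" by (auto simp: boundary_atlas intro: emb_in_X)
  ultimately show ?thesis by (simp add: T_def connectedin_subtopology)
qed

lemma abs_mean_curv_le: "\<bar>mean_curv y\<bar> \<le> (N - 1) * \<delta> * exp (N / 2 * \<delta>)"
proof -
  have c: "\<bar>\<delta> * cos y\<bar> \<le> \<delta>" using \<delta>_pos by (simp add: abs_mult)
  then have "- (N / 2 * (\<delta> * cos y)) \<le> N / 2 * \<delta>"
    using mult_left_mono[of "- (\<delta> * cos y)" \<delta> "N / 2"] N_ge by (simp add: abs_le_iff)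
  then have "\<bar>N - 1\<bar> * \<bar>\<delta> * cos y\<bar> * \<bar>exp (- (N / 2 * (\<delta> * cos y)))\<bar> \<le> (N - 1) * \<delta> * exp (N / 2 * \<delta>)"
    using c N_ge \<delta>_pos by (intro mult_mono) auto
  then show ?thesis by (simp add: mean_curv_def abs_mult)
qed

lemma INF_mean_curvature:
  "filterlim (\<lambda>a. INF p\<in>boundary atlas. mean_curvature atlas (\<lambda>c. met a) p) at_bot (at_right 0)"
proof -
  have "filterlim (\<lambda>a. mean_curv pi / a) at_bot (at_right 0)"
  proof -
    \<comment> \<open>At y = pi the cosine is -1; this one point already forces the infimum down
      like a negative multiple of 1/a.\<close>
    have "mean_curv pi < 0" using N_ge \<delta>_pos by (simp add: mean_curv_def mult_pos_pos)
    then have "LIM a at_right 0. mean_curv pi * inverse a :> at_bot"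
      by (intro filterlim_tendsto_neg_mult_at_bot[OF tendsto_const] filterlim_inverse_at_top_right)
    then show ?thesis by (simp add: divide_inverse)
  qed
  moreover have "\<forall>\<^sub>F a in at_right 0. (INF p\<in>boundary atlas. mean_curvature atlas (\<lambda>c. met a) p) \<le> mean_curv pi / a"
  proof (rule eventually_at_rightI[of 0 1])
    fix a :: real assume "a \<in> {0<..<1}"
    then have a: "a > 0" by simp
    have "emb pi 1 (axis j0 1) \<in> boundary atlas" by (intro emb_in_boundary) simp
    \<comment> \<open>A real infimum lies below the values only when these are bounded
      below.\<close>
    moreover have "bdd_below (mean_curvature atlas (\<lambda>c. met a) ` boundary atlas)"
    proof (rule bdd_belowI2[of _ "- ((N - 1) * \<delta> * exp (N / 2 * \<delta>) / a)"])
      fix p assume "p \<in> boundary atlas"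
      then obtain y \<sigma> where p: "p = emb y 1 \<sigma>" "norm \<sigma> = 1" by (auto simp: boundary_atlas)
      have "- ((N - 1) * \<delta> * exp (N / 2 * \<delta>)) / a \<le> mean_curv y / a"
        using abs_mean_curv_le[of y] a by (intro divide_right_mono) (auto simp: abs_le_iff)
      then show "- ((N - 1) * \<delta> * exp (N / 2 * \<delta>) / a) \<le> mean_curvature atlas (\<lambda>c. met a) p"
        by (simp add: p mean_curvature_emb a)
    qed
    ultimately have "(INF p\<in>boundary atlas. mean_curvature atlas (\<lambda>c. met a) p)
        \<le> mean_curvature atlas (\<lambda>c. met a) (emb pi 1 (axis j0 1))"
      by (intro cINF_lower)
    then show "(INF p\<in>boundary atlas. mean_curvature atlas (\<lambda>c. met a) p) \<le> mean_curv pi / a"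
      by (simp add: mean_curvature_emb a)
  qed simp
  ultimately show ?thesis
    by (rule filterlim_at_bot_mono)
qed

lemma induced_metric_met:
  "induced_metric (met a) v = diag (\<lambda>j. if j = j0 then exp (2 * theta v) else exp (2 * (theta v + lam v)))"
  by (simp add: induced_metric_def met_def ph_def vec_eq_iff)

end

section \<open>Inversion and Lebesgue measure\<close>

definition rsq_off :: "'n::finite \<Rightarrow> real ^ 'n \<Rightarrow> real" where
  "rsq_off j0 z = (\<Sum>j\<in>-{j0}. (z $ j)\<^sup>2)"

text \<open>The change between the two poles as seen on the boundary, where \<open>None\<close> is
  absent. Where \<open>rsq_off\<close> vanishes, division by 0 gives the entry 0.\<close>

definition inv_off :: "'n::finite \<Rightarrow> 'n \<Rightarrow> real ^ 'n \<Rightarrow> real ^ 'n" where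
  "inv_off j0 j1 z = (\<chi> j. if j = j0 then z $ j0 else (if j = j1 then -1 else 1) * (z $ j / rsq_off j0 z))"

definition dinv_off :: "'n::finite \<Rightarrow> 'n \<Rightarrow> real ^ 'n \<Rightarrow> real ^ 'n \<Rightarrow> real ^ 'n" where
  "dinv_off j0 j1 z h = (\<chi> j. if j = j0 then h $ j0 else (if j = j1 then -1 else 1) *
    ((h $ j * rsq_off j0 z - z $ j * (2 * (\<Sum>l\<in>-{j0}. z $ l * h $ l))) / (rsq_off j0 z * rsq_off j0 z)))"

lemma rsq_off_nonneg [simp]: "0 \<le> rsq_off j0 z"
  by (simp add: rsq_off_def sum_nonneg)

lemma inv_off_nth: "inv_off j0 j1 z $ j0 = z $ j0"
    "j \<noteq> j0 \<Longrightarrow> inv_off j0 j1 z $ j = (if j = j1 then -1 else 1) * (z $ j / rsq_off j0 z)"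
  by (simp_all add: inv_off_def)

lemma rsq_off_inv_off: "rsq_off j0 (inv_off j0 j1 z) = 1 / rsq_off j0 z"
proof -
  have "rsq_off j0 (inv_off j0 j1 z) = (\<Sum>j\<in>-{j0}. (z $ j)\<^sup>2 / (rsq_off j0 z)\<^sup>2)"
    unfolding rsq_off_def[of j0 "inv_off j0 j1 z"]
    by (intro sum.cong) (auto simp: inv_off_nth power_divide power_mult_distrib)
  also have "\<dots> = rsq_off j0 z / (rsq_off j0 z)\<^sup>2"
    by (simp add: sum_divide_distrib[symmetric] rsq_off_def)
  finally show ?thesis by (simp add: power2_eq_square)
qed

lemma inv_off_inv_off: "rsq_off j0 z \<noteq> 0 \<Longrightarrow> inv_off j0 j1 (inv_off j0 j1 z) = z"
  unfolding vec_eq_iff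
proof
  fix j assume "rsq_off j0 z \<noteq> 0"
  then show "inv_off j0 j1 (inv_off j0 j1 z) $ j = z $ j"
    by (cases "j = j0") (simp_all add: inv_off_nth rsq_off_inv_off)
qed

lemma has_derivative_inv_off:
  assumes "rsq_off j0 z \<noteq> 0"
  shows "(inv_off j0 j1 has_derivative dinv_off j0 j1 z) (at z within S)"
proof (rule has_derivative_vec)
  fix j
  have "(rsq_off j0 has_derivative (\<lambda>h. \<Sum>l\<in>-{j0}. of_nat 2 * h $ l * (z $ l) ^ (2 - 1))) (at z within S)"
    unfolding rsq_off_def by (intro has_derivative_sum has_derivative_power has_derivative_nth)
  then have rsq_off: "(rsq_off j0 has_derivative (\<lambda>h. 2 * (\<Sum>l\<in>-{j0}. z $ l * h $ l))) (at z within S)"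
    by (simp add: sum_distrib_left mult_ac)
  show "((\<lambda>z. inv_off j0 j1 z $ j) has_derivative (\<lambda>h. dinv_off j0 j1 z h $ j)) (at z within S)"
  proof (cases "j = j0")
    case True
    then show ?thesis by (simp add: inv_off_def dinv_off_def has_derivative_nth)
  next
    case False
    have "((\<lambda>z. (if j = j1 then -1 else 1) * (z $ j / rsq_off j0 z)) has_derivative
        (\<lambda>h. (if j = j1 then -1 else 1) * ((h $ j * rsq_off j0 z - z $ j * (2 * (\<Sum>l\<in>-{j0}. z $ l * h $ l)))
          / (rsq_off j0 z * rsq_off j0 z)))) (at z within S)"
      by (intro has_derivative_mult_right has_derivative_divide' has_derivative_nth rsq_off assms)
    then show ?thesis using False by (simp add: inv_off_def dinv_off_def)
  qed
qed

text \<open>The inversion is conformal in the coordinates other than \<open>j0\<close>. Hence the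
  Jacobian times its transpose is diagonal, which yields the absolute value of the determinant
  without expanding it.\<close>

lemma dinv_off_inner:
  assumes "rsq_off j0 z \<noteq> 0"
  shows "dinv_off j0 j1 z h \<bullet> dinv_off j0 j1 z k = h $ j0 * k $ j0 + (\<Sum>j\<in>-{j0}. h $ j * k $ j) / (rsq_off j0 z)\<^sup>2"
proof -
  define r s t where "r = rsq_off j0 z" and "s = (\<Sum>l\<in>-{j0}. z $ l * h $ l)" and "t = (\<Sum>l\<in>-{j0}. z $ l * k $ l)"
  have r: "r \<noteq> 0" using assms by (simp add: r_def)
  have "dinv_off j0 j1 z h \<bullet> dinv_off j0 j1 z k = h $ j0 * k $ j0 + (\<Sum>j\<in>-{j0}. dinv_off j0 j1 z h $ j * dinv_off j0 j1 z k $ j)"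
    by (simp add: inner_vec_def sum.remove[of UNIV j0] Compl_eq_Diff_UNIV) (simp add: dinv_off_def)
  also have "(\<Sum>j\<in>-{j0}. dinv_off j0 j1 z h $ j * dinv_off j0 j1 z k $ j)
      = (\<Sum>j\<in>-{j0}. (h $ j * k $ j) / r\<^sup>2 - 2 * t / r ^ 3 * (z $ j * h $ j) - 2 * s / r ^ 3 * (z $ j * k $ j)
          + 4 * s * t / r ^ 4 * (z $ j)\<^sup>2)"
  proof (rule sum.cong[OF refl])
    fix j assume "j \<in> -{j0}"
    then have "dinv_off j0 j1 z h $ j * dinv_off j0 j1 z k $ j
        = ((h $ j * r - z $ j * (2 * s)) / (r * r)) * ((k $ j * r - z $ j * (2 * t)) / (r * r))"
      by (simp add: dinv_off_def r_def s_def t_def)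
    also have "\<dots> = (h $ j * k $ j) / r\<^sup>2 - 2 * t / r ^ 3 * (z $ j * h $ j) - 2 * s / r ^ 3 * (z $ j * k $ j)
          + 4 * s * t / r ^ 4 * (z $ j)\<^sup>2"
      using r by (simp add: field_simps power2_eq_square power3_eq_cube power4_eq_xxxx)
    finally show "dinv_off j0 j1 z h $ j * dinv_off j0 j1 z k $ j = \<dots>" .
  qed
  also have "\<dots> = (\<Sum>j\<in>-{j0}. h $ j * k $ j) / r\<^sup>2 - 2 * t / r ^ 3 * s - 2 * s / r ^ 3 * t + 4 * s * t / r ^ 4 * r"
    by (simp add: sum.distrib sum_subtractf sum_distrib_left[symmetric] sum_divide_distrib[symmetric] rsq_off_def[symmetric]
        r_def s_def t_def)
  also have "\<dots> = (\<Sum>j\<in>-{j0}. h $ j * k $ j) / r\<^sup>2"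
    using r by (simp add: field_simps power3_eq_cube power4_eq_xxxx)
  finally show ?thesis by (simp add: r_def)
qed

lemma abs_det_dinv_off:
  fixes z :: "real ^ 'n::finite"
  assumes "rsq_off j0 z \<noteq> 0"
  shows "\<bar>det (matrix (dinv_off j0 j1 z))\<bar> = 1 / rsq_off j0 z ^ (CARD('n) - 1)"
proof -
  let ?J = "matrix (dinv_off j0 j1 z)" and ?d = "\<lambda>j. if j = j0 then 1 else 1 / (rsq_off j0 z)\<^sup>2"
  have lin: "linear (dinv_off j0 j1 z)"
    using has_derivative_inv_off[OF assms] has_derivative_linear by blast
  have "x \<bullet> ((transpose ?J ** ?J) *v y) = x \<bullet> (diag ?d *v y)" for x y
  proof -
    have "x \<bullet> ((transpose ?J ** ?J) *v y) = (?J *v x) \<bullet> (?J *v y)"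
      unfolding matrix_vector_mul_assoc[symmetric]
      by (subst dot_lmul_matrix[symmetric]) (simp only: vector_transpose_matrix)
    also have "\<dots> = x $ j0 * y $ j0 + (\<Sum>j\<in>-{j0}. x $ j * y $ j) / (rsq_off j0 z)\<^sup>2"
      by (simp add: matrix_works lin dinv_off_inner[OF assms])
    also have "\<dots> = x \<bullet> (diag ?d *v y)"
    proof -
      have "(\<Sum>j\<in>-{j0}. x $ j * (diag ?d *v y) $ j) = (\<Sum>j\<in>-{j0}. x $ j * y $ j / (rsq_off j0 z)\<^sup>2)"
        by (intro sum.cong) (auto simp: diag_mult_vec_nth)
      then show ?thesis
        by (simp add: inner_vec_def sum.remove[of UNIV j0] Compl_eq_Diff_UNIV sum_divide_distrib)
          (simp add: diag_mult_vec_nth)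
    qed
    finally show ?thesis .
  qed
  then have "(transpose ?J ** ?J) *v y = diag ?d *v y" for y
    using vector_eq_ldot by blast
  then have "transpose ?J ** ?J = diag ?d" unfolding matrix_eq by blast
  then have "det ?J * det ?J = (\<Prod>j\<in>UNIV. ?d j)"
    by (metis det_diag det_mul det_transpose)
  also have "\<dots> = (\<Prod>j\<in>-{j0}. 1 / (rsq_off j0 z)\<^sup>2)"
    by (intro prod.mono_neutral_cong_right) auto
  also have "\<dots> = (1 / rsq_off j0 z ^ (CARD('n) - 1))\<^sup>2"
    by (simp add: Compl_eq_Diff_UNIV power_divide power_mult[symmetric] mult.commute)
  finally have "\<bar>det ?J\<bar>\<^sup>2 = (1 / rsq_off j0 z ^ (CARD('n) - 1))\<^sup>2" by (simp add: power2_eq_square)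
  then show ?thesis by (rule power2_eq_imp_eq) simp_all
qed

lemma borel_measurable_nth [measurable]: "(\<lambda>z :: real ^ 'n. z $ j) \<in> borel_measurable borel"
  by (intro borel_measurable_continuous_onI continuous_intros)

lemma borel_measurable_rsq_off [measurable]: "rsq_off j0 \<in> borel_measurable borel"
  unfolding rsq_off_def[abs_def] by measurable

lemma borel_measurable_vecI:
  fixes f :: "'a \<Rightarrow> real ^ 'n"
  assumes "\<And>j. (\<lambda>z. f z $ j) \<in> borel_measurable M"
  shows "f \<in> borel_measurable M"
  by (subst borel_measurable_euclidean_space) (auto simp: Basis_vec_def inner_axis assms)

lemma borel_measurable_inv_off [measurable]: "inv_off j0 j1 \<in> borel_measurable borel"
proof (rule borel_measurable_vecI)
  fix j
  show "(\<lambda>z. inv_off j0 j1 z $ j) \<in> borel_measurable borel"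
    by (cases "j = j0") (simp_all add: inv_off_nth)
qed

lemma null_rsq_off:
  fixes j0 j1 :: "'n::finite"
  assumes "j0 \<noteq> j1"
  shows "{z. rsq_off j0 z = 0} \<in> null_sets lborel"
proof -
  have "{z :: real ^ 'n. rsq_off j0 z = 0} \<subseteq> {z. axis j1 1 \<bullet> z = 0}"
  proof
    fix z :: "real ^ 'n" assume "z \<in> {z. rsq_off j0 z = 0}"
    then have "z $ j1 = 0" using assms by (auto simp: rsq_off_def sum_nonneg_eq_0_iff)
    then show "z \<in> {z. axis j1 1 \<bullet> z = 0}" by (simp add: inner_axis')
  qed
  moreover have "negligible {z :: real ^ 'n. axis j1 1 \<bullet> z = 0}"
    by (rule negligible_hyperplane) (auto simp: axis_eq_0_iff)
  ultimately have "{z :: real ^ 'n. rsq_off j0 z = 0} \<in> null_sets lebesgue"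
    using negligible_subset negligible_iff_null_sets by blast
  then show ?thesis
    by (rule null_sets_completion_iff[THEN iffD1, rotated]) simp
qed

definition jac_off :: "'n::finite \<Rightarrow> real ^ 'n \<Rightarrow> real" where
  "jac_off j0 z = 1 / rsq_off j0 z ^ (CARD('n) - 1)"

lemma jac_off_nonneg [simp]: "0 \<le> jac_off j0 z"
  by (simp add: jac_off_def)

lemma borel_measurable_jac_off [measurable]: "jac_off j0 \<in> borel_measurable borel"
  unfolding jac_off_def[abs_def] by measurable

text \<open>The change of variables is an equivalence between finite measure of the image and
  integrability of the Jacobian determinant. If the image has infinite measure, it shows that the
  integral is infinite as well.\<close>

lemma emeasure_inv_off_image:
  fixes j0 j1 :: "'n::{finite,wellorder}"
  assumes B: "B \<in> sets borel" "\<And>z. z \<in> B \<Longrightarrow> rsq_off j0 z \<noteq> 0" "inv_off j0 j1 ` B \<in> sets borel"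
  shows "emeasure lborel (inv_off j0 j1 ` B) = (\<integral>\<^sup>+ z. ennreal (jac_off j0 z) * indicator B z \<partial>lborel)"
proof -
  have Bl: "B \<in> sets lebesgue" using B(1) by simp
  have D: "\<bar>det (matrix (dinv_off j0 j1 z))\<bar> = jac_off j0 z" if "z \<in> B" for z
    using abs_det_dinv_off[OF B(2)[OF that]] by (simp add: jac_off_def)
  have iff: "inv_off j0 j1 ` B \<in> lmeasurable \<and> measure lebesgue (inv_off j0 j1 ` B) = m
      \<longleftrightarrow> ((\<lambda>z. \<bar>det (matrix (dinv_off j0 j1 z))\<bar>) has_integral m) B" for m
  proof (rule has_measure_differentiable_image[OF Bl])
    show "(inv_off j0 j1 has_derivative dinv_off j0 j1 x) (at x within B)" if "x \<in> B" for x
      using B(2)[OF that] by (rule has_derivative_inv_off)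
    show "inj_on (inv_off j0 j1) B"
      by (rule inj_on_inverseI[of _ "inv_off j0 j1"]) (simp add: inv_off_inv_off B(2))
  qed
  have "((\<lambda>z. \<bar>det (matrix (dinv_off j0 j1 z))\<bar>) has_integral m) B \<longleftrightarrow> (jac_off j0 has_integral m) B" for m
    by (rule has_integral_cong) (rule D)
  note iff = iff[unfolded this]
  have em: "emeasure lborel (inv_off j0 j1 ` B) = emeasure lebesgue (inv_off j0 j1 ` B)"
    using B(3) by simp
  let ?I = "\<integral>\<^sup>+ z. ennreal (jac_off j0 z) * indicator B z \<partial>lborel"
  show ?thesis
  proof (cases "inv_off j0 j1 ` B \<in> lmeasurable")
    case True
    then have "(jac_off j0 has_integral measure lebesgue (inv_off j0 j1 ` B)) B" using iff by blast
    then have "?I = ennreal (measure lebesgue (inv_off j0 j1 ` B))"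
      by (rule nn_integral_has_integral_lebesgue'[rotated]) simp
    then show ?thesis
      using True em by (simp add: emeasure_eq_measure2)
  next
    case False
    have "?I = \<infinity>"
    proof (rule ccontr)
      assume "?I \<noteq> \<infinity>"
      then obtain m where m: "?I = ennreal m" "0 \<le> m" by (cases ?I) auto
      have "((\<lambda>z. jac_off j0 z * indicator B z) has_integral m) UNIV"
      proof (rule nn_integral_has_integral)
        show "(\<lambda>z. jac_off j0 z * indicator B z) \<in> borel_measurable borel" using B(1) by measurable
        have "(\<integral>\<^sup>+ z. ennreal (jac_off j0 z * indicator B z) \<partial>lborel) = ?I"
          by (intro nn_integral_cong) (simp add: indicator_def)
        then show "(\<integral>\<^sup>+ z. ennreal (jac_off j0 z * indicator B z) \<partial>lborel) = ennreal m" using m by simp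
      qed (use m in \<open>auto simp: indicator_def\<close>)
      moreover have "(\<lambda>z. jac_off j0 z * indicator B z) = (\<lambda>z. if z \<in> B then jac_off j0 z else 0)"
        by (auto simp: indicator_def)
      ultimately have "(jac_off j0 has_integral m) B"
        by (simp only: has_integral_restrict_UNIV)
      then show False using iff False by blast
    qed
    moreover have "emeasure lborel (inv_off j0 j1 ` B) = \<infinity>"
    proof -
      have "inv_off j0 j1 ` B \<in> sets lebesgue" using B(3) by simp
      then have "\<not> emeasure lebesgue (inv_off j0 j1 ` B) < \<infinity>"
        using False by (intro notI) (blast intro: fmeasurableI)
      then show ?thesis unfolding em infinity_ennreal_def using top.not_eq_extremum by blast
    qed
    ultimately show ?thesis by simp
  qed
qed

text \<open>Off a null set \<open>inv_off\<close> is an involution, so preimages are images and the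
  formula for images becomes one for the push-forward.\<close>

lemma distr_inv_off_wellorder:
  fixes j0 j1 :: "'n::{finite,wellorder}"
  assumes "j0 \<noteq> j1"
  shows "distr (density lborel (\<lambda>z. ennreal (jac_off j0 z))) borel (inv_off j0 j1) = lborel"
proof (rule measure_eqI)
  fix A assume "A \<in> sets (distr (density lborel (\<lambda>z. ennreal (jac_off j0 z))) borel (inv_off j0 j1))"
  then have A: "A \<in> sets borel" by simp
  define B where "B = {z. rsq_off j0 z \<noteq> 0} \<inter> inv_off j0 j1 -` A"
  have B: "B \<in> sets borel"
    unfolding B_def using A measurable_sets[OF borel_measurable_inv_off A] by (intro sets.Int) auto
  have AB: "inv_off j0 j1 ` B = A - {z. rsq_off j0 z = 0}"
  proof
    show "inv_off j0 j1 ` B \<subseteq> A - {z. rsq_off j0 z = 0}" by (auto simp: B_def rsq_off_inv_off)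
    show "A - {z. rsq_off j0 z = 0} \<subseteq> inv_off j0 j1 ` B"
    proof
      fix z assume z: "z \<in> A - {z. rsq_off j0 z = 0}"
      then have "inv_off j0 j1 z \<in> B" by (auto simp: B_def rsq_off_inv_off inv_off_inv_off)
      then show "z \<in> inv_off j0 j1 ` B" using inv_off_inv_off[of j0 z j1] z by (intro image_eqI[of _ _ "inv_off j0 j1 z"]) auto
    qed
  qed
  have "emeasure (distr (density lborel (\<lambda>z. ennreal (jac_off j0 z))) borel (inv_off j0 j1)) A
      = (\<integral>\<^sup>+ z. ennreal (jac_off j0 z) * indicator (inv_off j0 j1 -` A) z \<partial>lborel)"
    using A measurable_sets[OF borel_measurable_inv_off A] by (simp add: emeasure_distr emeasure_density)
  also have "\<dots> = (\<integral>\<^sup>+ z. ennreal (jac_off j0 z) * indicator B z \<partial>lborel)"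
  proof -
    \<comment> \<open>There are at least two indices, so the exponent in \<open>jac_off\<close> is
      positive and the density takes the value 1 / 0 = 0 where \<open>rsq_off\<close>
      vanishes.\<close>
    have "card {j0, j1} \<le> CARD('n)" by (rule card_mono) auto
    then have "jac_off j0 z = 0" if "rsq_off j0 z = 0" for z
      using assms that by (simp add: jac_off_def)
    then show ?thesis by (intro nn_integral_cong) (auto simp: B_def indicator_def)
  qed
  also have "\<dots> = emeasure lborel (inv_off j0 j1 ` B)"
  proof (rule emeasure_inv_off_image[symmetric])
    show "inv_off j0 j1 ` B \<in> sets borel"
      unfolding AB using A null_rsq_off[OF assms] by (auto dest: null_setsD2)
  qed (use B in \<open>auto simp: B_def\<close>)
  also have "\<dots> = emeasure lborel A"
    unfolding AB using A null_rsq_off[OF assms] by (intro emeasure_Diff_null_set) auto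
  finally show "emeasure (distr (density lborel (\<lambda>z. ennreal (jac_off j0 z))) borel (inv_off j0 j1)) A = emeasure lborel A" .
qed simp

text \<open>The change of variables theorem of the library needs a well-ordered index type.\<close>

datatype 'a wo = Wo (unWo: 'a)

lemma bij_Wo: "bij Wo"
  by (rule bijI') (auto intro: wo.exhaust_sel)

lemma UNIV_wo: "(UNIV :: 'a wo set) = range Wo"
  by (rule bij_is_surj[OF bij_Wo, symmetric])

instance wo :: (finite) finite
  by standard (simp add: UNIV_wo)

instantiation wo :: (finite) wellorder
begin

definition less_eq_wo :: "'a wo \<Rightarrow> 'a wo \<Rightarrow> bool" where
  "less_eq_wo x y \<longleftrightarrow> to_nat (unWo x) \<le> to_nat (unWo y)"

definition less_wo :: "'a wo \<Rightarrow> 'a wo \<Rightarrow> bool" where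
  "less_wo x y \<longleftrightarrow> to_nat (unWo x) < to_nat (unWo y)"

instance
proof
  fix P :: "'a wo \<Rightarrow> bool" and a :: "'a wo"
  assume step: "\<And>x. (\<And>y. y < x \<Longrightarrow> P y) \<Longrightarrow> P x"
  show "P a"
  proof (induction a rule: measure_induct_rule[of "\<lambda>x. to_nat (unWo x)"])
    case (less x)
    show ?case
    proof (rule step)
      fix y assume "y < x"
      then show "P y" by (intro less) (simp add: less_wo_def)
    qed
  qed
qed (auto simp: less_eq_wo_def less_wo_def wo.expand)

end

definition unwo :: "real ^ 'n wo \<Rightarrow> real ^ 'n" where
  "unwo x = (\<chi> i. x $ Wo i)"

lemma unwo_nth [simp]: "unwo x $ i = x $ Wo i"
  by (simp add: unwo_def)

lemma borel_measurable_unwo [measurable]: "unwo \<in> borel_measurable borel"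
  by (rule borel_measurable_vecI) simp

lemma prod_Basis_vec:
  fixes f :: "real ^ 'n::finite \<Rightarrow> real"
  shows "(\<Prod>b\<in>Basis. f b) = (\<Prod>i\<in>UNIV. f (axis i 1))"
proof -
  have B: "(Basis :: (real ^ 'n) set) = range (\<lambda>i. axis i 1)" by (auto simp: Basis_vec_def)
  have "inj (\<lambda>i :: 'n. axis i (1::real))" by (auto simp: inj_def axis_eq_axis)
  then show ?thesis unfolding B by (simp add: prod.reindex)
qed

text \<open>Renaming coordinates preserves the volume of boxes, and these determine Lebesgue
  measure.\<close>

lemma distr_unwo: "distr lborel borel (unwo :: real ^ ('n::finite) wo \<Rightarrow> real ^ 'n) = lborel"
proof (rule lborel_eqI[symmetric])
  fix l u :: "real ^ 'n"
  assume le: "\<And>b. b \<in> Basis \<Longrightarrow> l \<bullet> b \<le> u \<bullet> b"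
  define l' u' :: "real ^ 'n wo" where "l' = (\<chi> i. l $ unWo i)" and "u' = (\<chi> i. u $ unWo i)"
  have vim: "unwo -` box l u = box l' u'"
  proof (rule set_eqI)
    fix x :: "real ^ 'n wo"
    have "(\<forall>i. l $ unWo i < x $ i \<and> x $ i < u $ unWo i) \<longleftrightarrow> (\<forall>i. l $ i < x $ Wo i \<and> x $ Wo i < u $ i)"
      by (metis wo.collapse wo.sel)
    then show "x \<in> unwo -` box l u \<longleftrightarrow> x \<in> box l' u'"
      by (simp add: mem_box_cart l'_def u'_def)
  qed
  have "emeasure (distr lborel borel unwo) (box l u) = emeasure lborel (box l' u')"
    by (simp add: emeasure_distr vim)
  also have "\<dots> = ennreal (\<Prod>b\<in>Basis. (u' - l') \<bullet> b)"
  proof (rule emeasure_lborel_box)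
    fix b :: "real ^ 'n wo" assume "b \<in> Basis"
    then obtain i where "b = axis i 1" by (auto simp: Basis_vec_def)
    moreover have "l $ unWo i \<le> u $ unWo i" using le[of "axis (unWo i) 1"] by (simp add: inner_axis)
    ultimately show "l' \<bullet> b \<le> u' \<bullet> b" by (simp add: inner_axis l'_def u'_def)
  qed
  also have "(\<Prod>b\<in>Basis. (u' - l') \<bullet> b) = (\<Prod>i\<in>UNIV. (u - l) $ unWo i)"
    by (simp add: prod_Basis_vec inner_axis u'_def l'_def)
  also have "\<dots> = (\<Prod>i\<in>UNIV. (u - l) $ i)"
    by (simp add: UNIV_wo prod.reindex[OF bij_is_inj[OF bij_Wo]])
  also have "\<dots> = (\<Prod>b\<in>Basis. (u - l) \<bullet> b)"
    by (simp add: prod_Basis_vec inner_axis)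
  finally show "emeasure (distr lborel borel unwo) (box l u) = ennreal (\<Prod>b\<in>Basis. (u - l) \<bullet> b)" .
qed simp

lemma rsq_off_unwo: "rsq_off j0 (unwo z) = rsq_off (Wo j0) z"
proof -
  have "(\<Sum>j\<in>-{j0}. (z $ Wo j)\<^sup>2) = (\<Sum>j\<in>Wo ` (-{j0}). (z $ j)\<^sup>2)"
    by (simp add: sum.reindex inj_on_subset[OF bij_is_inj[OF bij_Wo]])
  also have "Wo ` (-{j0}) = -{Wo j0}"
    by (simp add: bij_image_Compl_eq[OF bij_Wo])
  finally show ?thesis by (simp add: rsq_off_def)
qed

lemma inv_off_unwo: "inv_off j0 j1 (unwo z) = unwo (inv_off (Wo j0) (Wo j1) z)"
  unfolding vec_eq_iff
proof
  fix j
  show "inv_off j0 j1 (unwo z) $ j = unwo (inv_off (Wo j0) (Wo j1) z) $ j"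
    by (cases "j = j0") (simp_all add: inv_off_nth rsq_off_unwo)
qed

lemma distr_inv_off:
  fixes j0 j1 :: "'n::finite"
  assumes "j0 \<noteq> j1"
  shows "distr (density lborel (\<lambda>z. ennreal (jac_off j0 z))) borel (inv_off j0 j1) = lborel"
proof -
  have card: "CARD('n wo) = CARD('n)"
    using card_image[OF bij_is_inj[OF bij_Wo], where ?'a = 'n] by (simp add: UNIV_wo)
  have jac_off: "jac_off j0 (unwo z) = jac_off (Wo j0) z" for z
    by (simp add: jac_off_def rsq_off_unwo card)
  have "distr (density lborel (\<lambda>z. ennreal (jac_off j0 z))) borel (inv_off j0 j1)
      = distr (density (distr lborel borel unwo) (\<lambda>z. ennreal (jac_off j0 z))) borel (inv_off j0 j1)"
    by (simp only: distr_unwo)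
  also have "\<dots> = distr (distr (density lborel (\<lambda>z. ennreal (jac_off (Wo j0) z))) borel unwo) borel (inv_off j0 j1)"
    by (subst density_distr) (simp_all add: jac_off)
  also have "\<dots> = distr (density lborel (\<lambda>z. ennreal (jac_off (Wo j0) z))) borel (\<lambda>z. unwo (inv_off (Wo j0) (Wo j1) z))"
    by (subst distr_distr) (simp_all add: o_def inv_off_unwo)
  also have "\<dots> = distr (distr (density lborel (\<lambda>z. ennreal (jac_off (Wo j0) z))) borel (inv_off (Wo j0) (Wo j1))) borel unwo"
    by (subst distr_distr) (simp_all add: o_def)
  also have "\<dots> = lborel"
    using assms by (simp add: distr_inv_off_wellorder distr_unwo)
  finally show ?thesis .
qed

lemma nn_integral_inv_off:
  fixes j0 j1 :: "'n::finite" and F :: "real ^ 'n \<Rightarrow> ennreal"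
  assumes "j0 \<noteq> j1" "F \<in> borel_measurable borel"
  shows "(\<integral>\<^sup>+ z. F (inv_off j0 j1 z) * ennreal (jac_off j0 z) \<partial>lborel) = (\<integral>\<^sup>+ z. F z \<partial>lborel)"
proof -
  have [measurable]: "F \<in> borel_measurable borel" by (rule assms(2))
  have "(\<integral>\<^sup>+ z. F z \<partial>lborel) = (\<integral>\<^sup>+ z. F z \<partial>distr (density lborel (\<lambda>z. ennreal (jac_off j0 z))) borel (inv_off j0 j1))"
    by (simp add: distr_inv_off[OF assms(1)])
  also have "\<dots> = (\<integral>\<^sup>+ z. F (inv_off j0 j1 z) \<partial>density lborel (\<lambda>z. ennreal (jac_off j0 z)))"
    by (intro nn_integral_distr) measurable
  also have "\<dots> = (\<integral>\<^sup>+ z. ennreal (jac_off j0 z) * F (inv_off j0 j1 z) \<partial>lborel)"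
    by (intro nn_integral_density) measurable
  finally show ?thesis by (simp add: mult.commute)
qed

section \<open>The volume of the boundary\<close>

lemma nn_integral_lborel_shift:
  fixes F :: "'a::euclidean_space \<Rightarrow> ennreal"
  assumes "F \<in> borel_measurable borel"
  shows "(\<integral>\<^sup>+ z. F (z + t) \<partial>lborel) = (\<integral>\<^sup>+ z. F z \<partial>lborel)"
proof -
  have [measurable]: "F \<in> borel_measurable borel" by (rule assms)
  have "(\<integral>\<^sup>+ z. F z \<partial>lborel) = (\<integral>\<^sup>+ z. F z \<partial>distr lborel borel ((+) t))"
    by (simp add: lborel_distr_plus)
  also have "\<dots> = (\<integral>\<^sup>+ z. F (t + z) \<partial>lborel)"
    by (intro nn_integral_distr) measurable
  finally show ?thesis by (simp add: add.commute)
qed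

lemma integral_lborel_shift:
  fixes F :: "'a::euclidean_space \<Rightarrow> real"
  assumes "F \<in> borel_measurable borel"
  shows "integral\<^sup>L lborel (\<lambda>z. F (z + t)) = integral\<^sup>L lborel F"
    "integrable lborel (\<lambda>z. F (z + t)) \<longleftrightarrow> integrable lborel F"
proof -
  have [measurable]: "F \<in> borel_measurable borel" by (rule assms)
  have "integral\<^sup>L (distr lborel borel ((+) t)) F = integral\<^sup>L lborel (\<lambda>z. F (t + z))"
    by (intro integral_distr) measurable
  then show "integral\<^sup>L lborel (\<lambda>z. F (z + t)) = integral\<^sup>L lborel F"
    by (simp add: lborel_distr_plus add.commute)
  have "integrable (distr lborel borel ((+) t)) F \<longleftrightarrow> integrable lborel (\<lambda>z. F (t + z))"
    by (intro integrable_distr_eq) measurable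
  then show "integrable lborel (\<lambda>z. F (z + t)) \<longleftrightarrow> integrable lborel F"
    by (simp add: lborel_distr_plus add.commute)
qed

lemma from_tangential_nth [simp]:
  "from_tangential z $ None = 0" "from_tangential z $ Some j = z $ j"
  by (simp_all add: from_tangential_def)

lemma tangential_from_tangential [simp]: "tangential (from_tangential z) = z"
  by (simp add: tangential_def vec_eq_iff)

lemma from_tangential_tangential: "v $ None = 0 \<Longrightarrow> from_tangential (tangential v) = v"
  by (auto simp: from_tangential_def tangential_def vec_eq_iff split: option.split)

lemma continuous_on_from_tangential: "continuous_on S (from_tangential :: real ^ 'm::finite \<Rightarrow> _)"
proof -
  have "continuous_on S (\<lambda>z :: real ^ 'm. from_tangential z $ i)" for i
    by (cases i) (simp_all add: continuous_intros)
  then show ?thesis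
    using continuous_on_vec_lambda[of S "\<lambda>i z. from_tangential z $ i"] by simp
qed

context twisted_slab
begin

lemma flip_1: "flip 1 \<sigma> = \<sigma>"
  by (simp add: vec_eq_iff flip_nth)

definition bpar :: "real \<Rightarrow> real ^ 'm \<Rightarrow> nat \<Rightarrow> real" where
  "bpar e z = par e (from_tangential z)"

lemma bpar_emb: "bpar e z = emb (z $ j0) 1 (sph e (from_tangential z))"
  by (simp add: bpar_def par_def)

definition dens :: "real ^ 'm \<Rightarrow> real" where
  "dens z = exp ((N - 1) * (\<delta> * cos (z $ j0))) * (2 / (1 + rsq_off j0 z)) ^ (CARD('m) - 1)"

definition strip :: "real \<Rightarrow> (real ^ 'm) set" where
  "strip b = {z. b \<le> z $ j0 \<and> z $ j0 < b + 2 * pi}"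

definition bborel :: "(nat \<Rightarrow> real) measure" where
  "bborel = restrict_space borel (boundary atlas)"

text \<open>The stereographic projection from the pole 1 on one period of y parametrizes the
  boundary except for the circle over that pole, so a single push-forward gives the whole measure.
  The period starts at - pi/2 so that cos y is nonnegative on its first half and nonpositive on its
  second.\<close>

definition bvol :: "(nat \<Rightarrow> real) measure" where
  "bvol = distr (density lborel (\<lambda>z. ennreal (dens z * indicator (strip (- pi / 2)) z))) bborel (bpar 1)"

lemma rsq_from_tangential [simp]: "rsq (from_tangential z) = rsq_off j0 z"
  by (simp add: rsq_def rsq_off_def)

lemma one_plus_rsq_off [simp]: "0 < 1 + rsq_off j0 z"
  using rsq_off_nonneg[of j0 z] by linarith

lemma dens_nonneg [simp]: "0 \<le> dens z"
  using one_plus_rsq_off[of z] by (simp add: dens_def)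

lemma sqrt_det_induced_metric:
  "sqrt (det (induced_metric (met a) (from_tangential z))) = dens z"
proof -
  define k where "k = CARD('m) - 1"
  have card: "CARD('m) = Suc k" by (simp add: k_def)
  let ?t = "theta (from_tangential z)" and ?l = "lam (from_tangential z)"
  have "det (induced_metric (met a) (from_tangential z))
      = exp (2 * ?t) * (\<Prod>j\<in>-{j0}. exp (2 * (?t + ?l)))"
    unfolding induced_metric_met det_diag
    by (subst prod.remove[of UNIV j0]) (auto simp: Compl_eq_Diff_UNIV intro!: prod.cong)
  also have "\<dots> = exp (2 * ?t) * exp (2 * (?t + ?l)) ^ k"
    by (simp add: Compl_eq_Diff_UNIV k_def)
  also have "\<dots> = (exp ?t ^ Suc k * exp ?l ^ k)\<^sup>2"
    by (simp add: exp_double exp_add power_mult_distrib power_mult[symmetric] mult.commute)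
  also have "exp ?t ^ Suc k * exp ?l ^ k = dens z"
  proof -
    have "exp ?l = 2 / (1 + rsq_off j0 z)"
      by (simp add: lam_def exp_diff)
    moreover have "exp ?t ^ Suc k = exp ((N - 1) * (\<delta> * cos (z $ j0)))"
      by (simp only: exp_of_nat_mult[symmetric] card[symmetric]) (simp add: N_def theta_def)
    ultimately show ?thesis by (simp add: dens_def k_def)
  qed
  finally show ?thesis by simp
qed

lemma borel_measurable_dens [measurable]: "dens \<in> borel_measurable borel"
  unfolding dens_def[abs_def] by measurable

lemma sets_strip [measurable]: "strip b \<in> sets borel"
  unfolding strip_def by measurable

lemma bpar_in_boundary: "pole e \<Longrightarrow> bpar e z \<in> boundary atlas"
  unfolding bpar_emb by (intro emb_in_boundary norm_sph)

lemma measurable_bpar [measurable]: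
  assumes "pole e"
  shows "bpar e \<in> borel \<rightarrow>\<^sub>M bborel"
  unfolding bborel_def
proof (rule measurable_restrict_space2)
  have "continuous_on UNIV (bpar e)"
    unfolding bpar_def
    by (rule continuous_on_compose2[OF continuous_on_par[of UNIV] continuous_on_from_tangential]) simp
  then show "bpar e \<in> borel \<rightarrow>\<^sub>M borel" by (rule borel_measurable_continuous_onI)
qed (simp add: bpar_in_boundary assms)

lemma pole_1 [simp]: "pole 1" "pole (-1)"
  by (simp_all add: pole_def)

text \<open>An integral over a full period does not depend on where the period starts. With d the
  translate of b whose period contains b', the part of the new strip beyond d + 2 pi is moved back
  by one period.\<close>

lemma nn_integral_strip:
  fixes F :: "real ^ 'm \<Rightarrow> ennreal"
  assumes F [measurable]: "F \<in> borel_measurable borel"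
    and per: "\<And>z l. F (z + (2 * pi * of_int l) *\<^sub>R axis j0 1) = F z"
  shows "(\<integral>\<^sup>+ z. F z * indicator (strip b) z \<partial>lborel) = (\<integral>\<^sup>+ z. F z * indicator (strip b') z \<partial>lborel)"
proof -
  define l where "l = \<lfloor>(b' - b) / (2 * pi)\<rfloor>"
  have l: "b + 2 * pi * of_int l \<le> b'" "b' < b + 2 * pi * of_int l + 2 * pi"
  proof -
    have "of_int l * (2 * pi) \<le> ((b' - b) / (2 * pi)) * (2 * pi)"
      unfolding l_def by (intro mult_right_mono of_int_floor_le) simp
    moreover have "((b' - b) / (2 * pi)) * (2 * pi) < (of_int l + 1) * (2 * pi)"
      unfolding l_def by (intro mult_strict_right_mono real_of_int_floor_add_one_gt) simp
    moreover have "((b' - b) / (2 * pi)) * (2 * pi) = b' - b" by simp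
    moreover have "2 * pi * of_int l = of_int l * (2 * pi)" by (rule mult.commute)
    ultimately show "b + 2 * pi * of_int l \<le> b'" "b' < b + 2 * pi * of_int l + 2 * pi"
      by (simp_all only: distrib_right mult_1)
  qed
  define d where "d = b + 2 * pi * of_int l"
  define J where "J s t = {z :: real ^ 'm. s \<le> z $ j0 \<and> z $ j0 < t}" for s t
  have [measurable]: "J s t \<in> sets borel" for s t unfolding J_def by measurable
  have shift: "(\<integral>\<^sup>+ z. F z * indicator (J s t) z \<partial>lborel)
      = (\<integral>\<^sup>+ z. F z * indicator (J (s - 2 * pi * of_int i) (t - 2 * pi * of_int i)) z \<partial>lborel)" for s t and i :: int
  proof -
    have "(\<integral>\<^sup>+ z. F z * indicator (J s t) z \<partial>lborel)
        = (\<integral>\<^sup>+ z. F (z + (2 * pi * of_int i) *\<^sub>R axis j0 1) * indicator (J s t) (z + (2 * pi * of_int i) *\<^sub>R axis j0 1) \<partial>lborel)"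
      by (rule nn_integral_lborel_shift[symmetric]) measurable
    also have "\<dots> = (\<integral>\<^sup>+ z. F z * indicator (J (s - 2 * pi * of_int i) (t - 2 * pi * of_int i)) z \<partial>lborel)"
      by (intro nn_integral_cong) (auto simp: per J_def indicator_def)
    finally show ?thesis .
  qed
  have join: "(\<integral>\<^sup>+ z. F z * indicator (J s r) z \<partial>lborel)
      = (\<integral>\<^sup>+ z. F z * indicator (J s t) z \<partial>lborel) + (\<integral>\<^sup>+ z. F z * indicator (J t r) z \<partial>lborel)"
    if "s \<le> t" "t \<le> r" for s t r
    using that by (subst nn_integral_add[symmetric]) (auto simp: J_def indicator_def intro!: nn_integral_cong)
  have "(\<integral>\<^sup>+ z. F z * indicator (J b' (b' + 2 * pi)) z \<partial>lborel)
      = (\<integral>\<^sup>+ z. F z * indicator (J b' (d + 2 * pi)) z \<partial>lborel)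
        + (\<integral>\<^sup>+ z. F z * indicator (J (d + 2 * pi) (b' + 2 * pi)) z \<partial>lborel)"
    using l by (intro join) (auto simp: d_def)
  also have "(\<integral>\<^sup>+ z. F z * indicator (J (d + 2 * pi) (b' + 2 * pi)) z \<partial>lborel)
      = (\<integral>\<^sup>+ z. F z * indicator (J d b') z \<partial>lborel)"
    using shift[of "d + 2 * pi" "b' + 2 * pi" 1] by simp
  also have "(\<integral>\<^sup>+ z. F z * indicator (J b' (d + 2 * pi)) z \<partial>lborel)
      + (\<integral>\<^sup>+ z. F z * indicator (J d b') z \<partial>lborel) = (\<integral>\<^sup>+ z. F z * indicator (J d (d + 2 * pi)) z \<partial>lborel)"
    using l by (subst join[of d b' "d + 2 * pi"]) (auto simp: d_def add.commute)
  also have "\<dots> = (\<integral>\<^sup>+ z. F z * indicator (J b (b + 2 * pi)) z \<partial>lborel)"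
    using shift[of d "d + 2 * pi" l] by (simp add: d_def)
  finally show ?thesis by (simp add: strip_def J_def)
qed

lemma bpar_periodic: "bpar e (z + (2 * pi * of_int l) *\<^sub>R axis j0 1) = bpar e z"
proof -
  let ?z = "z + (2 * pi * of_int l) *\<^sub>R axis j0 1"
  have r: "rsq_off j0 ?z = rsq_off j0 z"
    unfolding rsq_off_def by (intro sum.cong) (auto simp: axis_def)
  have "sph e (from_tangential ?z) = sph e (from_tangential z)"
    unfolding sph_def rsq_from_tangential r by (auto simp: vec_eq_iff axis_def)
  moreover have "emb (z $ j0 + 2 * pi * of_int l) 1 \<sigma> = emb (z $ j0) 1 \<sigma>" for \<sigma>
    using emb_shift[of "z $ j0" "2 * l" 1 \<sigma>] by (simp add: sg_def flip_1 mult_ac)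
  ultimately show ?thesis by (simp add: bpar_emb axis_def)
qed

lemma dens_periodic: "dens (z + (2 * pi * of_int l) *\<^sub>R axis j0 1) = dens z"
proof -
  have "rsq_off j0 (z + (2 * pi * of_int l) *\<^sub>R axis j0 1) = rsq_off j0 z"
    unfolding rsq_off_def by (intro sum.cong) (auto simp: axis_def)
  moreover have "cos (z $ j0 + 2 * pi * of_int l) = cos (z $ j0)"
    using cos_add_int_pi[of "z $ j0" "2 * l"] by (simp add: sg_def mult_ac)
  ultimately show ?thesis by (simp add: dens_def axis_def)
qed

section \<open>Comparison of the two stereographic parametrizations of the boundary\<close>

lemma bpar_inv_off:
  assumes "rsq_off j0 z \<noteq> 0"
  shows "bpar (-1) z = bpar 1 (inv_off j0 j1 z)"
proof -
  have "sph (-1) (from_tangential z) = sph 1 (from_tangential (inv_off j0 j1 z))"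
    unfolding vec_eq_iff
  proof
    fix j
    have "1 + rsq_off j0 z \<noteq> 0" using one_plus_rsq_off[of z] by linarith
    then show "sph (-1) (from_tangential z) $ j = sph 1 (from_tangential (inv_off j0 j1 z)) $ j"
      using assms by (cases "j = j0") (simp_all add: sph_def rsq_off_inv_off inv_off_nth divide_simps add.commute)
  qed
  then show ?thesis by (simp add: bpar_emb inv_off_nth)
qed

lemma dens_inv_off:
  assumes "rsq_off j0 z \<noteq> 0"
  shows "dens (inv_off j0 j1 z) * jac_off j0 z = dens z"
proof -
  have "1 + rsq_off j0 z \<noteq> 0" using one_plus_rsq_off[of z] by linarith
  then have eq: "2 / (1 + 1 / rsq_off j0 z) = 2 / (1 + rsq_off j0 z) * rsq_off j0 z"
    using assms by (simp add: divide_simps add.commute)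
  show ?thesis
    unfolding dens_def jac_off_def inv_off_nth rsq_off_inv_off eq power_mult_distrib using assms by simp
qed

lemma AE_rsq_off: "AE z in lborel. rsq_off j0 z \<noteq> 0"
  using null_rsq_off[OF j01] by (intro AE_I'[where N = "{z. rsq_off j0 z = 0}"]) auto

text \<open>The window has length pi and sits inside a strip of length 2 pi centred at c. A
  competing parameter differs by an even multiple m of pi with |m| < 2, so m = 0 and the strip
  contains each boundary point of the chart once.\<close>

lemma tangential_crd_image:
  assumes "pole e" "S \<subseteq> dom c e" "S \<subseteq> boundary atlas"
  shows "tangential ` crd c e ` S = {z \<in> strip (c - pi). bpar e z \<in> S}"
proof (intro set_eqI iffI)
  fix z assume "z \<in> tangential ` crd c e ` S"
  then obtain p where p: "p \<in> S" "z = tangential (crd c e p)" by auto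
  then obtain y \<sigma> where emb: "p = emb y 1 \<sigma>" using assms(3) by (auto simp: boundary_atlas)
  have d: "p \<in> dom c e" using p(1) assms(2) by blast
  then have "crd c e p $ None = 0" using boundary_crd[OF assms(1)] unfolding emb by metis
  then have f: "from_tangential z = crd c e p" by (simp add: p(2) from_tangential_tangential)
  then have "bpar e z = p" using par_crd(1)[OF assms(1) d] by (simp add: bpar_def)
  moreover have "z $ j0 = crd c e p $ Some j0" by (simp add: f[symmetric])
  then have "\<bar>z $ j0 - c\<bar> < pi / 2" using par_crd(2)[OF assms(1) d] by (simp add: win_def)
  then have "- (pi / 2) < z $ j0 - c" "z $ j0 - c < pi / 2" unfolding abs_less_iff by linarith+
  then have "z \<in> strip (c - pi)" using pi_gt_zero unfolding strip_def by auto
  ultimately show "z \<in> {z \<in> strip (c - pi). bpar e z \<in> S}" using p(1) by simp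
next
  fix z assume "z \<in> {z \<in> strip (c - pi). bpar e z \<in> S}"
  then have z: "z \<in> strip (c - pi)" "bpar e z \<in> S" by auto
  then have d: "bpar e z \<in> dom c e" using assms(2) by blast
  obtain m where m: "even m" "crd c e (bpar e z) $ Some j0 = z $ j0 + of_int m * pi"
    using boundary_crd[OF assms(1)] d unfolding bpar_emb by metis
  have w: "\<bar>z $ j0 + of_int m * pi - c\<bar> < pi / 2"
    using par_crd(2)[OF assms(1) d] m(2) by (simp add: win_def)
  moreover have "\<bar>z $ j0 - c\<bar> \<le> pi" using z(1) by (auto simp: strip_def abs_le_iff)
  ultimately have "\<bar>of_int m * pi\<bar> < 2 * pi" using pi_gt_zero by linarith
  then have "\<bar>of_int m\<bar> * pi < 2 * pi" by (simp add: abs_mult)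
  then have "\<bar>of_int m\<bar> < (2::real)" by (simp only: mult_less_cancel_right_pos pi_gt_zero)
  then have "\<bar>m\<bar> < 2" by linarith
  then have "m = 0" using m(1) by presburger
  then have "from_tangential z \<in> win c" using w by (simp add: win_def)
  then have "crd c e (bpar e z) = from_tangential z" unfolding bpar_def by (rule crd_par[OF assms(1)])
  then have "z = tangential (crd c e (bpar e z))" by simp
  then show "z \<in> tangential ` crd c e ` S" using z(2) by blast
qed

section \<open>Existence and uniqueness of the boundary measure\<close>

lemma space_bborel [simp]: "space bborel = boundary atlas"
  by (simp add: bborel_def space_restrict_space)

lemma sets_bvol [simp]: "sets bvol = sets bborel"
  by (simp add: bvol_def)

lemma space_bvol [simp]: "space bvol = boundary atlas"
  by (simp add: bvol_def)

text \<open>Periodicity moves the strip to the one centred at c. For the pole -1 an inversion is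
  applied in addition, under which density and Jacobian match.\<close>

lemma emeasure_bvol_chart:
  assumes e: "pole e" and S: "S \<in> sets bborel" "S \<subseteq> dom c e"
  shows "emeasure bvol S = (\<integral>\<^sup>+ z\<in>tangential ` crd c e ` S. ennreal (dens z) \<partial>lborel)"
proof -
  have Sb: "S \<subseteq> boundary atlas" using sets.sets_into_space[OF S(1)] by simp
  have pre [measurable]: "bpar e -` S \<in> sets borel" if "pole e" for e
    using measurable_sets[OF measurable_bpar[OF that] S(1)] by simp
  define F where "F z = ennreal (dens z) * indicator (bpar 1 -` S) z" for z
  have pre1 [measurable]: "bpar 1 -` S \<in> sets borel" by (rule pre) simp
  have F [measurable]: "F \<in> borel_measurable borel" unfolding F_def by measurable
  have "emeasure bvol S = emeasure (density lborel (\<lambda>z. ennreal (dens z * indicator (strip (- pi / 2)) z))) (bpar 1 -` S)"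
    unfolding bvol_def by (subst emeasure_distr) (simp_all add: S(1))
  also have "\<dots> = (\<integral>\<^sup>+ z. ennreal (dens z * indicator (strip (- pi / 2)) z) * indicator (bpar 1 -` S) z \<partial>lborel)"
    by (intro emeasure_density) simp_all
  also have "\<dots> = (\<integral>\<^sup>+ z. F z * indicator (strip (- pi / 2)) z \<partial>lborel)"
    by (intro nn_integral_cong) (simp add: F_def indicator_def)
  also have "\<dots> = (\<integral>\<^sup>+ z. F z * indicator (strip (c - pi)) z \<partial>lborel)"
    by (rule nn_integral_strip[OF F]) (simp add: F_def dens_periodic bpar_periodic indicator_def)
  also have "\<dots> = (\<integral>\<^sup>+ z. ennreal (dens z) * indicator {z \<in> strip (c - pi). bpar e z \<in> S} z \<partial>lborel)"
  proof (cases "e = 1")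
    case True
    then show ?thesis by (intro nn_integral_cong) (auto simp: F_def indicator_def)
  next
    case False
    then have e: "e = -1" using e by (simp add: pole_def)
    have "(\<integral>\<^sup>+ z. F z * indicator (strip (c - pi)) z \<partial>lborel)
        = (\<integral>\<^sup>+ z. F (inv_off j0 j1 z) * indicator (strip (c - pi)) (inv_off j0 j1 z) * ennreal (jac_off j0 z) \<partial>lborel)"
      by (rule nn_integral_inv_off[OF j01, symmetric]) measurable
    also have "\<dots> = (\<integral>\<^sup>+ z. ennreal (dens z) * indicator {z \<in> strip (c - pi). bpar e z \<in> S} z \<partial>lborel)"
    proof (rule nn_integral_cong_AE, use AE_rsq_off in eventually_elim)
      fix z assume r: "rsq_off j0 z \<noteq> 0"
      have "ennreal (dens (inv_off j0 j1 z)) * ennreal (jac_off j0 z) = ennreal (dens z)"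
        using dens_inv_off[OF r] by (simp add: ennreal_mult'[symmetric])
      then show "F (inv_off j0 j1 z) * indicator (strip (c - pi)) (inv_off j0 j1 z) * ennreal (jac_off j0 z)
          = ennreal (dens z) * indicator {z \<in> strip (c - pi). bpar e z \<in> S} z"
        by (auto simp: F_def indicator_def e bpar_inv_off[OF r] strip_def inv_off_nth)
    qed
    finally show ?thesis .
  qed
  also have "\<dots> = (\<integral>\<^sup>+ z\<in>tangential ` crd c e ` S. ennreal (dens z) \<partial>lborel)"
    by (simp add: tangential_crd_image[OF e S(2) Sb])
  finally show ?thesis .
qed

lemma boundary_subset_X: "boundary atlas \<subseteq> X"
  by (auto simp: boundary_atlas intro: emb_in_X)

lemma subtopology_boundary: "subtopology T (boundary atlas) = top_of_set (boundary atlas)"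
  unfolding T_def subtopology_subtopology using boundary_subset_X by (metis inf.absorb2)

lemma compact_boundary: "compact (boundary atlas)"
proof -
  have "boundary atlas = (\<lambda>(y, \<sigma>). emb y 1 \<sigma>) ` ({0..2 * pi} \<times> sphere 0 1)"
  proof
    show "boundary atlas \<subseteq> (\<lambda>(y, \<sigma>). emb y 1 \<sigma>) ` ({0..2 * pi} \<times> sphere 0 1)"
    proof
      fix p assume "p \<in> boundary atlas"
      then obtain y \<sigma> where p: "p = emb y 1 \<sigma>" "norm \<sigma> = 1" by (auto simp: boundary_atlas)
      define l where "l = - \<lfloor>y / (2 * pi)\<rfloor>"
      have "p = emb (y + of_int (2 * l) * pi) (sg (2 * l) * 1) (flip (sg (2 * l)) \<sigma>)"
        by (simp only: p(1) emb_shift)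
      then have "p = emb (y + of_int l * (2 * pi)) 1 \<sigma>"
        by (simp add: sg_def flip_1 mult_ac)
      moreover have "of_int \<lfloor>y / (2 * pi)\<rfloor> * (2 * pi) \<le> y" "y < (of_int \<lfloor>y / (2 * pi)\<rfloor> + 1) * (2 * pi)"
        using mult_right_mono[OF of_int_floor_le[of "y / (2 * pi)"], of "2 * pi"]
          mult_strict_right_mono[OF real_of_int_floor_add_one_gt[of "y / (2 * pi)"], of "2 * pi"] by simp_all
      then have "y + of_int l * (2 * pi) \<in> {0..2 * pi}"
        by (simp add: l_def distrib_right)
      ultimately show "p \<in> (\<lambda>(y, \<sigma>). emb y 1 \<sigma>) ` ({0..2 * pi} \<times> sphere 0 1)"
        using p(2) by (intro image_eqI[of _ _ "(y + of_int l * (2 * pi), \<sigma>)"]) auto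
    qed
  qed (auto intro: emb_in_boundary)
  moreover have "continuous_on S (\<lambda>(y, \<sigma>). emb y 1 \<sigma>)" for S
    unfolding split_beta by (intro continuous_on_emb continuous_intros)
  ultimately show ?thesis
    by (metis compact_Icc compact_Times compact_continuous_image compact_sphere)
qed

lemma sets_bborel: "sets bborel = sigma_sets (boundary atlas) {B. openin (subtopology T (boundary atlas)) B}"
proof -
  have "sets bborel = (\<inter>) (boundary atlas) ` sigma_sets UNIV {S. open S}"
    by (simp add: bborel_def sets_restrict_space borel_def)
  also have "\<dots> = sigma_sets (boundary atlas) ((\<inter>) (boundary atlas) ` {S. open S})"
  proof (rule sigma_sets_Int)
    have "boundary atlas \<in> sets borel"
      using compact_boundary by (intro borel_closed compact_imp_closed)
    then show "boundary atlas \<in> sigma_sets UNIV {S. open S}" by (simp add: borel_def)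
  qed simp
  also have "(\<inter>) (boundary atlas) ` {S. open S} = {B. openin (subtopology T (boundary atlas)) B}"
    unfolding subtopology_boundary openin_open by auto
  finally show ?thesis .
qed

lemma is_boundary_volume_bvol: "is_boundary_volume T atlas (\<lambda>c. met a) bvol"
  unfolding is_boundary_volume_def
proof (intro conjI ballI impI)
  show "space bvol = boundary atlas" by simp
  show "sets bvol = sigma_sets (boundary atlas) {B. openin (subtopology T (boundary atlas)) B}"
    by (simp add: sets_bborel)
  fix C B assume "C \<in> atlas" "B \<in> sets bvol" "B \<subseteq> fst C"
  then obtain c e where "C = chart c e" "pole e" "B \<in> sets bborel" "B \<subseteq> dom c e"
    by (auto simp: atlas_def)
  then show "emeasure bvol B = (\<integral>\<^sup>+ y\<in>tangential ` snd C ` B.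
      ennreal (sqrt (det (induced_metric (met a) (from_tangential y)))) \<partial>lborel)"
    by (simp add: emeasure_bvol_chart sqrt_det_induced_metric)
qed

text \<open>The local formula fixes the measure of sets inside one chart. Countably many charts
  cover the boundary, and making them disjoint splits any measurable set into such pieces.\<close>

lemma boundary_volume_unique:
  assumes "is_boundary_volume T atlas g \<mu>" "is_boundary_volume T atlas g \<nu>"
  shows "\<mu> = \<nu>"
proof (rule measure_eqI)
  show sets: "sets \<mu> = sets \<nu>" using assms by (simp add: is_boundary_volume_def)
  have sb: "sets \<mu> = sets bborel" using assms(1) by (simp add: is_boundary_volume_def sets_bborel)
  \<comment> \<open>The centres are the multiples of pi/2; rounding leaves a distance of at most
    pi/4, well inside the window. The Boolean selects the pole.\<close>
  define D where "D n = (case from_nat n of (i :: int, b :: bool) \<Rightarrow>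
      dom (of_int i * pi / 2) (if b then 1 else -1) \<inter> boundary atlas)" for n
  have D_chart: "\<exists>c e. pole e \<and> D n \<subseteq> dom c e" for n
    by (cases "from_nat n :: int \<times> bool") (auto simp: D_def intro: pole_1 split: if_splits)
  have D_sets: "D n \<in> sets \<mu>" for n
  proof -
    obtain c e where "D n = dom c e \<inter> boundary atlas"
      by (cases "from_nat n :: int \<times> bool") (auto simp: D_def)
    moreover have "openin (subtopology T (boundary atlas)) (dom c e \<inter> boundary atlas)"
      using openin_dom openin_subtopology by blast
    ultimately show ?thesis unfolding sb sets_bborel by (intro sigma_sets.Basic) simp
  qed
  have cover: "boundary atlas \<subseteq> (\<Union>n. D n)"
  proof
    fix p assume p: "p \<in> boundary atlas"
    then obtain y \<sigma> where emb: "p = emb y 1 \<sigma>" "norm \<sigma> = 1" by (auto simp: boundary_atlas)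
    define i where "i = round (y / (pi / 2))"
    define b where "b \<longleftrightarrow> \<sigma> $ j0 \<noteq> 1"
    have "\<bar>of_int i - y / (pi / 2)\<bar> \<le> 1 / 2" unfolding i_def by (rule of_int_round_abs_le)
    then have "\<bar>of_int i - y / (pi / 2)\<bar> * (pi / 2) \<le> 1 / 2 * (pi / 2)" by (intro mult_right_mono) auto
    moreover have "\<bar>of_int i - y / (pi / 2)\<bar> * (pi / 2) = \<bar>y - of_int i * pi / 2\<bar>"
    proof -
      have "\<bar>of_int i - y / (pi / 2)\<bar> * (pi / 2) = \<bar>(of_int i - y / (pi / 2)) * (pi / 2)\<bar>"
        by (simp only: abs_mult) simp
      also have "(of_int i - y / (pi / 2)) * (pi / 2) = of_int i * pi / 2 - y"
        by (simp add: left_diff_distrib)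
      finally show ?thesis by (simp add: abs_minus_commute)
    qed
    ultimately have "\<bar>y - of_int i * pi / 2\<bar> < pi / 2" using pi_gt_zero by linarith
    then have "p \<in> dom (of_int i * pi / 2) (if b then 1 else -1)"
      unfolding emb(1) using emb(2) by (intro emb_in_dom) (auto simp: b_def)
    then have "p \<in> D (to_nat (i, b))" using p by (simp add: D_def)
    then show "p \<in> (\<Union>n. D n)" by blast
  qed
  fix S assume S: "S \<in> sets \<mu>"
  define B where "B n = S \<inter> disjointed D n" for n
  have B_sets: "B n \<in> sets \<mu>" for n
  proof -
    have "range (disjointed D) \<subseteq> sets \<mu>" using D_sets by (intro sets.range_disjointed_sets) auto
    then show ?thesis unfolding B_def using S by (intro sets.Int) auto
  qed
  have "S \<subseteq> boundary atlas" using sets.sets_into_space[OF S] assms(1) by (simp add: is_boundary_volume_def)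
  then have B_UN: "(\<Union>n. B n) = S"
    unfolding B_def using cover UN_disjointed_eq[of D] by blast
  have B_disj: "disjoint_family B"
    unfolding B_def using disjoint_family_disjointed[of D] by (auto simp: disjoint_family_on_def)
  have "emeasure \<mu> (B n) = emeasure \<nu> (B n)" for n
  proof -
    obtain c e where ce: "pole e" "D n \<subseteq> dom c e" using D_chart by blast
    then have C: "chart c e \<in> atlas" "B n \<subseteq> fst (chart c e)"
      using disjointed_subset[of D n] by (auto simp: atlas_def B_def)
    have "emeasure m (B n) = (\<integral>\<^sup>+ y\<in>tangential ` snd (chart c e) ` B n.
        ennreal (sqrt (det (induced_metric (g (chart c e)) (from_tangential y)))) \<partial>lborel)"
      if "is_boundary_volume T atlas g m" "B n \<in> sets m" for m
      using that C unfolding is_boundary_volume_def by blast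
    from this[OF assms(1) B_sets] this[OF assms(2) B_sets[unfolded sets]] show ?thesis by (simp only:)
  qed
  then have "(\<Sum>n. emeasure \<mu> (B n)) = (\<Sum>n. emeasure \<nu> (B n))" by simp
  then show "emeasure \<mu> S = emeasure \<nu> S"
    using suminf_emeasure[of B \<mu>] suminf_emeasure[of B \<nu>] B_sets B_disj B_UN sets by (simp add: image_subset_iff)
qed

lemma boundary_volume_eq: "boundary_volume T atlas (\<lambda>c. met a) = bvol"
  unfolding boundary_volume_def
  by (rule the_equality[where a = bvol]) (use is_boundary_volume_bvol boundary_volume_unique in blast)+

text \<open>For \<open>rsq_off\<close> at most 1 the domain and the density are bounded. The rest is
  carried into this part by the inversion, which preserves the measure with density
  \<open>dens\<close>.\<close>

lemma nn_integral_dens_finite: "(\<integral>\<^sup>+ z. ennreal (dens z * indicator (strip b) z) \<partial>lborel) < \<infinity>"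
proof -
  define A where "A = strip b \<inter> {z. rsq_off j0 z \<le> 1}"
  have A [measurable]: "A \<in> sets borel" unfolding A_def by measurable
  define C where "C = exp ((N - 1) * \<delta>) * 2 ^ (CARD('m) - 1)"
  have le_C: "dens z \<le> C" for z
  proof -
    have "2 / (1 + rsq_off j0 z) \<le> 2" using rsq_off_nonneg[of j0 z] by (simp add: divide_le_eq)
    moreover have "0 \<le> 2 / (1 + rsq_off j0 z)" using one_plus_rsq_off[of z] by simp
    ultimately have "(2 / (1 + rsq_off j0 z)) ^ (CARD('m) - 1) \<le> 2 ^ (CARD('m) - 1)" by (intro power_mono)
    moreover have "(N - 1) * (\<delta> * cos (z $ j0)) \<le> (N - 1) * (\<delta> * 1)"
      using N_ge \<delta>_pos by (intro mult_left_mono) auto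
    ultimately show ?thesis unfolding dens_def C_def using one_plus_rsq_off[of z] by (intro mult_mono) auto
  qed
  let ?l = "\<chi> j. if j = j0 then b else -1" and ?u = "\<chi> j. if j = j0 then b + 2 * pi else 1"
  have "A \<subseteq> cbox ?l ?u"
  proof
    fix z assume z: "z \<in> A"
    have "\<bar>z $ j\<bar> \<le> 1" if "j \<noteq> j0" for j
    proof -
      have "(z $ j)\<^sup>2 \<le> rsq_off j0 z" unfolding rsq_off_def using that by (intro member_le_sum) auto
      then have "(z $ j)\<^sup>2 \<le> 1\<^sup>2" using z by (simp add: A_def)
      then show ?thesis by (simp add: abs_square_le_1)
    qed
    then show "z \<in> cbox ?l ?u" using z by (auto simp: mem_box_cart A_def strip_def abs_le_iff minus_le_iff)
  qed
  then have "emeasure lborel A \<le> emeasure lborel (cbox ?l ?u)" by (intro emeasure_mono) auto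
  also have "\<dots> < \<infinity>" by (rule emeasure_lborel_cbox_finite)
  finally have fin: "emeasure lborel A < \<infinity>" .
  have "(\<integral>\<^sup>+ z. ennreal (dens z) * indicator A z \<partial>lborel) \<le> (\<integral>\<^sup>+ z. ennreal C * indicator A z \<partial>lborel)"
    using le_C by (intro nn_integral_mono mult_right_mono ennreal_leI) auto
  also have "\<dots> = ennreal C * emeasure lborel A" by (simp add: nn_integral_cmult_indicator)
  also have "\<dots> < \<infinity>" using fin by (simp add: ennreal_mult_less_top)
  finally have inner: "(\<integral>\<^sup>+ z. ennreal (dens z) * indicator A z \<partial>lborel) < \<infinity>" .
  define H where "H z = ennreal (dens z) * indicator (strip b \<inter> {z. 0 < rsq_off j0 z \<and> rsq_off j0 z < 1}) z" for z
  have H [measurable]: "H \<in> borel_measurable borel" unfolding H_def by measurable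
  have "(\<integral>\<^sup>+ z. ennreal (dens z) * indicator (strip b \<inter> {z. 1 < rsq_off j0 z}) z \<partial>lborel)
      = (\<integral>\<^sup>+ z. H (inv_off j0 j1 z) * ennreal (jac_off j0 z) \<partial>lborel)"
  proof (rule nn_integral_cong)
    fix z
    show "ennreal (dens z) * indicator (strip b \<inter> {z. 1 < rsq_off j0 z}) z = H (inv_off j0 j1 z) * ennreal (jac_off j0 z)"
    proof (cases "1 < rsq_off j0 z")
      case True
      then have "ennreal (dens (inv_off j0 j1 z)) * ennreal (jac_off j0 z) = ennreal (dens z)"
        using dens_inv_off[of z] by (simp add: ennreal_mult'[symmetric])
      then show ?thesis using True by (auto simp: H_def indicator_def strip_def inv_off_nth rsq_off_inv_off)
    next
      case False
      then have "\<not> (0 < 1 / rsq_off j0 z \<and> 1 / rsq_off j0 z < 1)"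
        using rsq_off_nonneg[of j0 z] by (auto simp: field_simps)
      then show ?thesis using False by (auto simp: H_def indicator_def rsq_off_inv_off)
    qed
  qed
  also have "\<dots> = (\<integral>\<^sup>+ z. H z \<partial>lborel)" by (rule nn_integral_inv_off[OF j01 H])
  also have "\<dots> \<le> (\<integral>\<^sup>+ z. ennreal (dens z) * indicator A z \<partial>lborel)"
    by (intro nn_integral_mono) (auto simp: H_def A_def indicator_def)
  finally have outer: "(\<integral>\<^sup>+ z. ennreal (dens z) * indicator (strip b \<inter> {z. 1 < rsq_off j0 z}) z \<partial>lborel) < \<infinity>"
    using inner by (rule le_less_trans)
  have "(\<integral>\<^sup>+ z. ennreal (dens z * indicator (strip b) z) \<partial>lborel)
      = (\<integral>\<^sup>+ z. ennreal (dens z) * indicator A z + ennreal (dens z) * indicator (strip b \<inter> {z. 1 < rsq_off j0 z}) z \<partial>lborel)"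
    by (intro nn_integral_cong) (auto simp: A_def indicator_def)
  also have "\<dots> = (\<integral>\<^sup>+ z. ennreal (dens z) * indicator A z \<partial>lborel)
      + (\<integral>\<^sup>+ z. ennreal (dens z) * indicator (strip b \<inter> {z. 1 < rsq_off j0 z}) z \<partial>lborel)"
    by (intro nn_integral_add) measurable
  finally show ?thesis using inner outer by (simp add: ennreal_add_less_top)
qed

section \<open>The integral of the mean curvature\<close>

definition total :: real where
  "total = (LINT z|lborel. dens z * indicator (strip (- pi / 2)) z * mean_curv (z $ j0))"

lemma borel_measurable_mean_curv [measurable]: "mean_curv \<in> borel_measurable borel"
  unfolding mean_curv_def[abs_def] by (intro borel_measurable_continuous_onI continuous_intros)

lemma integrable_dens: "integrable lborel (\<lambda>z. dens z * indicator (strip b) z)"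
  by (rule integrableI_nonneg) (use nn_integral_dens_finite in auto)

lemma integrable_dens_mean_curv: "integrable lborel (\<lambda>z. dens z * indicator (strip b) z * mean_curv (z $ j0))"
proof (rule Bochner_Integration.integrable_bound[OF integrable_mult_right[OF integrable_dens]])
  show "AE z in lborel. norm (dens z * indicator (strip b) z * mean_curv (z $ j0))
      \<le> norm ((N - 1) * \<delta> * exp (N / 2 * \<delta>) * (dens z * indicator (strip b) z))"
  proof (rule AE_I2)
    fix z
    have "norm (dens z * indicator (strip b) z * mean_curv (z $ j0)) = (dens z * indicator (strip b) z) * \<bar>mean_curv (z $ j0)\<bar>"
      by (simp add: abs_mult)
    also have "\<dots> \<le> (dens z * indicator (strip b) z) * ((N - 1) * \<delta> * exp (N / 2 * \<delta>))"
      by (intro mult_left_mono abs_mean_curv_le) simp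
    also have "\<dots> \<le> norm ((N - 1) * \<delta> * exp (N / 2 * \<delta>) * (dens z * indicator (strip b) z))"
      by (simp add: mult.commute)
    finally show "norm (dens z * indicator (strip b) z * mean_curv (z $ j0))
      \<le> norm ((N - 1) * \<delta> * exp (N / 2 * \<delta>) * (dens z * indicator (strip b) z))" .
  qed
qed measurable

text \<open>The shift \<open>y \<mapsto> y + \<pi>\<close> changes the sign of \<open>cos y\<close>, so the integrals over the two halves of
  the boundary combine to that of \<open>f (exp (c f) - exp (- c f))\<close> with \<open>f = \<delta> cos y\<close> and \<open>c = (n - 2) / 2\<close>.\<close>

lemma total_pos: "0 < total"
proof -
  define A where "A = {z :: real ^ 'm. - pi / 2 \<le> z $ j0 \<and> z $ j0 < pi / 2}"
  define B where "B = {z :: real ^ 'm. pi / 2 \<le> z $ j0 \<and> z $ j0 < 3 * pi / 2}"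
  have [measurable]: "A \<in> sets borel" "B \<in> sets borel" unfolding A_def B_def by measurable
  define G where "G z = dens z * mean_curv (z $ j0)" for z
  have [measurable]: "G \<in> borel_measurable borel" unfolding G_def by measurable
  define t :: "real ^ 'm" where "t = pi *\<^sub>R axis j0 1"
  have int: "integrable lborel (\<lambda>z. G z * indicator (strip (- pi / 2)) z)"
    using integrable_dens_mean_curv[of "- pi / 2"] by (simp add: G_def mult_ac)
  have sub: "integrable lborel (\<lambda>z. G z * indicator U z)" if [measurable]: "U \<in> sets borel" and "U \<subseteq> strip (- pi / 2)" for U
    using that(2) by (intro Bochner_Integration.integrable_bound[OF int]) (auto simp: indicator_def)
  have AB: "A \<subseteq> strip (- pi / 2)" "B \<subseteq> strip (- pi / 2)"
    using pi_gt_zero by (auto simp: A_def B_def strip_def)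
  have iA: "integrable lborel (\<lambda>z. G z * indicator A z)" and iB: "integrable lborel (\<lambda>z. G z * indicator B z)"
    using sub AB by simp_all
  have Bt: "indicator B (z + t) = (indicator A z :: real)" for z
    by (auto simp: indicator_def A_def B_def t_def axis_def)
  have iBt: "integrable lborel (\<lambda>z. G (z + t) * indicator A z)"
    using integral_lborel_shift(2)[of "\<lambda>z. G z * indicator B z" t] iB by (simp add: Bt)
  have "total = (LINT z|lborel. G z * indicator A z + G z * indicator B z)"
    unfolding total_def
    by (intro Bochner_Integration.integral_cong) (auto simp: G_def A_def B_def strip_def indicator_def)
  also have "\<dots> = (LINT z|lborel. G z * indicator A z) + (LINT z|lborel. G z * indicator B z)"
    by (rule Bochner_Integration.integral_add[OF iA iB])
  also have "(LINT z|lborel. G z * indicator B z) = (LINT z|lborel. G (z + t) * indicator A z)"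
    using integral_lborel_shift(1)[of "\<lambda>z. G z * indicator B z" t] by (simp add: Bt)
  also have "(LINT z|lborel. G z * indicator A z) + \<dots> = (LINT z|lborel. G z * indicator A z + G (z + t) * indicator A z)"
    by (rule Bochner_Integration.integral_add[OF iA iBt, symmetric])
  finally have tot: "total = (LINT z|lborel. G z * indicator A z + G (z + t) * indicator A z)" .
  have pos: "0 < G z + G (z + t)" if "0 < cos (z $ j0)" for z
  proof -
    define f where "f = \<delta> * cos (z $ j0)"
    define W where "W = (N - 1) * (2 / (1 + rsq_off j0 z)) ^ (CARD('m) - 1)"
    have f: "f > 0" using that \<delta>_pos by (simp add: f_def)
    have W: "W > 0" using N_ge one_plus_rsq_off[of z] by (simp add: W_def)
    have r: "rsq_off j0 (z + t) = rsq_off j0 z" unfolding rsq_off_def t_def by (intro sum.cong) (auto simp: axis_def)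
    have c: "cos ((z + t) $ j0) = - cos (z $ j0)" by (simp add: t_def axis_def)
    have "G z = W * f * (exp ((N - 1) * f) * exp (- (N / 2 * f)))"
      by (simp add: G_def dens_def mean_curv_def W_def f_def)
    also have "exp ((N - 1) * f) * exp (- (N / 2 * f)) = exp ((N / 2 - 1) * f)"
      by (simp add: exp_add[symmetric] algebra_simps)
    finally have 1: "G z = W * f * exp ((N / 2 - 1) * f)" .
    have "G (z + t) = W * (- f) * (exp ((N - 1) * (- f)) * exp (- (N / 2 * (- f))))"
      unfolding G_def dens_def mean_curv_def c r by (simp add: W_def f_def)
    also have "exp ((N - 1) * (- f)) * exp (- (N / 2 * (- f))) = exp (- ((N / 2 - 1) * f))"
      by (simp add: exp_add[symmetric] algebra_simps)
    finally have 2: "G (z + t) = - (W * f * exp (- ((N / 2 - 1) * f)))" by simp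
    have "0 < (N / 2 - 1) * f" using N_ge f by simp
    then have "exp (- ((N / 2 - 1) * f)) < exp ((N / 2 - 1) * f)" by simp
    then have "W * f * exp (- ((N / 2 - 1) * f)) < W * f * exp ((N / 2 - 1) * f)"
      using W f by (intro mult_strict_left_mono) auto
    then show ?thesis unfolding 1 2 by linarith
  qed
  have nonneg: "0 \<le> G z * indicator A z + G (z + t) * indicator A z" for z
  proof (cases "z \<in> A \<and> z $ j0 \<noteq> - pi / 2")
    case True
    then have "0 < cos (z $ j0)" by (intro cos_gt_zero_pi) (auto simp: A_def)
    then show ?thesis using pos[of z] by (simp add: indicator_def)
  next
    case False
    then show ?thesis
    proof (cases "z \<in> A")
      case True
      with False have "z $ j0 = - pi / 2" by simp
      then show ?thesis by (simp add: G_def mean_curv_def t_def axis_def)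
    qed simp
  qed
  \<comment> \<open>A nonnegative integrand with integral 0 vanishes almost everywhere, but this one
    is positive on a nonempty open strip.\<close>
  have "total \<noteq> 0"
  proof
    assume "total = 0"
    then have "AE z in lborel. G z * indicator A z + G (z + t) * indicator A z = 0"
      unfolding tot using integral_nonneg_eq_0_iff_AE[OF Bochner_Integration.integrable_add[OF iA iBt]] nonneg by simp
    then have "AE z in lborel. z \<notin> {z. - pi / 2 < z $ j0 \<and> z $ j0 < pi / 2}"
    proof eventually_elim
      case (elim z)
      show ?case
      proof
        assume z: "z \<in> {z. - pi / 2 < z $ j0 \<and> z $ j0 < pi / 2}"
        then have "0 < cos (z $ j0)" by (intro cos_gt_zero_pi) auto
        then show False using pos[of z] elim z by (simp add: A_def)
      qed
    qed
    moreover have op: "open {z :: real ^ 'm. - pi / 2 < z $ j0 \<and> z $ j0 < pi / 2}"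
      by (intro open_Collect_conj open_Collect_less continuous_intros)
    ultimately have "{z :: real ^ 'm. - pi / 2 < z $ j0 \<and> z $ j0 < pi / 2} \<in> null_sets lborel"
      by (subst (asm) AE_iff_null_sets[symmetric]) auto
    then have "negligible {z :: real ^ 'm. - pi / 2 < z $ j0 \<and> z $ j0 < pi / 2}"
      unfolding negligible_iff_null_sets by (rule null_sets_completionI)
    moreover have "0 \<in> {z :: real ^ 'm. - pi / 2 < z $ j0 \<and> z $ j0 < pi / 2}" by simp
    ultimately show False using open_not_negligible[OF op] by blast
  qed
  moreover have "0 \<le> total" unfolding tot using nonneg by (intro integral_nonneg_AE) simp
  ultimately show ?thesis by simp
qed

lemma integral_mean_curvature:
  assumes "a > 0"
  shows "(LINT p|boundary_volume T atlas (\<lambda>c. met a). mean_curvature atlas (\<lambda>c. met a) p) = total / a"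
proof -
  let ?M = "density lborel (\<lambda>z. ennreal (dens z * indicator (strip (- pi / 2)) z))"
  \<comment> \<open>On the boundary x = 1 this polynomial in the embedding coordinates is cos y, so
    the mean curvature is the restriction of a continuous function and hence measurable.\<close>
  define cosb where "cosb p = (p 2 + p 2 * p 0 + p 3 * p 1) / 2" for p :: "nat \<Rightarrow> real"
  have mc: "mean_curvature atlas (\<lambda>c. met a) (bpar 1 z) = mean_curv (z $ j0) / a" for z
    unfolding bpar_emb using assms by (intro mean_curvature_emb norm_sph) simp_all
  have "(LINT p|bvol. mean_curvature atlas (\<lambda>c. met a) p) = (LINT z|?M. mean_curvature atlas (\<lambda>c. met a) (bpar 1 z))"
    unfolding bvol_def
  proof (rule integral_distr)
    show "mean_curvature atlas (\<lambda>c. met a) \<in> borel_measurable bborel"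
    proof (subst measurable_cong)
      fix p assume "p \<in> space bborel"
      then obtain y \<sigma> where p: "p = emb y 1 \<sigma>" "norm \<sigma> = 1" by (auto simp: boundary_atlas)
      have cs: "cos y * cos y = 1 - sin y * sin y"
        using sin_cos_squared_add[of y] by (simp add: power2_eq_square)
      have "(1 * cos y - s * sin y) + (1 * cos y - s * sin y) * cos (2 * y)
          + (1 * sin y + s * cos y) * sin (2 * y) = 2 * cos y" for s
        unfolding cos_double sin_double power2_eq_square using cs by algebra
      then have "cosb p = cos y" unfolding cosb_def p(1) emb_simps by simp
      then show "mean_curvature atlas (\<lambda>c. met a) p
          = (N - 1) * (\<delta> * cosb p) * exp (- (N / 2 * (\<delta> * cosb p))) / a"
        unfolding p(1) by (simp add: mean_curvature_emb p(2) assms mean_curv_def)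
    next
      have "continuous_on UNIV (\<lambda>p. (N - 1) * (\<delta> * cosb p) * exp (- (N / 2 * (\<delta> * cosb p))) / a)"
        unfolding cosb_def using assms by (intro continuous_intros) auto
      then show "(\<lambda>p. (N - 1) * (\<delta> * cosb p) * exp (- (N / 2 * (\<delta> * cosb p))) / a) \<in> borel_measurable bborel"
        unfolding bborel_def by (intro measurable_restrict_space1 borel_measurable_continuous_onI)
    qed
  qed simp
  also have "\<dots> = (LINT z|?M. mean_curv (z $ j0) / a)" by (simp add: mc)
  also have "\<dots> = (LINT z|lborel. (dens z * indicator (strip (- pi / 2)) z) *\<^sub>R (mean_curv (z $ j0) / a))"
    by (intro integral_density) auto
  also have "\<dots> = (LINT z|lborel. dens z * indicator (strip (- pi / 2)) z * mean_curv (z $ j0) / a)"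
    by simp
  also have "\<dots> = total / a" unfolding total_def by (rule integral_divide_zero)
  finally show ?thesis by (simp add: boundary_volume_eq)
qed

end

section \<open>The theorem\<close>

theorem theorem1:
  fixes n :: nat
  assumes "n = CARD('m::finite) + 1" and "n \<ge> 3"
  shows "\<exists>(T :: (nat \<Rightarrow> real) topology) (A :: (nat \<Rightarrow> real, 'm) chart set)
          (g :: real \<Rightarrow> (nat \<Rightarrow> real, 'm) metric_components).
     spin_manifold T A \<and> compact_space T \<and> connected_space T \<and>
     boundary A \<noteq> {} \<and> connectedin T (boundary A) \<and>
     (\<forall>a>0. riemannian_metric A (g a)) \<and>
     (\<exists>C. \<forall>a>0. \<forall>p\<in>topspace T. \<bar>scal A (g a) p\<bar> \<le> C) \<and>
     (\<forall>a>0. \<forall>b>0. \<forall>c\<in>A. \<forall>p\<in>fst c \<inter> boundary A.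
        induced_metric (g a c) (snd c p) = induced_metric (g b c) (snd c p)) \<and>
     filterlim (\<lambda>a. LINT p|boundary_volume T A (g a). mean_curvature A (g a) p)
       at_top (at_right 0) \<and>
     filterlim (\<lambda>a. INF p\<in>boundary A. mean_curvature A (g a) p) at_bot (at_right 0) \<and>
     (n \<ge> 5 \<longrightarrow> (\<exists>\<epsilon>>0. \<forall>a>0. \<forall>p\<in>topspace T. scal A (g a) p \<ge> \<epsilon>))"
proof -
  \<comment> \<open>The dimension bound n >= 3 supplies two tangential indices: \<open>j0\<close>
    for the circle and \<open>j1\<close> for the direction that the gluing map reflects.\<close>
  have "\<not> CARD('m) \<le> Suc 0" using assms by simp
  then obtain j0 j1 :: 'm where "j0 \<noteq> j1"
    by (auto simp: card_le_Suc0_iff_eq)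
  then interpret twisted_slab j0 j1 by unfold_locales
  have N: "N = real n" by (simp add: N_def assms(1))
  show ?thesis
  proof (intro exI[of _ T] exI[of _ atlas] exI[of _ "\<lambda>a c. met a"] conjI)
    show "spin_manifold T atlas" by (rule spin_manifold_T)
    show "compact_space T" using compact_X by (simp add: T_def compact_space_subtopology)
    show "connected_space T" using connected_X by (simp add: T_def connected_space_subtopology)
    show "boundary atlas \<noteq> {}" by (rule boundary_nonempty)
    show "connectedin T (boundary atlas)" by (rule connected_boundary)
    show "\<forall>a>0. riemannian_metric atlas (\<lambda>c. met a)" by (simp add: riemannian_metric_met)
    show "\<exists>C. \<forall>a>0. \<forall>p\<in>topspace T. \<bar>scal atlas (\<lambda>c. met a) p\<bar> \<le> C"
      using scal_bounded by auto
    show "\<forall>a>0. \<forall>b>0. \<forall>c\<in>atlas. \<forall>p\<in>fst c \<inter> boundary atlas.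
        induced_metric (met a) (snd c p) = induced_metric (met b) (snd c p)"
      by (simp add: induced_metric_met)
    show "filterlim (\<lambda>a. LINT p|boundary_volume T atlas (\<lambda>c. met a). mean_curvature atlas (\<lambda>c. met a) p)
        at_top (at_right 0)"
    proof -
      have "filterlim (\<lambda>a. total * inverse a) at_top (at_right 0)"
        by (intro filterlim_tendsto_pos_mult_at_top[OF tendsto_const total_pos] filterlim_inverse_at_top_right)
      moreover have "\<forall>\<^sub>F a in at_right 0. (LINT p|boundary_volume T atlas (\<lambda>c. met a).
          mean_curvature atlas (\<lambda>c. met a) p) = total * inverse a"
        by (rule eventually_at_rightI[of 0 1]) (simp_all add: integral_mean_curvature divide_inverse)
      ultimately show ?thesis by (simp add: filterlim_cong)
    qed
    show "filterlim (\<lambda>a. INF p\<in>boundary atlas. mean_curvature atlas (\<lambda>c. met a) p) at_bot (at_right 0)"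
      by (rule INF_mean_curvature)
    show "n \<ge> 5 \<longrightarrow> (\<exists>\<epsilon>>0. \<forall>a>0. \<forall>p\<in>topspace T. scal atlas (\<lambda>c. met a) p \<ge> \<epsilon>)"
    proof
      assume "n \<ge> 5"
      then have "scal atlas (\<lambda>c. met a) p \<ge> exp (- 2 * \<delta>)" if "p \<in> X" for a p
        using that by (intro scal_ge) (simp_all add: N)
      then show "\<exists>\<epsilon>>0. \<forall>a>0. \<forall>p\<in>topspace T. scal atlas (\<lambda>c. met a) p \<ge> \<epsilon>"
        by (intro exI[of _ "exp (- 2 * \<delta>)"]) simp
    qed
  qed
qed

end
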